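(* Let $\beta>0$ and $\tau_1,\tau_2>0$ be fixed, and for $i\in\{L,G,J\}$ let $X_n^{i,\beta}:=\log(\det W_n^{i,\beta})-\mu^i_{\beta,n}$. Let $(a,b)$ be a fixed interval with $a<b$. For every $-\frac12<\delta<1$ and each $i\in\{L,G,J\}$, $$\lim_{n\to\infty}\left(\frac{2\log n}\beta\right)^{\delta+\frac12}\mathbb{P}\left(X_n^{i,\beta}\in\left(\frac\beta{2\log n}\right)^\delta(a,b)\right)=\frac{b-a}{\sqrt{2\pi}}.$$
   Context: Random determinants. (L) $\det W_n^{L,\beta}=\prod_{k=1}^n\lambda_k$, where $(\lambda_1,\dots,\lambda_n)$ has density on $(0,\infty)^n$ proportional to $\prod_{j<k}|\lambda_k-\lambda_j|^\beta\prod_{k=1}^n\lambda_k^{\beta/2-1}e^{-\lambda_k/2}$ ($\beta$-Laguerre ensemble). (G) $\det W_n^{G,\beta}$ is a random variable distributed as $\prod_{k=2}^n\rho_k$ with $\rho_k$ independent, $\rho_k\sim\mathrm{Beta}\left(\frac\beta2(n-k+1),\frac\beta2(k-1)\right)$ ($\beta$-Uniform Gram ensemble). (J) With $n_1=\lfloor n\tau_1\rfloor$, $n_2=\lfloor n\tau_2\rfloor$, $m=\min(n_1,n_2)$, $M=\max(n_1,n_2)$: $\det W_n^{J,\beta}=\prod_{k=1}^m\lambda_k$, where $(\lambda_1,\dots,\lambda_m)$ has density on $(0,1)^m$ proportional to $\prod_{j<k}|\lambda_k-\lambda_j|^\beta\prod_{k=1}^m\lambda_k^{\beta/2-1}(1-\lambda_k)^{\frac\beta2(M-m+1)-1}$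 ($\beta$-Jacobi ensemble). Centerings: $\mu^L_{\beta,n}=(\frac12-\frac1\beta)\log n-n+n\log(\beta n)$; $\mu^G_{\beta,n}=(\frac12-\frac1\beta)\log n-n+\frac1\beta$; $\mu^J_{\beta,n}=(\frac12-\frac1\beta)\log n+(\frac12-\frac1\beta)\log\left(\frac{\tau_1\tau_2}{\tau_1+\tau_2}\right)-\varepsilon(\lfloor n\tau_1\rfloor,\lfloor n\tau_2\rfloor)-\varepsilon(\lfloor n\tau_2\rfloor,\lfloor n\tau_1\rfloor)$ with $\varepsilon(x,y)=x\log(1+\frac yx)$. For $c>0$, $c(a,b)$ denotes the interval $(ca,cb)$. *)

theory Defs
  imports "HOL-Probability.Probability"
begin

text \<open>
  On a probability space the constant is necessarily the inverse of the total mass of \<open>w\<close>.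
\<close>

definition has_density_proportional_to ::
    "'w measure \<Rightarrow> 'a measure \<Rightarrow> ('w \<Rightarrow> 'a) \<Rightarrow> ('a \<Rightarrow> real) \<Rightarrow> bool" where
  "has_density_proportional_to P N X w \<longleftrightarrow>
     (\<exists>c>0. distributed P N X (\<lambda>x. ennreal (c * w x)))"

definition abs_vandermonde :: "nat \<Rightarrow> (nat \<Rightarrow> real) \<Rightarrow> real" where
  "abs_vandermonde n x = (\<Prod>k\<in>{1..n}. \<Prod>j\<in>{1..<k}. \<bar>x k - x j\<bar>)"

definition laguerre_weight :: "real \<Rightarrow> nat \<Rightarrow> (nat \<Rightarrow> real) \<Rightarrow> real" where
  "laguerre_weight \<beta> n x =
     (if \<forall>k\<in>{1..n}. 0 < x k
      then abs_vandermonde n x powr \<beta>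
           * (\<Prod>k\<in>{1..n}. x k powr (\<beta> / 2 - 1) * exp (- x k / 2))
      else 0)"

definition jacobi_weight :: "real \<Rightarrow> nat \<Rightarrow> nat \<Rightarrow> (nat \<Rightarrow> real) \<Rightarrow> real" where
  "jacobi_weight \<beta> m M x =
     (if \<forall>k\<in>{1..m}. 0 < x k \<and> x k < 1
      then abs_vandermonde m x powr \<beta>
           * (\<Prod>k\<in>{1..m}. x k powr (\<beta> / 2 - 1)
                * (1 - x k) powr (\<beta> / 2 * (real M - real m + 1) - 1))
      else 0)"

definition beta_density :: "real \<Rightarrow> real \<Rightarrow> real \<Rightarrow> real" where
  "beta_density p q x =
     (if 0 < x \<and> x < 1 then x powr (p - 1) * (1 - x) powr (q - 1) / Beta p q else 0)"

datatype ensemble = Laguerre | Gram | Jacobi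

text \<open>
  \<open>ensemble_det i \<beta> \<tau>1 \<tau>2 n P D\<close> says that the real random variable \<open>D\<close> on the
  probability space \<open>P\<close> is the determinant of a matrix of size parameter \<open>n\<close> from the
  ensemble \<open>i\<close>. In the Laguerre and Jacobi cases \<open>D\<close> is the product of the coordinates of
  a random vector on \<open>P\<close> with the eigenvalue density. In the Gram case only the law of \<open>D\<close>
  is prescribed, so the independent Beta variables may live on another space \<open>Q\<close>, whose
  type is immaterial. The parameters \<open>\<tau>1\<close>, \<open>\<tau>2\<close> matter only in the Jacobi case.
\<close>

fun ensemble_det ::
    "ensemble \<Rightarrow> real \<Rightarrow> real \<Rightarrow> real \<Rightarrow> nat \<Rightarrow> 'w measure \<Rightarrow> ('w \<Rightarrow> real) \<Rightarrow> bool" where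
  "ensemble_det Laguerre \<beta> \<tau>1 \<tau>2 n P D \<longleftrightarrow>
     (\<exists>\<Lambda>. has_density_proportional_to P (\<Pi>\<^sub>M k\<in>{1..n}. lborel) \<Lambda> (laguerre_weight \<beta> n)
        \<and> (\<forall>\<omega>\<in>space P. D \<omega> = (\<Prod>k\<in>{1..n}. \<Lambda> \<omega> k)))"
| "ensemble_det Gram \<beta> \<tau>1 \<tau>2 n P D \<longleftrightarrow>
     D \<in> borel_measurable P
     \<and> (\<exists>(Q :: (nat \<Rightarrow> real) measure) \<rho>.
          prob_space Q
          \<and> prob_space.indep_vars Q (\<lambda>_. borel) \<rho> {2..n}
          \<and> (\<forall>k\<in>{2..n}. distributed Q lborel (\<rho> k)
               (\<lambda>x. ennreal (beta_density (\<beta> / 2 * (real n - real k + 1)) (\<beta> / 2 * (real k - 1)) x)))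
          \<and> distr P borel D = distr Q borel (\<lambda>\<omega>. \<Prod>k\<in>{2..n}. \<rho> k \<omega>))"
| "ensemble_det Jacobi \<beta> \<tau>1 \<tau>2 n P D \<longleftrightarrow>
     (let n1 = nat \<lfloor>real n * \<tau>1\<rfloor>; n2 = nat \<lfloor>real n * \<tau>2\<rfloor>; m = min n1 n2; M = max n1 n2
      in \<exists>\<Lambda>. has_density_proportional_to P (\<Pi>\<^sub>M k\<in>{1..m}. lborel) \<Lambda> (jacobi_weight \<beta> m M)
           \<and> (\<forall>\<omega>\<in>space P. D \<omega> = (\<Prod>k\<in>{1..m}. \<Lambda> \<omega> k)))"

text \<open>
  If \<open>x = 0\<close> (which for \<open>x = \<lfloor>n \<tau>\<rfloor>\<close> happens for only finitely many \<open>n\<close>), division by zero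
  makes \<open>eps x y = 0\<close>, the limit of \<open>x ln (1 + y / x)\<close> as \<open>x\<close> tends to 0 from above.
\<close>

definition eps :: "real \<Rightarrow> real \<Rightarrow> real" where
  "eps x y = x * ln (1 + y / x)"

fun centering :: "ensemble \<Rightarrow> real \<Rightarrow> real \<Rightarrow> real \<Rightarrow> nat \<Rightarrow> real" where
  "centering Laguerre \<beta> \<tau>1 \<tau>2 n =
     (1 / 2 - 1 / \<beta>) * ln (real n) - real n + real n * ln (\<beta> * real n)"
| "centering Gram \<beta> \<tau>1 \<tau>2 n =
     (1 / 2 - 1 / \<beta>) * ln (real n) - real n + 1 / \<beta>"
| "centering Jacobi \<beta> \<tau>1 \<tau>2 n =
     (1 / 2 - 1 / \<beta>) * ln (real n)
     + (1 / 2 - 1 / \<beta>) * ln (\<tau>1 * \<tau>2 / (\<tau>1 + \<tau>2))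
     - eps (of_int \<lfloor>real n * \<tau>1\<rfloor>) (of_int \<lfloor>real n * \<tau>2\<rfloor>)
     - eps (of_int \<lfloor>real n * \<tau>2\<rfloor>) (of_int \<lfloor>real n * \<tau>1\<rfloor>)"

end

theory Submission
  imports Defs "HOL-Real_Asymp.Real_Asymp"
begin

text \<open>
  Write \<open>Y = ln det W\<close>. The proof computes the Mellin transform \<open>E exp (z Y)\<close> on the imaginary
  axis exactly, as a quotient of Gamma functions, and then reads off a local limit theorem from
  Fourier inversion.

  \<^bold>\<open>Mellin transform.\<close> The moments of a determinant are quotients of Selberg-type integrals.
  Aomoto's integration by parts shows that they satisfy a first-order recursion
  \<open>E exp ((z + 1) Y) = R z * E exp (z Y)\<close> with a rational function \<open>R\<close>; it is valid for complex
  \<open>z\<close> with nonnegative real part (\<open>aomoto_recursion\<close>). The integrand \<open>\<bar>\<Delta>\<bar> powr \<beta>\<close> is not smooth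
  where two coordinates meet, so \<open>\<Delta>\<^sup>2\<close> is first replaced by \<open>\<Delta>\<^sup>2 + \<epsilon>\<close>; every integral is then
  absolutely convergent, and \<open>\<epsilon>\<close> tends to \<open>0\<close> after the singular terms have been symmetrised away.
  Aomoto's argument for one variable gives the same recursion for the Beta factors of the Gram
  ensemble. A recursion alone determines the transform only up to a periodic factor, and the tilted
  laws with density proportional to \<open>exp (N Y)\<close> remove this freedom: \<open>Y\<close> concentrates under them at
  \<open>ln (R N)\<close>, so \<open>E exp (i t Y)\<close> is the limit of explicit finite products
  (\<open>mellin_recursion_char\<close>). In all three cases the result is
  \<open>C powr (i t)\<close> times the product over \<open>k \<le> K\<close> of \<open>\<Gamma>(k \<beta> / 2 + i t) / \<Gamma>(k \<beta> / 2)\<close>, divided by a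
  product of such ratios with larger parameters (no such divisor for Laguerre).

  \<^bold>\<open>Gaussian behaviour.\<close> Taylor expansion of \<open>ln \<Gamma>\<close> at \<open>k \<beta> / 2\<close> yields a mean
  \<open>\<Sum> \<psi>(k \<beta> / 2)\<close> and a variance \<open>\<Sum> \<psi>'(k \<beta> / 2)\<close>, each minus the analogous
  sum over the parameters of the divisor (and the mean shifted by \<open>ln C\<close>), and an error \<open>O(\<bar>t\<bar>\<^sup>3)\<close> that is uniform in \<open>n\<close>,
  because \<open>\<psi>''\<close> is \<open>O(1 / k\<^sup>2)\<close>. The variance is \<open>v + O(1)\<close> with \<open>v = (2 / \<beta>) ln n\<close>, and by
  Stirling's formula the mean is the stated centering up to \<open>O(1)\<close>; since \<open>v\<close> tends to infinity,
  bounded errors vanish after rescaling by \<open>sqrt v\<close>.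

  \<^bold>\<open>Local limit.\<close> The modulus of each Gamma ratio is an explicit infinite product, which gives
  \<open>\<bar>E exp (i t Y)\<bar> \<le> 1 / (1 + v t\<^sup>2 / 16)\<close> for all real \<open>t\<close> and all large \<open>n\<close>
  (\<open>gamma_ratio_quotient_decay\<close>). After the substitution \<open>t = u / sqrt v\<close> this is an integrable
  majorant independent of \<open>n\<close>, so dominated convergence in Levy's inversion formula applies to
  intervals of every length \<open>v powr (- \<delta>) * (b - a)\<close> with \<open>\<delta> > - 1 / 2\<close>
  (\<open>local_limit_from_char\<close>).
\<close>

section \<open>One-dimensional weights and the smoothed discriminant\<close>

definition poly_growth :: "(real \<Rightarrow> real) \<Rightarrow> bool" where
  "poly_growth h \<longleftrightarrow> (\<exists>C K. \<forall>x. \<bar>h x\<bar> \<le> C * (1 + \<bar>x\<bar>) ^ K)"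

text \<open>
  Pearson's differential equation \<open>d/dx (x (1 - \<kappa> x) p x) = (A - B x) p x\<close> in weak form, that is,
  tested against smooth functions of polynomial growth. For \<open>\<kappa> = 1\<close> it describes Beta-type weights
  on \<open>(0, 1)\<close>, for \<open>\<kappa> = 0\<close> Gamma-type weights on \<open>(0, \<infinity>)\<close>; one recursion thus serves both
  ensembles. The weight is complex because it carries a factor \<open>x powr z\<close>.
\<close>

definition pearson_weight :: "complex \<Rightarrow> complex \<Rightarrow> real \<Rightarrow> (real \<Rightarrow> complex) \<Rightarrow> bool" where
  "pearson_weight A B \<kappa> p \<longleftrightarrow>
     p \<in> borel_measurable borel \<and>
     (\<forall>K. integrable lborel (\<lambda>x. of_real ((1 + \<bar>x\<bar>) ^ K) * p x)) \<and>
     (\<forall>h h'. (\<forall>x. (h has_real_derivative h' x) (at x)) \<longrightarrow> continuous_on UNIV h' \<longrightarrow>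
        poly_growth h \<longrightarrow> poly_growth h' \<longrightarrow>
        (\<integral>x. ((A - B * of_real x) * of_real (h x) + of_real (x * (1 - \<kappa> * x) * h' x)) * p x \<partial>lborel) = 0)"

definition off_diagonal :: "'i set \<Rightarrow> ('i \<times> 'i) set" where
  "off_diagonal I = {(i, j). i \<in> I \<and> j \<in> I \<and> i \<noteq> j}"

text \<open>
  The product runs over ordered pairs, so it is the square of the Vandermonde determinant.
\<close>

definition discriminant :: "'i set \<Rightarrow> ('i \<Rightarrow> real) \<Rightarrow> real" where
  "discriminant I x = (\<Prod>(i, j)\<in>off_diagonal I. \<bar>x i - x j\<bar>)"

text \<open>
  A single majorant in product form: all functions that occur are bounded by a power of it, and its
  powers are integrable against product weights.
\<close>

definition envelope :: "'i set \<Rightarrow> ('i \<Rightarrow> real) \<Rightarrow> real" where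
  "envelope I x = (\<Prod>i\<in>I. 1 + \<bar>x i\<bar>)"

lemma finite_off_diagonal [simp]: "finite I \<Longrightarrow> finite (off_diagonal I)"
  by (rule finite_subset[of _ "I \<times> I"]) (auto simp: off_diagonal_def)

lemma discriminant_nonneg [simp]: "discriminant I x \<ge> 0"
  unfolding discriminant_def by (intro prod_nonneg) auto

lemma envelope_ge_1: "envelope I x \<ge> 1"
  unfolding envelope_def by (intro prod_ge_1) auto

lemma envelope_subset_mono: "finite I \<Longrightarrow> J \<subseteq> I \<Longrightarrow> envelope J x \<le> envelope I x"
  unfolding envelope_def by (intro prod_mono2) auto

lemma abs_diff_le_envelope:
  assumes "finite I" "i \<in> I" "j \<in> I" "i \<noteq> j"
  shows "\<bar>x i - x j\<bar> \<le> envelope I x"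
proof -
  have "\<bar>x i - x j\<bar> \<le> (1 + \<bar>x i\<bar>) * (1 + \<bar>x j\<bar>)"
    by (simp add: algebra_simps abs_mult[symmetric])
  also have "\<dots> = envelope {i, j} x" using assms by (simp add: envelope_def)
  also have "\<dots> \<le> envelope I x" using assms by (intro envelope_subset_mono) auto
  finally show ?thesis .
qed

lemma prod_off_diagonal_le:
  assumes "finite I" "R \<subseteq> off_diagonal I"
  shows "(\<Prod>(i, j)\<in>R. \<bar>x i - x j\<bar>) \<le> envelope I x ^ card (off_diagonal I)"
proof -
  have "(\<Prod>(i, j)\<in>R. \<bar>x i - x j\<bar>) \<le> (\<Prod>_\<in>R. envelope I x)"
    using assms by (intro prod_mono) (auto simp: off_diagonal_def intro!: abs_diff_le_envelope)
  also have "\<dots> = envelope I x ^ card R" by simp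
  also have "\<dots> \<le> envelope I x ^ card (off_diagonal I)"
    using assms by (intro power_increasing card_mono envelope_ge_1) auto
  finally show ?thesis .
qed

lemma discriminant_le: "finite I \<Longrightarrow> discriminant I x \<le> envelope I x ^ card (off_diagonal I)"
  unfolding discriminant_def by (rule prod_off_diagonal_le) auto

text \<open>
  The factor \<open>\<bar>x k - x j\<bar>\<close> occurs twice in the discriminant, so one division leaves a product of
  differences.
\<close>

lemma discriminant_div_le:
  assumes "finite I" "k \<in> I" "j \<in> I" "k \<noteq> j"
  shows "\<bar>discriminant I x / (x k - x j)\<bar> \<le> envelope I x ^ card (off_diagonal I)"
proof (cases "x k = x j")
  case True
  then show ?thesis using envelope_ge_1[of I x] by simp
next
  case False
  have "discriminant I x = \<bar>x k - x j\<bar> * (\<Prod>(i, j)\<in>off_diagonal I - {(k, j)}. \<bar>x i - x j\<bar>)"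
    unfolding discriminant_def using assms
    by (subst prod.remove[of _ "(k, j)"]) (auto simp: off_diagonal_def intro: finite_off_diagonal[unfolded off_diagonal_def])
  then have "\<bar>discriminant I x / (x k - x j)\<bar> = \<bar>\<Prod>(i, j)\<in>off_diagonal I - {(k, j)}. \<bar>x i - x j\<bar>\<bar>"
    using False by (simp add: abs_mult)
  also have "\<dots> = (\<Prod>(i, j)\<in>off_diagonal I - {(k, j)}. \<bar>x i - x j\<bar>)"
    by (intro abs_of_nonneg prod_nonneg) auto
  also have "\<dots> \<le> envelope I x ^ card (off_diagonal I)"
    using assms by (intro prod_off_diagonal_le) auto
  finally show ?thesis .
qed

text \<open>
  As a function of one coordinate, the discriminant is a constant times the square of a polynomial.
\<close>

lemma discriminant_coordinate:
  assumes "finite I" "k \<in> I"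
  shows "discriminant I (x(k := y)) = discriminant (I - {k}) x * (\<Prod>j\<in>I - {k}. y - x j)\<^sup>2"
proof -
  let ?J = "I - {k}"
  have eq: "off_diagonal I = off_diagonal ?J \<union> ((\<lambda>j. (k, j)) ` ?J \<union> (\<lambda>j. (j, k)) ` ?J)"
    using assms by (auto simp: off_diagonal_def)
  have "discriminant I (x(k := y)) = (\<Prod>(i, j)\<in>off_diagonal ?J. \<bar>(x(k := y)) i - (x(k := y)) j\<bar>) *
     ((\<Prod>(i, j)\<in>(\<lambda>j. (k, j)) ` ?J. \<bar>(x(k := y)) i - (x(k := y)) j\<bar>) *
      (\<Prod>(i, j)\<in>(\<lambda>j. (j, k)) ` ?J. \<bar>(x(k := y)) i - (x(k := y)) j\<bar>))"
    unfolding discriminant_def eq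
    by (subst prod.union_disjoint, use assms in simp, use assms in simp,
        force simp: off_diagonal_def, subst prod.union_disjoint) (use assms in auto)
  also have "(\<Prod>(i, j)\<in>off_diagonal ?J. \<bar>(x(k := y)) i - (x(k := y)) j\<bar>) = discriminant ?J x"
    unfolding discriminant_def by (intro prod.cong) (auto simp: off_diagonal_def)
  also have "(\<Prod>(i, j)\<in>(\<lambda>j. (k, j)) ` ?J. \<bar>(x(k := y)) i - (x(k := y)) j\<bar>) = (\<Prod>j\<in>?J. \<bar>y - x j\<bar>)"
    by (subst prod.reindex) (auto simp: inj_on_def intro!: prod.cong)
  also have "(\<Prod>(i, j)\<in>(\<lambda>j. (j, k)) ` ?J. \<bar>(x(k := y)) i - (x(k := y)) j\<bar>) = (\<Prod>j\<in>?J. \<bar>y - x j\<bar>)"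
    by (subst prod.reindex) (auto simp: inj_on_def abs_minus_commute intro!: prod.cong)
  also have "(\<Prod>j\<in>?J. \<bar>y - x j\<bar>) * (\<Prod>j\<in>?J. \<bar>y - x j\<bar>) = (\<Prod>j\<in>?J. y - x j)\<^sup>2"
    by (simp add: abs_prod[symmetric] power2_eq_square)
  finally show ?thesis .
qed

lemma discriminant_transpose:
  assumes "finite I" "k \<in> I" "j \<in> I"
  shows "discriminant I (x \<circ> Transposition.transpose k j) = discriminant I x"
proof -
  let ?f = "map_prod (Transposition.transpose k j) (Transposition.transpose k j)"
  have "bij_betw ?f (off_diagonal I) (off_diagonal I)"
    by (rule bij_betw_byWitness[of _ ?f])
       (use assms in \<open>auto simp: off_diagonal_def Transposition.transpose_def inj_on_def split: if_splits\<close>)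
  then show ?thesis unfolding discriminant_def
    by (subst prod.reindex_bij_betw[symmetric, of ?f "off_diagonal I"])
       (auto simp: case_prod_unfold)
qed

lemma discriminant_measurable [measurable]:
  "finite I \<Longrightarrow> discriminant I \<in> borel_measurable (PiM I (\<lambda>_. lborel :: real measure))"
  unfolding discriminant_def case_prod_unfold
  by (intro borel_measurable_prod borel_measurable_abs borel_measurable_diff)
     (auto simp: off_diagonal_def intro!: measurable_component_singleton)

text \<open>
  The power \<open>\<bar>\<Delta>\<bar> powr \<beta>\<close> with \<open>\<Delta>\<^sup>2\<close> replaced by \<open>\<Delta>\<^sup>2 + \<epsilon>\<close> and \<open>\<gamma> = \<beta> / 2\<close>.
\<close>

definition smoothed :: "'i set \<Rightarrow> real \<Rightarrow> real \<Rightarrow> ('i \<Rightarrow> real) \<Rightarrow> real" where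
  "smoothed I \<gamma> \<epsilon> x = (discriminant I x + \<epsilon>) powr \<gamma>"

text \<open>
  The factor left over when \<open>smoothed\<close> is differentiated logarithmically: it vanishes to second
  order where two coordinates meet, hence absorbs the poles \<open>1 / (x k - x j)\<close>, and it has the same
  limit as \<open>smoothed\<close> when \<open>\<epsilon>\<close> tends to \<open>0\<close>.
\<close>

definition smoothed' :: "'i set \<Rightarrow> real \<Rightarrow> real \<Rightarrow> ('i \<Rightarrow> real) \<Rightarrow> real" where
  "smoothed' I \<gamma> \<epsilon> x = discriminant I x * (discriminant I x + \<epsilon>) powr (\<gamma> - 1)"

text \<open>
  The logarithmic derivative of the discriminant in the coordinate \<open>k\<close> is
  \<open>2 * (\<Sum>j. 1 / (x k - x j))\<close>. With the convention \<open>1 / 0 = 0\<close> the formula remains true where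
  coordinates meet, since \<open>smoothed'\<close> and the derivative both vanish there.
\<close>

lemma smoothed_has_derivative:
  fixes x :: "'i \<Rightarrow> real" and \<gamma> :: real
  assumes "finite I" "k \<in> I" "\<epsilon> > 0"
  defines "h' \<equiv> \<lambda>y. 2 * \<gamma> * (\<Sum>j\<in>I - {k}. smoothed' I \<gamma> \<epsilon> (x(k := y)) / (y - x j))"
  shows "((\<lambda>y. smoothed I \<gamma> \<epsilon> (x(k := y))) has_real_derivative h' y) (at y)"
    and "continuous_on UNIV h'"
proof -
  define c where "c = discriminant (I - {k}) x"
  have c: "c \<ge> 0" by (simp add: c_def)
  define q where "q = (\<lambda>y. \<Prod>j\<in>I - {k}. y - x j)"
  define q' where "q' = (\<lambda>y. \<Sum>j\<in>I - {k}. 1 * (\<Prod>i\<in>I - {k} - {j}. y - x i))"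
  have q: "(q has_real_derivative q' y) (at y)" for y
    unfolding q_def q'_def by (rule has_field_derivative_prod) (auto intro!: derivative_eq_intros)
  have D: "discriminant I (x(k := y)) = c * (q y)\<^sup>2" for y
    unfolding c_def q_def by (rule discriminant_coordinate) fact+
  have pos: "c * (q y)\<^sup>2 + \<epsilon> > 0" for y
    using c assms(3) by (intro add_nonneg_pos) auto
  have qq': "q y * q' y = (\<Sum>j\<in>I - {k}. (q y)\<^sup>2 / (y - x j))" for y
    unfolding q'_def sum_distrib_left
  proof (rule sum.cong)
    fix j assume j: "j \<in> I - {k}"
    have "q y = (y - x j) * (\<Prod>i\<in>I - {k} - {j}. y - x i)"
      unfolding q_def using j assms(1) by (subst prod.remove[of _ j]) auto
    then show "q y * (1 * (\<Prod>i\<in>I - {k} - {j}. y - x i)) = (q y)\<^sup>2 / (y - x j)"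
      \<comment> \<open>at \<open>y = x j\<close> both sides vanish, because \<open>q y = 0\<close>\<close>
      by (cases "y = x j") (auto simp: power2_eq_square)
  qed simp
  have h': "h' y = \<gamma> * (c * (q y)\<^sup>2 + \<epsilon>) powr (\<gamma> - 1) * (c * (2 * (q y * q' y)))" for y
    unfolding h'_def smoothed'_def D qq'
    by (simp add: sum_distrib_left sum_distrib_right sum_divide_distrib mult_ac)
  show "((\<lambda>y. smoothed I \<gamma> \<epsilon> (x(k := y))) has_real_derivative h' y) (at y)"
    unfolding smoothed_def D h' using pos[of y]
    by (auto intro!: derivative_eq_intros q simp: powr_diff)
  have contq: "continuous_on UNIV q" "continuous_on UNIV q'"
    unfolding q_def q'_def by (auto intro!: continuous_intros)
  show "continuous_on UNIV h'"
    unfolding h' using pos by (intro continuous_intros contq) (auto simp: less_imp_neq[symmetric])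
qed

text \<open>
  The bound is uniform in \<open>\<epsilon>\<close>, as dominated convergence for \<open>\<epsilon> \<longlongrightarrow> 0\<close> needs.
\<close>

lemma smoothed_le:
  assumes "finite I" "\<gamma> > 0"
  shows "\<exists>C K. \<forall>\<epsilon>\<in>{0..1}. \<forall>x. smoothed I \<gamma> \<epsilon> x \<le> C * envelope I x ^ K"
proof (intro exI ballI allI)
  fix \<epsilon> :: real and x :: "'a \<Rightarrow> real" assume \<epsilon>: "\<epsilon> \<in> {0..1}"
  let ?L = "card (off_diagonal I)" and ?m = "nat \<lceil>\<gamma>\<rceil>" and ?E = "envelope I x"
  have E: "?E ^ ?L \<ge> 1" using envelope_ge_1[of I x] by (rule one_le_power)
  have "smoothed I \<gamma> \<epsilon> x \<le> (2 * ?E ^ ?L) powr \<gamma>"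
    unfolding smoothed_def using discriminant_le[OF assms(1), of x] E assms \<epsilon>
    by (intro powr_mono2) auto
  also have "\<dots> \<le> (2 * ?E ^ ?L) powr real ?m"
    using E assms(2) by (intro powr_mono) linarith+
  also have "\<dots> = (2 * ?E ^ ?L) ^ ?m" using E by (intro powr_realpow) linarith
  also have "\<dots> = 2 ^ ?m * ?E ^ (?L * ?m)" by (simp add: power_mult_distrib power_mult)
  finally show "smoothed I \<gamma> \<epsilon> x \<le> 2 ^ ?m * ?E ^ (?L * ?m)" .
qed

lemma smoothed_nonneg [simp]: "smoothed I \<gamma> \<epsilon> x \<ge> 0" by (simp add: smoothed_def)
lemma smoothed'_nonneg [simp]: "smoothed' I \<gamma> \<epsilon> x \<ge> 0" by (simp add: smoothed'_def)

lemma powr_minus_1_mult: "(y::real) \<ge> 0 \<Longrightarrow> y * y powr (\<gamma> - 1) = y powr \<gamma>"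
  by (cases "y = 0") (auto simp: powr_diff)

lemma smoothed'_le_smoothed:
  assumes "\<epsilon> \<ge> 0" shows "smoothed' I \<gamma> \<epsilon> x \<le> smoothed I \<gamma> \<epsilon> x"
proof -
  have "smoothed' I \<gamma> \<epsilon> x \<le> (discriminant I x + \<epsilon>) * (discriminant I x + \<epsilon>) powr (\<gamma> - 1)"
    unfolding smoothed'_def using assms by (intro mult_right_mono) auto
  then show ?thesis unfolding smoothed_def using assms by (simp add: powr_minus_1_mult)
qed

lemma smoothed_0: "smoothed I \<gamma> 0 x = discriminant I x powr \<gamma>"
  and smoothed'_0: "smoothed' I \<gamma> 0 x = discriminant I x powr \<gamma>"
  by (simp_all add: smoothed_def smoothed'_def powr_minus_1_mult)

lemma smoothed_measurable [measurable]:
  assumes "finite I"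
  shows "smoothed I \<gamma> \<epsilon> \<in> borel_measurable (PiM I (\<lambda>_. lborel))"
    and "smoothed' I \<gamma> \<epsilon> \<in> borel_measurable (PiM I (\<lambda>_. lborel))"
proof -
  note [measurable] = discriminant_measurable[OF assms]
  show "smoothed I \<gamma> \<epsilon> \<in> borel_measurable (PiM I (\<lambda>_. lborel))"
    unfolding smoothed_def by measurable
  show "smoothed' I \<gamma> \<epsilon> \<in> borel_measurable (PiM I (\<lambda>_. lborel))"
    unfolding smoothed'_def by measurable
qed

lemma smoothed_transpose:
  assumes "finite I" "k \<in> I" "j \<in> I"
  shows "smoothed I \<gamma> \<epsilon> (x \<circ> Transposition.transpose k j) = smoothed I \<gamma> \<epsilon> x"
    and "smoothed' I \<gamma> \<epsilon> (x \<circ> Transposition.transpose k j) = smoothed' I \<gamma> \<epsilon> x"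
  by (simp_all add: smoothed_def smoothed'_def discriminant_transpose[OF assms])

text \<open>
  The real functions whose integrals against product weights converge absolutely.
\<close>

definition tame :: "'i set \<Rightarrow> (('i \<Rightarrow> real) \<Rightarrow> real) \<Rightarrow> bool" where
  "tame I f \<longleftrightarrow> f \<in> borel_measurable (PiM I (\<lambda>_. lborel)) \<and>
     (\<exists>C K. \<forall>x. \<bar>f x\<bar> \<le> C * envelope I x ^ K)"

lemma tame_measurable: "tame I f \<Longrightarrow> f \<in> borel_measurable (PiM I (\<lambda>_. lborel))"
  by (simp add: tame_def)

lemma tameI:
  assumes "f \<in> borel_measurable (PiM I (\<lambda>_. lborel))" "\<And>x. \<bar>f x\<bar> \<le> C * envelope I x ^ K"
  shows "tame I f"
  using assms unfolding tame_def by blast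

lemma tame_const [intro]: "tame I (\<lambda>_. c)"
  by (rule tameI[of _ _ "\<bar>c\<bar>" 0]) auto

lemma tame_coordinate [intro]: "finite I \<Longrightarrow> i \<in> I \<Longrightarrow> tame I (\<lambda>x. x i)"
proof (rule tameI[of _ _ 1 1])
  fix x :: "'a \<Rightarrow> real" assume i: "finite I" "i \<in> I"
  have "\<bar>x i\<bar> \<le> envelope {i} x" by (simp add: envelope_def)
  also have "\<dots> \<le> envelope I x" using i by (intro envelope_subset_mono) auto
  finally show "\<bar>x i\<bar> \<le> 1 * envelope I x ^ 1" by simp
qed (auto intro!: measurable_component_singleton)

lemma tame_mult [intro]:
  assumes "tame I f" "tame I g" shows "tame I (\<lambda>x. f x * g x)"
proof -
  obtain C K where f: "\<And>x. \<bar>f x\<bar> \<le> C * envelope I x ^ K" using assms(1) unfolding tame_def by blast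
  obtain D L where g: "\<And>x. \<bar>g x\<bar> \<le> D * envelope I x ^ L" using assms(2) unfolding tame_def by blast
  show ?thesis
  proof (rule tameI[of _ _ "C * D" "K + L"])
    show "(\<lambda>x. f x * g x) \<in> borel_measurable (PiM I (\<lambda>_. lborel))"
      using assms by (intro borel_measurable_times tame_measurable)
    fix x
    have "\<bar>f x * g x\<bar> \<le> (C * envelope I x ^ K) * (D * envelope I x ^ L)"
      unfolding abs_mult using f[of x] g[of x] by (intro mult_mono) linarith+
    then show "\<bar>f x * g x\<bar> \<le> C * D * envelope I x ^ (K + L)" by (simp add: power_add mult_ac)
  qed
qed

lemma tame_add [intro]:
  assumes "tame I f" "tame I g" shows "tame I (\<lambda>x. f x + g x)"
proof -
  obtain C K where f: "\<And>x. \<bar>f x\<bar> \<le> C * envelope I x ^ K" using assms(1) unfolding tame_def by blast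
  obtain D L where g: "\<And>x. \<bar>g x\<bar> \<le> D * envelope I x ^ L" using assms(2) unfolding tame_def by blast
  show ?thesis
  proof (rule tameI[of _ _ "\<bar>C\<bar> + \<bar>D\<bar>" "max K L"])
    show "(\<lambda>x. f x + g x) \<in> borel_measurable (PiM I (\<lambda>_. lborel))"
      using assms by (intro borel_measurable_add tame_measurable)
    fix x
    have "C * envelope I x ^ K \<le> \<bar>C\<bar> * envelope I x ^ max K L"
      using envelope_ge_1[of I x] by (intro mult_mono power_increasing) auto
    moreover have "D * envelope I x ^ L \<le> \<bar>D\<bar> * envelope I x ^ max K L"
      using envelope_ge_1[of I x] by (intro mult_mono power_increasing) auto
    ultimately show "\<bar>f x + g x\<bar> \<le> (\<bar>C\<bar> + \<bar>D\<bar>) * envelope I x ^ max K L"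
      unfolding distrib_right using f[of x] g[of x] abs_triangle_ineq[of "f x" "g x"] by linarith
  qed
qed

lemma tame_diff [intro]: "tame I f \<Longrightarrow> tame I g \<Longrightarrow> tame I (\<lambda>x. f x - g x)"
  using tame_add[of I f "\<lambda>x. (- 1) * g x", OF _ tame_mult[OF tame_const]] by simp

lemma tame_sum [intro]: "(\<And>j. j \<in> J \<Longrightarrow> tame I (f j)) \<Longrightarrow> tame I (\<lambda>x. \<Sum>j\<in>J. f j x)"
  by (induction J rule: infinite_finite_induct) auto

lemma tame_prod [intro]: "(\<And>j. j \<in> J \<Longrightarrow> tame I (f j)) \<Longrightarrow> tame I (\<lambda>x. \<Prod>j\<in>J. f j x)"
  by (induction J rule: infinite_finite_induct) auto

lemma tame_smoothed [intro]:
  assumes "finite I" "\<gamma> > 0" "\<epsilon> \<in> {0..1}"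
  shows "tame I (smoothed I \<gamma> \<epsilon>)" "tame I (smoothed' I \<gamma> \<epsilon>)"
proof -
  obtain C K where CK: "\<And>x. smoothed I \<gamma> \<epsilon> x \<le> C * envelope I x ^ K"
    using smoothed_le[OF assms(1,2)] assms(3) by blast
  then show "tame I (smoothed I \<gamma> \<epsilon>)"
    using assms by (intro tameI[of _ _ C K]) auto
  show "tame I (smoothed' I \<gamma> \<epsilon>)"
    using assms CK smoothed'_le_smoothed[of \<epsilon> I \<gamma>] by (intro tameI[of _ _ C K]) (auto intro: order_trans)
qed

lemma tame_smoothed'_div [intro]:
  assumes "finite I" "\<gamma> > 0" "\<epsilon> \<in> {0<..1}" "k \<in> I" "j \<in> I" "k \<noteq> j"
  shows "tame I (\<lambda>x. smoothed' I \<gamma> \<epsilon> x / (x k - x j))"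
proof -
  have \<epsilon>: "\<epsilon> > 0" "\<epsilon> \<in> {0..1}" using assms by auto
  obtain C K where CK: "\<And>x. smoothed I \<gamma> \<epsilon> x \<le> C * envelope I x ^ K"
    using smoothed_le[OF assms(1,2)] \<epsilon>(2) by blast
  let ?L = "card (off_diagonal I)"
  show ?thesis
  proof (rule tameI[of _ _ "C / \<epsilon>" "?L + K"])
    have [measurable]: "(\<lambda>x. x k) \<in> borel_measurable (PiM I (\<lambda>_. lborel))"
      "(\<lambda>x. x j) \<in> borel_measurable (PiM I (\<lambda>_. lborel))"
      using assms by (auto intro: tame_measurable)
    note [measurable] = smoothed_measurable[OF assms(1)]
    show "(\<lambda>x. smoothed' I \<gamma> \<epsilon> x / (x k - x j)) \<in> borel_measurable (PiM I (\<lambda>_. lborel))"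
      by measurable
    fix x :: "'a \<Rightarrow> real"
    let ?D = "discriminant I x"
    have D: "?D + \<epsilon> > 0" using \<epsilon> by (simp add: add_nonneg_pos)
    have "\<bar>smoothed' I \<gamma> \<epsilon> x / (x k - x j)\<bar> = \<bar>?D / (x k - x j)\<bar> * (?D + \<epsilon>) powr (\<gamma> - 1)"
      unfolding smoothed'_def by (simp add: abs_mult)
    also have "\<dots> \<le> envelope I x ^ ?L * (smoothed I \<gamma> \<epsilon> x / \<epsilon>)"
    proof (intro mult_mono discriminant_div_le)
      have "(?D + \<epsilon>) powr (\<gamma> - 1) = smoothed I \<gamma> \<epsilon> x / (?D + \<epsilon>)"
        using D by (simp add: smoothed_def powr_diff)
      also have "\<dots> \<le> smoothed I \<gamma> \<epsilon> x / \<epsilon>"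
        using \<epsilon> D by (intro divide_left_mono mult_pos_pos) auto
      finally show "(?D + \<epsilon>) powr (\<gamma> - 1) \<le> smoothed I \<gamma> \<epsilon> x / \<epsilon>" .
    qed (use assms envelope_ge_1[of I x] in auto)
    also have "\<dots> \<le> envelope I x ^ ?L * ((C * envelope I x ^ K) / \<epsilon>)"
      using \<epsilon> CK[of x] envelope_ge_1[of I x] by (intro mult_left_mono divide_right_mono) auto
    finally show "\<bar>smoothed' I \<gamma> \<epsilon> x / (x k - x j)\<bar> \<le> C / \<epsilon> * envelope I x ^ (?L + K)"
      by (simp add: power_add mult_ac)
  qed
qed

lemma tame_coordinate_growth:
  assumes "tame I f" "finite I" "k \<in> I"
  shows "poly_growth (\<lambda>y. f (x(k := y)))"
proof -
  obtain C K where f: "\<And>x. \<bar>f x\<bar> \<le> C * envelope I x ^ K" using assms(1) unfolding tame_def by blast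
  have "envelope I (x(k := y)) = (1 + \<bar>y\<bar>) * envelope (I - {k}) x" for y
    unfolding envelope_def using assms by (subst prod.remove[of _ k]) auto
  then have "\<bar>f (x(k := y))\<bar> \<le> (C * envelope (I - {k}) x ^ K) * (1 + \<bar>y\<bar>) ^ K" for y
    using f[of "x(k := y)"] by (simp add: power_mult_distrib mult_ac)
  then show ?thesis unfolding poly_growth_def by blast
qed

definition weighted_integral :: "'i set \<Rightarrow> (real \<Rightarrow> complex) \<Rightarrow> (('i \<Rightarrow> real) \<Rightarrow> real) \<Rightarrow> complex" where
  "weighted_integral I p f = (\<integral>x. of_real (f x) * (\<Prod>i\<in>I. p (x i)) \<partial>PiM I (\<lambda>_. lborel))"

text \<open>
  Both measures give a box the same product of side lengths.
\<close>

lemma distr_transpose: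
  fixes I :: "'i set"
  assumes "finite I" "k \<in> I" "j \<in> I"
  shows "distr (PiM I (\<lambda>_. lborel :: real measure)) (PiM I (\<lambda>_. lborel)) (\<lambda>x. x \<circ> Transposition.transpose k j) =
         PiM I (\<lambda>_. lborel)" (is "distr ?M ?M ?T = ?M")
proof -
  interpret product_sigma_finite "\<lambda>_ :: 'i. lborel :: real measure" ..
  let ?t = "Transposition.transpose k j"
  have t: "?t i \<in> I \<longleftrightarrow> i \<in> I" for i using assms by (auto simp: Transposition.transpose_def)
  have T: "?T \<in> measurable ?M ?M"
    by (rule measurable_PiM_single')
       (auto simp: t space_PiM PiE_def extensional_def intro!: measurable_component_singleton)
  show ?thesis
  proof (rule PiM_eqI)
    fix A :: "'i \<Rightarrow> real set" assume A: "\<And>i. i \<in> I \<Longrightarrow> A i \<in> sets lborel"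
    have bij: "bij_betw ?t I I"
      by (rule bij_betw_byWitness[of _ ?t]) (auto simp: t)
    have vim: "?T -` Pi\<^sub>E I A \<inter> space ?M = Pi\<^sub>E I (A \<circ> ?t)"
    proof -
      have "x (?t i) \<in> A i" if "x \<in> Pi\<^sub>E I (A \<circ> ?t)" "i \<in> I" for x i
        using that t[of i] PiE_mem[OF that(1), of "?t i"] by simp
      moreover have "x i \<in> A (?t i)" if "\<And>i. i \<in> I \<Longrightarrow> x (?t i) \<in> A i" "i \<in> I" for x i
        using that(1)[of "?t i"] that(2) t[of i] by simp
      ultimately show ?thesis
        by (auto simp: space_PiM PiE_def Pi_def extensional_def t)
    qed
    have "emeasure (distr ?M ?M ?T) (Pi\<^sub>E I A) = emeasure ?M (Pi\<^sub>E I (A \<circ> ?t))"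
      using A assms by (subst emeasure_distr[OF T]) (auto simp: vim intro!: sets_PiM_I_finite)
    also have "\<dots> = (\<Prod>i\<in>I. emeasure lborel (A (?t i)))"
      using A assms by (subst emeasure_PiM) (auto simp: t)
    also have "\<dots> = (\<Prod>i\<in>I. emeasure lborel (A i))"
      by (rule prod.reindex_bij_betw[OF bij])
    finally show "emeasure (distr ?M ?M ?T) (Pi\<^sub>E I A) = (\<Prod>i\<in>I. emeasure lborel (A i))" .
  qed (use assms in auto)
qed

lemma transpose_measurable:
  assumes "k \<in> I" "j \<in> I"
  shows "(\<lambda>x. x \<circ> Transposition.transpose k j) \<in> measurable (PiM I (\<lambda>_. lborel :: real measure)) (PiM I (\<lambda>_. lborel))"
proof -
  have t: "Transposition.transpose k j i \<in> I \<longleftrightarrow> i \<in> I" for i using assms by (auto simp: Transposition.transpose_def)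
  show ?thesis
    by (rule measurable_PiM_single')
       (auto simp: t space_PiM PiE_def extensional_def intro!: measurable_component_singleton)
qed

lemma weighted_integral_transpose:
  assumes "finite I" "k \<in> I" "j \<in> I" "p \<in> borel_measurable borel"
    and f: "f \<in> borel_measurable (PiM I (\<lambda>_. lborel))"
  shows "weighted_integral I p (\<lambda>x. f (x \<circ> Transposition.transpose k j)) = weighted_integral I p f"
proof -
  let ?t = "Transposition.transpose k j"
  let ?M = "PiM I (\<lambda>_. lborel :: real measure)"
  have t: "?t i \<in> I \<longleftrightarrow> i \<in> I" for i using assms by (auto simp: Transposition.transpose_def)
  have bij: "bij_betw ?t I I"
    by (rule bij_betw_byWitness[of _ ?t]) (auto simp: t)
  note [measurable] = f assms(4)
  have [measurable]: "(\<lambda>x. \<Prod>i\<in>I. p (x i)) \<in> borel_measurable ?M"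
    by (intro borel_measurable_prod measurable_compose[OF measurable_component_singleton]) auto
  have "weighted_integral I p f =
      (\<integral>x. of_real (f x) * (\<Prod>i\<in>I. p (x i)) \<partial>distr ?M ?M (\<lambda>x. x \<circ> ?t))"
    by (simp only: distr_transpose[OF assms(1-3)] weighted_integral_def)
  also have "\<dots> = (\<integral>x. of_real (f (x \<circ> ?t)) * (\<Prod>i\<in>I. p ((x \<circ> ?t) i)) \<partial>?M)"
    by (rule integral_distr[OF transpose_measurable[OF assms(2,3)]]) measurable
  also have "(\<lambda>x. \<Prod>i\<in>I. p ((x \<circ> ?t) i)) = (\<lambda>x. \<Prod>i\<in>I. p (x i))"
    using prod.reindex_bij_betw[OF bij, of "\<lambda>i. p (x i)" for x] by (simp add: o_def)
  finally show ?thesis by (simp add: weighted_integral_def o_def)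
qed

section \<open>Aomoto's recursion\<close>
lemma pearson_weight_identity:
  assumes "pearson_weight A B \<kappa> p"
    and "\<And>x. (h has_real_derivative h' x) (at x)" "continuous_on UNIV h'" "poly_growth h" "poly_growth h'"
  shows "(\<integral>x. ((A - B * of_real x) * of_real (h x) + of_real (x * (1 - \<kappa> * x) * h' x)) * p x \<partial>lborel) = 0"
  using assms unfolding pearson_weight_def by meson

context
  fixes I :: "'i set" and p :: "real \<Rightarrow> complex" and A B :: complex and \<kappa> \<gamma> :: real
  assumes I: "finite I" and pw: "pearson_weight A B \<kappa> p" and \<gamma>: "\<gamma> > 0"
begin

interpretation product_sigma_finite "\<lambda>_ :: 'i. lborel :: real measure" ..

lemma p_measurable [measurable]: "p \<in> borel_measurable borel"
  using pw by (simp add: pearson_weight_def)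

lemma integrable_envelope:
  "integrable (PiM I (\<lambda>_. lborel)) (\<lambda>x. of_real (envelope I x ^ K) * (\<Prod>i\<in>I. p (x i)))"
proof -
  have "integrable (PiM I (\<lambda>_. lborel)) (\<lambda>x. \<Prod>i\<in>I. of_real ((1 + \<bar>x i\<bar>) ^ K) * p (x i))"
    using pw I by (intro product_integrable_prod[where f = "\<lambda>_ y. of_real ((1 + \<bar>y\<bar>) ^ K) * p y"])
      (auto simp: pearson_weight_def)
  then show ?thesis
    by (simp only: prod.distrib envelope_def prod_power_distrib of_real_prod)
qed

lemma integrable_tame:
  assumes "tame I f"
  shows "integrable (PiM I (\<lambda>_. lborel)) (\<lambda>x. of_real (f x) * (\<Prod>i\<in>I. p (x i)))"
proof -
  obtain C K where f: "\<And>x. \<bar>f x\<bar> \<le> C * envelope I x ^ K" using assms unfolding tame_def by blast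
  note [measurable] = tame_measurable[OF assms]
  show ?thesis
  proof (rule Bochner_Integration.integrable_bound[OF integrable_mult_right[OF integrable_envelope[of K], of "of_real C"]])
    show "AE x in PiM I (\<lambda>_. lborel). norm (of_real (f x) * (\<Prod>i\<in>I. p (x i)))
        \<le> norm (complex_of_real C * (of_real (envelope I x ^ K) * (\<Prod>i\<in>I. p (x i))))"
    proof (rule AE_I2)
      fix x
      have "\<bar>f x\<bar> \<le> \<bar>C\<bar> * \<bar>envelope I x ^ K\<bar>"
        using f[of x] abs_ge_self[of "C * envelope I x ^ K"] by (simp only: abs_mult)
      then have "\<bar>f x\<bar> * norm (\<Prod>i\<in>I. p (x i)) \<le> (\<bar>C\<bar> * \<bar>envelope I x ^ K\<bar>) * norm (\<Prod>i\<in>I. p (x i))"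
        by (intro mult_right_mono) auto
      then show "norm (of_real (f x) * (\<Prod>i\<in>I. p (x i)))
        \<le> norm (complex_of_real C * (of_real (envelope I x ^ K) * (\<Prod>i\<in>I. p (x i))))"
        by (simp only: norm_mult norm_of_real mult.assoc)
    qed
  qed measurable
qed

lemma weighted_integral_add:
  "tame I f \<Longrightarrow> tame I g \<Longrightarrow>
     weighted_integral I p (\<lambda>x. f x + g x) = weighted_integral I p f + weighted_integral I p g"
  unfolding weighted_integral_def of_real_add distrib_right
  by (intro Bochner_Integration.integral_add integrable_tame)

lemma weighted_integral_cmult:
  "weighted_integral I p (\<lambda>x. c * f x) = of_real c * weighted_integral I p f"
  unfolding weighted_integral_def by (simp add: mult.assoc)

lemma weighted_integral_sum:
  "(\<And>j. j \<in> J \<Longrightarrow> tame I (f j)) \<Longrightarrow>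
     weighted_integral I p (\<lambda>x. \<Sum>j\<in>J. f j x) = (\<Sum>j\<in>J. weighted_integral I p (f j))"
proof (induction J rule: infinite_finite_induct)
  case (insert j J)
  then show ?case by (simp add: weighted_integral_add tame_sum)
qed (simp_all add: weighted_integral_def)

text \<open>
  By Fubini the coordinate \<open>k\<close> can be integrated first, with the others held fixed. There the weak
  Pearson equation applies to the test function \<open>h y = smoothed I \<gamma> \<epsilon> (x(k := y))\<close>.
\<close>

lemma weighted_integral_by_parts:
  assumes k: "k \<in> I" and S: "S \<subseteq> I - {k}" and \<epsilon>: "\<epsilon> \<in> {0<..1}"
  shows "A * weighted_integral I p (\<lambda>x. (\<Prod>i\<in>S. x i) * smoothed I \<gamma> \<epsilon> x)
       - B * weighted_integral I p (\<lambda>x. (\<Prod>i\<in>S. x i) * x k * smoothed I \<gamma> \<epsilon> x)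
       + of_real (2 * \<gamma>) * (\<Sum>j\<in>I - {k}. weighted_integral I p
           (\<lambda>x. (\<Prod>i\<in>S. x i) * (x k * (1 - \<kappa> * x k)) * (smoothed' I \<gamma> \<epsilon> x / (x k - x j)))) = 0"
    (is "A * ?J1 - B * ?J2 + _ * (\<Sum>j\<in>_. ?J3 j) = 0")
proof -
  have \<epsilon>': "\<epsilon> \<in> {0..1}" "\<epsilon> > 0" using \<epsilon> by auto
  define H where "H = (\<lambda>x. 2 * \<gamma> * (\<Sum>j\<in>I - {k}. smoothed' I \<gamma> \<epsilon> x / (x k - x j)))"
  have tH: "tame I H"
    unfolding H_def using I \<gamma> \<epsilon> k by (intro tame_mult tame_const tame_sum tame_smoothed'_div) auto
  have tW: "tame I (smoothed I \<gamma> \<epsilon>)" using I \<gamma> \<epsilon>' by auto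
  have tS: "tame I (\<lambda>x. \<Prod>i\<in>S. x i)" using I S by (intro tame_prod[of S I "\<lambda>i x. x i"]) auto
  have tk: "tame I (\<lambda>x. x k)" using I k by auto
  let ?P = "\<lambda>x. \<Prod>i\<in>I. p (x i)"
  let ?xS = "\<lambda>x. \<Prod>i\<in>S. x i"
  define f1 f2 f3 where "f1 = (\<lambda>x. ?xS x * smoothed I \<gamma> \<epsilon> x)"
    and "f2 = (\<lambda>x. ?xS x * x k * smoothed I \<gamma> \<epsilon> x)"
    and "f3 = (\<lambda>x. ?xS x * (x k * (1 - \<kappa> * x k)) * H x)"
  have t: "tame I f1" "tame I f2" "tame I f3"
    unfolding f1_def f2_def f3_def by (intro tame_mult tame_diff tame_const tS tk tW tH)+
  define F where "F = (\<lambda>x. A * (of_real (f1 x) * ?P x) - B * (of_real (f2 x) * ?P x) + of_real (f3 x) * ?P x)"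
  have intF: "integrable (PiM I (\<lambda>_. lborel)) F"
    unfolding F_def using integrable_tame[OF t(1)] integrable_tame[OF t(2)] integrable_tame[OF t(3)] by simp
  have "A * ?J1 - B * ?J2 + weighted_integral I p f3 = (\<integral>x. F x \<partial>PiM I (\<lambda>_. lborel))"
    unfolding F_def using integrable_tame[OF t(1)] integrable_tame[OF t(2)] integrable_tame[OF t(3)]
    by (simp add: weighted_integral_def f1_def[symmetric] f2_def[symmetric])
  also have "\<dots> = (\<integral>x. \<integral>y. F (x(k := y)) \<partial>lborel \<partial>PiM (I - {k}) (\<lambda>_. lborel))"
    using product_integral_insert[of "I - {k}" k F] intF I k by (simp add: insert_absorb)
  also have "\<dots> = (\<integral>x. 0 \<partial>PiM (I - {k}) (\<lambda>_. lborel :: real measure))"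
  proof (rule Bochner_Integration.integral_cong[OF refl])
    fix x :: "'i \<Rightarrow> real"
    define c where "c = of_real (?xS x) * (\<Prod>i\<in>I - {k}. p (x i))"
    have xS: "?xS (x(k := y)) = ?xS x" for y
      using S by (intro prod.cong) auto
    have P: "?P (x(k := y)) = p y * (\<Prod>i\<in>I - {k}. p (x i))" for y
      using I k by (subst prod.remove[of _ k]) (auto intro!: prod.cong)
    have "F (x(k := y)) = c * (((A - B * of_real y) * of_real (smoothed I \<gamma> \<epsilon> (x(k := y))) +
            of_real (y * (1 - \<kappa> * y) * H (x(k := y)))) * p y)" for y
      unfolding F_def f1_def f2_def f3_def xS P c_def by (simp add: algebra_simps)
    moreover have "(\<integral>y. ((A - B * of_real y) * of_real (smoothed I \<gamma> \<epsilon> (x(k := y))) +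
            of_real (y * (1 - \<kappa> * y) * H (x(k := y)))) * p y \<partial>lborel) = 0"
    proof -
      have Heq: "H (x(k := y)) = 2 * \<gamma> * (\<Sum>j\<in>I - {k}. smoothed' I \<gamma> \<epsilon> (x(k := y)) / (y - x j))" for y
        unfolding H_def by (intro arg_cong2[of _ _ _ _ "(*)"] sum.cong refl) auto
      show ?thesis
        using tame_coordinate_growth[OF tW I k, of x] tame_coordinate_growth[OF tH I k, of x]
        unfolding Heq by (intro pearson_weight_identity[OF pw] smoothed_has_derivative[OF I k \<epsilon>'(2)])
    qed
    ultimately show "(\<integral>y. F (x(k := y)) \<partial>lborel) = 0" by simp
  qed
  also have "\<dots> = 0" by simp
  also have "weighted_integral I p f3 = of_real (2 * \<gamma>) * (\<Sum>j\<in>I - {k}. ?J3 j)"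
  proof -
    have "f3 = (\<lambda>x. 2 * \<gamma> * (\<Sum>j\<in>I - {k}. ?xS x * (x k * (1 - \<kappa> * x k)) * (smoothed' I \<gamma> \<epsilon> x / (x k - x j))))"
      unfolding f3_def H_def sum_distrib_left by (intro ext sum.cong refl) (simp only: mult_ac)
    moreover have "tame I (\<lambda>x. ?xS x * (x k * (1 - \<kappa> * x k)) * (smoothed' I \<gamma> \<epsilon> x / (x k - x j)))"
      if "j \<in> I - {k}" for j
      using that I k \<epsilon> \<gamma> by (intro tame_mult tame_diff tame_const tS tk tame_smoothed'_div) auto
    ultimately show ?thesis by (simp only: weighted_integral_cmult weighted_integral_sum)
  qed
  finally show ?thesis .
qed

text \<open>
  Averaging over the exchange of the coordinates \<open>k\<close> and \<open>j\<close> cancels the pole \<open>1 / (x k - x j)\<close>,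
  since the rest of the integrand is symmetric up to the monomial. If \<open>j \<in> S\<close>, the monomial
  \<open>x k * (\<Prod>i\<in>S. x i)\<close> is itself symmetric in the two, and
  \<open>((1 - \<kappa> x k) - (1 - \<kappa> x j)) / (x k - x j) = - \<kappa>\<close>; if \<open>j \<notin> S\<close>, then
  \<open>(x k (1 - \<kappa> x k) - x j (1 - \<kappa> x j)) / (x k - x j) = 1 - \<kappa> (x k + x j)\<close>.
\<close>

lemma weighted_integral_repulsion:
  assumes k: "k \<in> I" and S: "S \<subseteq> I - {k}" and j: "j \<in> I - {k}" and \<epsilon>: "\<epsilon> \<in> {0<..1}"
  shows "weighted_integral I p
           (\<lambda>x. (\<Prod>i\<in>S. x i) * (x k * (1 - \<kappa> * x k)) * (smoothed' I \<gamma> \<epsilon> x / (x k - x j)))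
       = (if j \<in> S then - of_real (\<kappa> / 2) * weighted_integral I p (\<lambda>x. (\<Prod>i\<in>S. x i) * x k * smoothed' I \<gamma> \<epsilon> x)
          else weighted_integral I p (\<lambda>x. (\<Prod>i\<in>S. x i) * smoothed' I \<gamma> \<epsilon> x) / 2
               - of_real \<kappa> * weighted_integral I p (\<lambda>x. (\<Prod>i\<in>S. x i) * x k * smoothed' I \<gamma> \<epsilon> x))"
    (is "weighted_integral I p ?f = ?rhs")
proof -
  let ?t = "Transposition.transpose k j"
  let ?V = "smoothed' I \<gamma> \<epsilon>"
  let ?xS = "\<lambda>x. \<Prod>i\<in>S. x i"
  have \<epsilon>': "\<epsilon> \<in> {0..1}" using \<epsilon> by auto
  have kj: "k \<noteq> j" "j \<in> I" "k \<notin> S" "finite S" using S j I finite_subset by auto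
  have tV: "tame I ?V" using I \<gamma> \<epsilon>' by auto
  have tS: "tame I ?xS" using I S by (intro tame_prod[of S I "\<lambda>i x. x i"]) auto
  have tk: "tame I (\<lambda>x. x k)" and tj: "tame I (\<lambda>x. x j)" using I k kj by auto
  have tf: "tame I ?f"
    using I \<gamma> \<epsilon> k kj by (intro tame_mult tame_diff tame_const tS tk tame_smoothed'_div)
  have sym: "weighted_integral I p g = weighted_integral I p (\<lambda>x. g (x \<circ> ?t))" if "tame I g" for g
    using weighted_integral_transpose[OF I k kj(2) p_measurable tame_measurable[OF that]] by simp
  \<comment> \<open>the envelope is symmetric\<close>
  have tf': "tame I (\<lambda>x. ?f (x \<circ> ?t))"
  proof -
    have "envelope I (x \<circ> ?t) = envelope I x" for x
    proof -
      have "bij_betw ?t I I"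
        by (rule bij_betw_byWitness[of _ ?t]) (use k kj in \<open>auto simp: Transposition.transpose_def\<close>)
      from prod.reindex_bij_betw[OF this, of "\<lambda>i. 1 + \<bar>x i\<bar>"] show ?thesis
        by (simp add: envelope_def)
    qed
    moreover obtain C K where "\<And>x. \<bar>?f x\<bar> \<le> C * envelope I x ^ K" using tf unfolding tame_def by blast
    ultimately have "\<bar>?f (x \<circ> ?t)\<bar> \<le> C * envelope I x ^ K" for x by metis
    then show ?thesis
      using measurable_compose[OF transpose_measurable[OF k kj(2)] tame_measurable[OF tf]] by (intro tameI)
  qed
  have "2 * weighted_integral I p ?f = weighted_integral I p (\<lambda>x. ?f x + ?f (x \<circ> ?t))"
    using sym[OF tf] weighted_integral_add[OF tf tf'] by simp
  also have "\<dots> = 2 * ?rhs"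
  proof (cases "j \<in> S")
    case True
    have xS: "?xS (x \<circ> ?t) * x j = ?xS x * x k" for x
    proof -
      have "?xS (x \<circ> ?t) = x k * (\<Prod>i\<in>S - {j}. x i)"
        using True kj by (subst prod.remove[of _ j], simp, simp,
          intro arg_cong2[of _ _ _ _ "(*)"] prod.cong) (auto simp: Transposition.transpose_def)
      moreover have "?xS x = x j * (\<Prod>i\<in>S - {j}. x i)"
        using True kj by (subst prod.remove[of _ j]) auto
      ultimately show ?thesis by (simp add: mult_ac)
    qed
    have "?f x + ?f (x \<circ> ?t) = (- \<kappa>) * (?xS x * x k * ?V x)" for x
    proof -
      have "?f (x \<circ> ?t) = (?xS (x \<circ> ?t) * x j) * (1 - \<kappa> * x j) * (?V x / (x j - x k))"
        by (simp add: smoothed_transpose[OF I k kj(2)])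
      also have "\<dots> = ?xS x * x k * (1 - \<kappa> * x j) * (?V x / (x j - x k))" by (simp only: xS)
      finally have eq: "?f (x \<circ> ?t) = ?xS x * x k * (1 - \<kappa> * x j) * (?V x / (x j - x k))" .
      show ?thesis
      proof (cases "x k = x j")
        case True
        then have "discriminant I x = 0"
          using k kj I unfolding discriminant_def
          by (subst prod_zero_iff) (auto simp: off_diagonal_def intro: bexI[of _ "(k, j)"] finite_off_diagonal[unfolded off_diagonal_def])
        then show ?thesis using True unfolding eq by (simp add: smoothed'_def)
      next
        case False
        then show ?thesis unfolding eq by (simp add: divide_simps) (simp add: algebra_simps)
      qed
    qed
    then have "weighted_integral I p (\<lambda>x. ?f x + ?f (x \<circ> ?t)) = - of_real \<kappa> * weighted_integral I p (\<lambda>x. ?xS x * x k * ?V x)"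
      using weighted_integral_cmult[of "- \<kappa>" "\<lambda>x. ?xS x * x k * ?V x"] by (simp only: of_real_minus)
    then show ?thesis using True by simp
  next
    case False
    have xS: "?xS (x \<circ> ?t) = ?xS x" for x
      using False kj by (intro prod.cong) (auto simp: Transposition.transpose_def)
    have "?f x + ?f (x \<circ> ?t) = ?xS x * ?V x + (- \<kappa>) * (?xS x * x k * ?V x) + (- \<kappa>) * (?xS x * x j * ?V x)" for x
    proof -
      have eq: "?f (x \<circ> ?t) = ?xS x * (x j * (1 - \<kappa> * x j)) * (?V x / (x j - x k))"
        by (simp add: smoothed_transpose[OF I k kj(2)] xS del: comp_apply) (simp)
      show ?thesis
      proof (cases "x k = x j")
        case True
        then have "discriminant I x = 0"
          using k kj I unfolding discriminant_def
          by (subst prod_zero_iff) (auto simp: off_diagonal_def intro: bexI[of _ "(k, j)"] finite_off_diagonal[unfolded off_diagonal_def])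
        then show ?thesis using True unfolding eq by (simp add: smoothed'_def)
      next
        case False
        then show ?thesis unfolding eq by (simp add: divide_simps) (simp add: algebra_simps)
      qed
    qed
    then have "weighted_integral I p (\<lambda>x. ?f x + ?f (x \<circ> ?t)) =
       weighted_integral I p (\<lambda>x. ?xS x * ?V x) - of_real \<kappa> * weighted_integral I p (\<lambda>x. ?xS x * x k * ?V x)
         - of_real \<kappa> * weighted_integral I p (\<lambda>x. ?xS x * x j * ?V x)"
      by (simp only: weighted_integral_cmult weighted_integral_add tame_add tame_mult tame_const tS tk tj tV) simp
    also have "weighted_integral I p (\<lambda>x. ?xS x * x j * ?V x) = weighted_integral I p (\<lambda>x. ?xS x * x k * ?V x)"
      by (subst sym) (auto intro!: tame_mult tS tj tV simp: smoothed_transpose[OF I k kj(2), unfolded comp_def] xS[unfolded comp_def] comp_def)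
    finally show ?thesis using False by (simp add: comp_def)
  qed
  finally show ?thesis by simp
qed


lemma weighted_integral_LIMSEQ:
  assumes g: "tame I g" and W: "\<And>n. tame I (W n)"
    and bound: "\<And>n x. 0 \<le> W n x \<and> W n x \<le> C * envelope I x ^ K"
    and lim: "\<And>x. (\<lambda>n. W n x) \<longlonglongrightarrow> w x"
  shows "(\<lambda>n. weighted_integral I p (\<lambda>x. g x * W n x)) \<longlonglongrightarrow> weighted_integral I p (\<lambda>x. g x * w x)"
proof -
  let ?b = "\<lambda>x. \<bar>g x\<bar> * (C * envelope I x ^ K)"
  note [measurable] = tame_measurable[OF g] tame_measurable[OF W]
  have "(\<lambda>x. w x) \<in> borel_measurable (PiM I (\<lambda>_. lborel))"
    by (rule borel_measurable_LIMSEQ_real[OF lim]) measurable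
  note [measurable] = this
  have "tame I ?b"
  proof (rule tame_mult)
    show "tame I (\<lambda>x. \<bar>g x\<bar>)" using g unfolding tame_def by auto
    show "tame I (\<lambda>x. C * envelope I x ^ K)"
    proof (rule tameI[of _ _ "\<bar>C\<bar>" K])
      show "(\<lambda>x. C * envelope I x ^ K) \<in> borel_measurable (PiM I (\<lambda>_. lborel))"
        unfolding envelope_def
        by (intro borel_measurable_times borel_measurable_const borel_measurable_power borel_measurable_prod
            borel_measurable_add borel_measurable_abs) (auto intro: measurable_component_singleton)
      show "\<bar>C * envelope I x ^ K\<bar> \<le> \<bar>C\<bar> * envelope I x ^ K" for x
        using envelope_ge_1[of I x] by (simp add: abs_mult)
    qed
  qed
  note int_b = integrable_norm[OF integrable_tame[OF this]]
  show ?thesis unfolding weighted_integral_def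
  proof (rule integral_dominated_convergence[OF _ _ int_b])
    show "AE x in PiM I (\<lambda>_. lborel). (\<lambda>n. of_real (g x * W n x) * (\<Prod>i\<in>I. p (x i)))
        \<longlonglongrightarrow> of_real (g x * w x) * (\<Prod>i\<in>I. p (x i))"
      by (intro AE_I2 tendsto_intros lim)
    show "AE x in PiM I (\<lambda>_. lborel). norm (of_real (g x * W n x) * (\<Prod>i\<in>I. p (x i)))
        \<le> norm (of_real (?b x) * (\<Prod>i\<in>I. p (x i)))" for n
    proof (rule AE_I2)
      fix x
      have "\<bar>W n x\<bar> \<le> \<bar>C * envelope I x ^ K\<bar>" using bound[of n x] by linarith
      then have "\<bar>g x * W n x\<bar> \<le> \<bar>?b x\<bar>"
        unfolding abs_mult[of "g x"] abs_mult[of "\<bar>g x\<bar>"] abs_abs by (intro mult_left_mono) auto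
      then show "norm (of_real (g x * W n x) * (\<Prod>i\<in>I. p (x i))) \<le> norm (of_real (?b x) * (\<Prod>i\<in>I. p (x i)))"
        unfolding norm_mult norm_of_real by (intro mult_right_mono) auto
    qed
  qed measurable
qed

text \<open>
  Both smoothings have the same limit, so the smoothed recursion becomes a recursion between
  the integrals with \<open>discriminant I x powr \<gamma> = \<bar>\<Delta>\<bar> powr (2 * \<gamma>)\<close>.
\<close>

lemma weighted_integral_smoothed_limit:
  assumes g: "tame I g"
  shows "(\<lambda>n. weighted_integral I p (\<lambda>x. g x * smoothed I \<gamma> (1 / real (Suc n)) x))
           \<longlonglongrightarrow> weighted_integral I p (\<lambda>x. g x * discriminant I x powr \<gamma>)"
    and "(\<lambda>n. weighted_integral I p (\<lambda>x. g x * smoothed' I \<gamma> (1 / real (Suc n)) x))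
           \<longlonglongrightarrow> weighted_integral I p (\<lambda>x. g x * discriminant I x powr \<gamma>)"
proof -
  obtain C K where CK: "\<And>\<epsilon> x. \<epsilon> \<in> {0..1} \<Longrightarrow> smoothed I \<gamma> \<epsilon> x \<le> C * envelope I x ^ K"
    using smoothed_le[OF I \<gamma>] by blast
  have \<epsilon>: "1 / real (Suc n) \<in> {0..1}" for n by auto
  have lim0: "(\<lambda>n. discriminant I x + 1 / real (Suc n)) \<longlonglongrightarrow> discriminant I x" for x
    using tendsto_add[OF tendsto_const LIMSEQ_inverse_real_of_nat] by (simp add: divide_inverse)
  have lim1: "(\<lambda>n. smoothed I \<gamma> (1 / real (Suc n)) x) \<longlonglongrightarrow> discriminant I x powr \<gamma>" for x
    unfolding smoothed_def
    by (intro tendsto_powr' lim0 tendsto_const disjI2 conjI \<gamma> always_eventually) auto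
  have lim2: "(\<lambda>n. smoothed' I \<gamma> (1 / real (Suc n)) x) \<longlonglongrightarrow> discriminant I x powr \<gamma>" for x
  proof (cases "discriminant I x = 0")
    case False
    have "(\<lambda>n. smoothed' I \<gamma> (1 / real (Suc n)) x) \<longlonglongrightarrow> discriminant I x * discriminant I x powr (\<gamma> - 1)"
      unfolding smoothed'_def by (intro tendsto_mult tendsto_const tendsto_powr lim0 False)
    then show ?thesis by (simp add: powr_minus_1_mult)
  qed (simp add: smoothed'_def)
  show "(\<lambda>n. weighted_integral I p (\<lambda>x. g x * smoothed I \<gamma> (1 / real (Suc n)) x))
           \<longlonglongrightarrow> weighted_integral I p (\<lambda>x. g x * discriminant I x powr \<gamma>)"
    using CK[OF \<epsilon>] by (intro weighted_integral_LIMSEQ[OF g _ _ lim1] tame_smoothed I \<gamma> \<epsilon>) auto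
  show "(\<lambda>n. weighted_integral I p (\<lambda>x. g x * smoothed' I \<gamma> (1 / real (Suc n)) x))
           \<longlonglongrightarrow> weighted_integral I p (\<lambda>x. g x * discriminant I x powr \<gamma>)"
  proof (rule weighted_integral_LIMSEQ[OF g tame_smoothed(2)[OF I \<gamma> \<epsilon>] _ lim2])
    show "0 \<le> smoothed' I \<gamma> (1 / real (Suc n)) x \<and> smoothed' I \<gamma> (1 / real (Suc n)) x \<le> C * envelope I x ^ K" for n x
      using order_trans[OF smoothed'_le_smoothed CK[OF \<epsilon>]] by simp
  qed
qed

text \<open>
  In \<open>weighted_integral_by_parts\<close> each of the \<open>card S\<close> indices \<open>j \<in> S\<close> and of the \<open>r\<close> indices
  \<open>j \<notin> insert k S\<close> contributes according to \<open>weighted_integral_repulsion\<close>. Letting \<open>\<epsilon>\<close> tend to \<open>0\<close>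
  leaves a linear relation between only two integrals.
\<close>

lemma aomoto_step:
  assumes k: "k \<in> I" and S: "S \<subseteq> I - {k}"
  defines "Z \<equiv> \<lambda>S. weighted_integral I p (\<lambda>x. (\<Prod>i\<in>S. x i) * discriminant I x powr \<gamma>)"
  defines "r \<equiv> real (card I) - 1 - real (card S)"
  shows "(A + of_real (\<gamma> * r)) * Z S = (B + of_real (2 * \<gamma> * \<kappa> * r + \<gamma> * \<kappa> * real (card S))) * Z (insert k S)"
proof -
  let ?\<epsilon> = "\<lambda>n. 1 / real (Suc n)"
  have fin: "finite S" and kS: "k \<notin> S" using S I finite_subset by auto
  let ?xS = "\<lambda>x. \<Prod>i\<in>S. x i"
  define W V where "W = (\<lambda>g \<epsilon>. weighted_integral I p (\<lambda>x. g x * smoothed I \<gamma> \<epsilon> x))"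
    and "V = (\<lambda>g \<epsilon>. weighted_integral I p (\<lambda>x. g x * smoothed' I \<gamma> \<epsilon> x))"
  have tS: "tame I ?xS" using I S by (intro tame_prod[of S I "\<lambda>i x. x i"]) auto
  have tk: "tame I (\<lambda>x. ?xS x * x k)" using I k by (intro tame_mult tS) auto
  have insert: "(\<lambda>x. (\<Prod>i\<in>insert k S. x i) :: real) = (\<lambda>x. ?xS x * x k)"
    using fin kS by (simp add: mult.commute)
  have "A * W ?xS \<epsilon> - B * W (\<lambda>x. ?xS x * x k) \<epsilon>
      + of_real (2 * \<gamma>) * (of_real (card S) * (- of_real (\<kappa> / 2) * V (\<lambda>x. ?xS x * x k) \<epsilon>)
         + of_real r * (V ?xS \<epsilon> / 2 - of_real \<kappa> * V (\<lambda>x. ?xS x * x k) \<epsilon>)) = 0" if \<epsilon>: "\<epsilon> \<in> {0<..1}" for \<epsilon>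
  proof -
    have "(\<Sum>j\<in>I - {k}. weighted_integral I p
           (\<lambda>x. ?xS x * (x k * (1 - \<kappa> * x k)) * (smoothed' I \<gamma> \<epsilon> x / (x k - x j)))) =
          (\<Sum>j\<in>I - {k}. if j \<in> S then - of_real (\<kappa> / 2) * V (\<lambda>x. ?xS x * x k) \<epsilon>
             else V ?xS \<epsilon> / 2 - of_real \<kappa> * V (\<lambda>x. ?xS x * x k) \<epsilon>)"
      unfolding V_def by (intro sum.cong refl weighted_integral_repulsion k S \<epsilon>)
    also have "\<dots> = of_real (card S) * (- of_real (\<kappa> / 2) * V (\<lambda>x. ?xS x * x k) \<epsilon>)
         + of_real (real (card (I - {k} - S))) * (V ?xS \<epsilon> / 2 - of_real \<kappa> * V (\<lambda>x. ?xS x * x k) \<epsilon>)"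
    proof -
      have "(I - {k}) \<inter> {j. j \<in> S} = S" "(I - {k}) \<inter> - {j. j \<in> S} = I - {k} - S" using S by auto
      then show ?thesis using I by (subst sum.If_cases) simp_all
    qed
    also have "real (card (I - {k} - S)) = r"
    proof -
      have "card I \<ge> 1" using I k by (simp add: card_gt_0_iff Suc_le_eq) auto
      moreover have "card S \<le> card (I - {k})" using I S by (intro card_mono) auto
      ultimately show ?thesis
        using I k S fin unfolding r_def by (simp add: card_Diff_subset of_nat_diff)
    qed
    finally show ?thesis
      using weighted_integral_by_parts[OF k S \<epsilon>] unfolding W_def by (simp add: mult.assoc)
  qed
  then have eq0: "(\<lambda>n. A * W ?xS (?\<epsilon> n) - B * W (\<lambda>x. ?xS x * x k) (?\<epsilon> n)
      + of_real (2 * \<gamma>) * (of_real (card S) * (- of_real (\<kappa> / 2) * V (\<lambda>x. ?xS x * x k) (?\<epsilon> n))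
         + of_real r * (V ?xS (?\<epsilon> n) / 2 - of_real \<kappa> * V (\<lambda>x. ?xS x * x k) (?\<epsilon> n)))) = (\<lambda>_. 0)"
    by (intro ext) (auto simp del: of_nat_Suc)
  have Zk: "Z (insert k S) = weighted_integral I p (\<lambda>x. ?xS x * x k * discriminant I x powr \<gamma>)"
    unfolding Z_def using fun_cong[OF insert] by simp
  have "(\<lambda>n. A * W ?xS (?\<epsilon> n) - B * W (\<lambda>x. ?xS x * x k) (?\<epsilon> n)
      + of_real (2 * \<gamma>) * (of_real (card S) * (- of_real (\<kappa> / 2) * V (\<lambda>x. ?xS x * x k) (?\<epsilon> n))
         + of_real r * (V ?xS (?\<epsilon> n) / 2 - of_real \<kappa> * V (\<lambda>x. ?xS x * x k) (?\<epsilon> n)))) \<longlonglongrightarrow>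
     A * Z S - B * Z (insert k S)
      + of_real (2 * \<gamma>) * (of_real (card S) * (- of_real (\<kappa> / 2) * Z (insert k S))
         + of_real r * (Z S / 2 - of_real \<kappa> * Z (insert k S)))"
    unfolding W_def V_def Zk unfolding Z_def
    by (intro tendsto_intros weighted_integral_smoothed_limit tS tk) simp_all
  from LIMSEQ_unique[OF this[unfolded eq0] tendsto_const]
  show ?thesis by (simp add: algebra_simps)
qed

text \<open>
  Adjoining the elements of \<open>I\<close> to the monomial one at a time, the steps multiply up. The index
  \<open>s\<close> counts the coordinates that are still missing after a step, so it runs downwards from
  \<open>card I - 1\<close>.
\<close>

theorem aomoto_recursion:
  defines "Z \<equiv> \<lambda>S. weighted_integral I p (\<lambda>x. (\<Prod>i\<in>S. x i) * discriminant I x powr \<gamma>)"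
  shows "(\<Prod>s<card I. A + of_real (\<gamma> * real s)) * Z {} =
         (\<Prod>s<card I. B + of_real (\<gamma> * \<kappa> * (real (card I) - 1 + real s))) * Z I"
proof -
  define n where "n = card I"
  have "(\<Prod>s\<in>{n - card S..<n}. A + of_real (\<gamma> * real s)) * Z {} =
        (\<Prod>s\<in>{n - card S..<n}. B + of_real (\<gamma> * \<kappa> * (real n - 1 + real s))) * Z S" if "S \<subseteq> I" for S
  proof -
    from that I have "finite S" using finite_subset by blast
    from this that show ?thesis
    proof (induction S rule: finite_induct)
      case (insert k S)
      have card: "card S < n" unfolding n_def using insert I by (intro psubset_card_mono) auto
      have r: "real n - 1 - real (card S) = real (n - Suc (card S))" using card by simp
      have set: "{n - card (insert k S)..<n} = insert (n - Suc (card S)) {n - card S..<n}"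
        using insert card by auto
      have notin: "n - Suc (card S) \<notin> {n - card S..<n}" using card by auto
      let ?a = "\<lambda>s. A + complex_of_real (\<gamma> * real s)"
      let ?b = "\<lambda>s. B + complex_of_real (\<gamma> * \<kappa> * (real n - 1 + real s))"
      have step: "?a (n - Suc (card S)) * Z S = ?b (n - Suc (card S)) * Z (insert k S)"
      proof -
        have "2 * \<gamma> * \<kappa> * real (n - Suc (card S)) + \<gamma> * \<kappa> * real (card S) = \<gamma> * \<kappa> * (real n - 1 + real (n - Suc (card S)))"
          using card by (simp add: algebra_simps of_nat_diff)
        then show ?thesis
          using aomoto_step[of k S] insert(2,4) unfolding Z_def n_def[symmetric] r by auto
      qed
      have "(\<Prod>s\<in>{n - card (insert k S)..<n}. ?a s) * Z {} = ?a (n - Suc (card S)) * ((\<Prod>s\<in>{n - card S..<n}. ?a s) * Z {})"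
        unfolding set using notin by simp
      also have "\<dots> = (\<Prod>s\<in>{n - card S..<n}. ?b s) * (?a (n - Suc (card S)) * Z S)"
        using insert by simp
      also have "\<dots> = (\<Prod>s\<in>{n - card (insert k S)..<n}. ?b s) * Z (insert k S)"
        unfolding set step using notin by simp
      finally show ?case .
    qed simp
  qed
  from this[of I] show ?thesis by (simp add: n_def lessThan_atLeast0)
qed

end

section \<open>The Laguerre and Jacobi weights\<close>
lemma poly_growth_mult:
  assumes "poly_growth f" "poly_growth g" shows "poly_growth (\<lambda>x. f x * g x)"
proof -
  obtain C K where f: "\<And>x. \<bar>f x\<bar> \<le> C * (1 + \<bar>x\<bar>) ^ K" using assms(1) unfolding poly_growth_def by blast
  obtain D L where g: "\<And>x. \<bar>g x\<bar> \<le> D * (1 + \<bar>x\<bar>) ^ L" using assms(2) unfolding poly_growth_def by blast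
  have "\<bar>f x * g x\<bar> \<le> (C * D) * (1 + \<bar>x\<bar>) ^ (K + L)" for x
  proof -
    have "\<bar>f x * g x\<bar> \<le> (C * (1 + \<bar>x\<bar>) ^ K) * (D * (1 + \<bar>x\<bar>) ^ L)"
      unfolding abs_mult using f[of x] g[of x] by (intro mult_mono) linarith+
    then show ?thesis by (simp add: power_add mult_ac)
  qed
  then show ?thesis unfolding poly_growth_def by blast
qed

lemma poly_growth_id: "poly_growth (\<lambda>x. x)"
  unfolding poly_growth_def by (rule exI[of _ 1], rule exI[of _ 1]) auto

lemma integrable_poly_growth:
  fixes p :: "real \<Rightarrow> complex"
  assumes [measurable]: "p \<in> borel_measurable borel" "g \<in> borel_measurable borel"
    and g: "poly_growth g" and p: "\<And>K. integrable lborel (\<lambda>x. of_real ((1 + \<bar>x\<bar>) ^ K) * p x)"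
  shows "integrable lborel (\<lambda>x. of_real (g x) * p x)"
proof -
  obtain C K where CK: "\<And>x. \<bar>g x\<bar> \<le> C * (1 + \<bar>x\<bar>) ^ K" using g unfolding poly_growth_def by blast
  show ?thesis
  proof (rule Bochner_Integration.integrable_bound[OF integrable_mult_right[OF p[of K], of "of_real C"]])
    show "AE x in lborel. norm (of_real (g x) * p x) \<le> norm (of_real C * (of_real ((1 + \<bar>x\<bar>) ^ K) * p x))"
    proof (rule AE_I2)
      fix x
      have "\<bar>g x\<bar> \<le> \<bar>C * (1 + \<bar>x\<bar>) ^ K\<bar>" using CK[of x] by linarith
      then have "\<bar>g x\<bar> * norm (p x) \<le> \<bar>C * (1 + \<bar>x\<bar>) ^ K\<bar> * norm (p x)"
        by (intro mult_right_mono) auto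
      then show "norm (of_real (g x) * p x) \<le> norm (of_real C * (of_real ((1 + \<bar>x\<bar>) ^ K) * p x))"
        by (simp only: norm_mult norm_of_real abs_mult mult.assoc)
    qed
  qed measurable
qed

lemma norm_exp_ln_le:
  assumes "x > 0" "Re z \<ge> 0"
  shows "norm (exp (z * of_real (ln x))) \<le> (1 + \<bar>x\<bar>) ^ nat \<lceil>Re z\<rceil>"
proof -
  have "norm (exp (z * of_real (ln x))) = x powr Re z"
    using assms by (simp add: powr_def)
  also have "\<dots> \<le> (1 + \<bar>x\<bar>) powr Re z" using assms by (intro powr_mono2) auto
  also have "\<dots> \<le> (1 + \<bar>x\<bar>) powr real (nat \<lceil>Re z\<rceil>)"
    using assms by (intro powr_mono) linarith+
  also have "\<dots> = (1 + \<bar>x\<bar>) ^ nat \<lceil>Re z\<rceil>" using assms by (intro powr_realpow) auto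
  finally show ?thesis .
qed

text \<open>
  Multiplying a weight by \<open>x powr z\<close> adds \<open>z / x\<close> to its logarithmic derivative, so
  \<open>x (1 - \<kappa> x) w'/w\<close> gains \<open>z (1 - \<kappa> x)\<close> and Pearson's equation persists with \<open>a + z\<close> and
  \<open>b + \<kappa> z\<close>. The weak form is the fundamental theorem of calculus on \<open>(0, R)\<close>; the boundary terms
  vanish by \<open>lim0\<close> and \<open>limR\<close>.
\<close>

lemma pearson_weight_tilted:
  fixes w :: "real \<Rightarrow> real" and R :: ereal
  assumes R: "R > 0"
    and w [measurable]: "w \<in> borel_measurable borel"
    and w0: "\<And>x. \<not> (0 < x \<and> ereal x < R) \<Longrightarrow> w x = 0"
    and cont: "\<And>x. 0 < x \<Longrightarrow> ereal x < R \<Longrightarrow> isCont w x"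
    and deriv: "\<And>x. 0 < x \<Longrightarrow> ereal x < R \<Longrightarrow>
        ((\<lambda>x. x * (1 - \<kappa> * x) * w x) has_real_derivative (a - b * x) * w x) (at x)"
    and moments: "\<And>K. integrable lborel (\<lambda>x. (1 + \<bar>x\<bar>) ^ K * w x)"
    and lim0: "\<And>K. ((\<lambda>x. (1 + \<bar>x\<bar>) ^ K * (x * (1 - \<kappa> * x) * w x)) \<longlongrightarrow> 0) (at_right 0)"
    and limR: "\<And>K. (((\<lambda>x. (1 + \<bar>x\<bar>) ^ K * (x * (1 - \<kappa> * x) * w x)) \<circ> real_of_ereal) \<longlongrightarrow> 0) (at_left R)"
    and z: "Re z \<ge> 0"
  shows "pearson_weight (of_real a + z) (of_real b + of_real \<kappa> * z) \<kappa>
           (\<lambda>x. of_real (w x) * exp (z * of_real (ln x)))"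
    (is "pearson_weight ?A ?B _ ?p")
proof -
  let ?m = "nat \<lceil>Re z\<rceil>"
  have pm [measurable]: "?p \<in> borel_measurable borel" by measurable
  have bound: "norm (of_real (g * w x) * exp (z * of_real (ln x))) \<le> norm ((1 + \<bar>x\<bar>) ^ ?m * (g * w x))" for g x
  proof (cases "0 < x \<and> ereal x < R")
    case True
    then have "\<bar>g * w x\<bar> * norm (exp (z * of_real (ln x))) \<le> \<bar>g * w x\<bar> * (1 + \<bar>x\<bar>) ^ ?m"
      by (intro mult_left_mono norm_exp_ln_le z) auto
    then show ?thesis by (simp add: norm_mult abs_mult mult_ac)
  qed (simp add: w0)
  have int: "integrable lborel (\<lambda>x. of_real ((1 + \<bar>x\<bar>) ^ K) * ?p x)" for K
  proof (rule Bochner_Integration.integrable_bound[OF moments[of "?m + K"]])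
    show "AE x in lborel. norm (of_real ((1 + \<bar>x\<bar>) ^ K) * ?p x) \<le> norm ((1 + \<bar>x\<bar>) ^ (?m + K) * w x)"
    proof (rule AE_I2)
      fix x show "norm (of_real ((1 + \<bar>x\<bar>) ^ K) * ?p x) \<le> norm ((1 + \<bar>x\<bar>) ^ (?m + K) * w x)"
        using bound[of "(1 + \<bar>x\<bar>) ^ K" x] by (simp add: power_add mult_ac)
    qed
  qed measurable
  have "(\<integral>x. ((?A - ?B * of_real x) * of_real (h x) + of_real (x * (1 - \<kappa> * x) * h' x)) * ?p x \<partial>lborel) = 0"
    if h: "\<And>x. (h has_real_derivative h' x) (at x)" and h': "continuous_on UNIV h'"
      and g: "poly_growth h" "poly_growth h'" for h h'
  proof -
    let ?f = "\<lambda>x. ((?A - ?B * of_real x) * of_real (h x) + of_real (x * (1 - \<kappa> * x) * h' x)) * ?p x"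
    let ?F = "\<lambda>x. of_real (h x * (x * (1 - \<kappa> * x) * w x)) * exp (z * of_real (ln x))"
    have conth: "isCont h x" for x using h by (rule DERIV_isCont)
    have conth': "isCont h' x" for x using h' by (simp add: continuous_on_eq_continuous_at)
    have [measurable]: "h \<in> borel_measurable borel" "h' \<in> borel_measurable borel"
      using conth h' by (auto intro!: borel_measurable_continuous_onI continuous_at_imp_continuous_on)
    have intf: "integrable lborel ?f"
    proof -
      note x_growth = poly_growth_mult[OF poly_growth_id]
      have i: "integrable lborel (\<lambda>x. of_real (q x) * ?p x)" if "poly_growth q" "q \<in> borel_measurable borel" for q
        using integrable_poly_growth[OF pm that(2,1) int] .
      have "integrable lborel (\<lambda>x. ?A * (of_real (h x) * ?p x) - ?B * (of_real (x * h x) * ?p x)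
          + of_real (x * h' x) * ?p x - of_real \<kappa> * (of_real (x * (x * h' x)) * ?p x))"
        by (intro Bochner_Integration.integrable_add Bochner_Integration.integrable_diff integrable_mult_right
              i[OF g(1)] i[OF x_growth[OF g(1)]] i[OF x_growth[OF g(2)]] i[OF x_growth[OF x_growth[OF g(2)]]]) measurable
      then show ?thesis by (simp add: algebra_simps)
    qed
    have "(LBINT x=0..R. ?f x) = 0 - 0"
    proof (rule interval_integral_FTC_integrable[OF R])
      fix x assume x: "0 < ereal x" "ereal x < R"
      then have x0: "x > 0" by simp
      show "isCont ?f x"
        using x0 x by (intro continuous_intros cont conth conth' continuous_of_real) auto
      have d1: "((\<lambda>x. h x * (x * (1 - \<kappa> * x) * w x)) has_real_derivative
          h' x * (x * (1 - \<kappa> * x) * w x) + h x * ((a - b * x) * w x)) (at x)"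
        using DERIV_mult[OF h deriv[OF x0 x(2)]] by (simp only: add.commute mult.commute)
      have d2: "((\<lambda>x. exp (z * of_real (ln x))) has_vector_derivative (z / of_real x) * exp (z * of_real (ln x))) (at x)"
      proof -
        have "((\<lambda>x. z * of_real (ln x)) has_vector_derivative z * of_real (1 / x)) (at x)"
          by (intro has_vector_derivative_mult_right has_vector_derivative_of_real
              DERIV_ln_divide x0)
        from field_vector_diff_chain_at[OF this DERIV_exp]
        show ?thesis by (simp add: o_def mult_ac)
      qed
      have "(?F has_vector_derivative of_real (h x * (x * (1 - \<kappa> * x) * w x)) * ((z / of_real x) * exp (z * of_real (ln x)))
          + of_real (h' x * (x * (1 - \<kappa> * x) * w x) + h x * ((a - b * x) * w x)) * exp (z * of_real (ln x))) (at x)"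
        by (intro has_vector_derivative_mult has_vector_derivative_of_real d2 d1)
      also have "of_real (h x * (x * (1 - \<kappa> * x) * w x)) * ((z / of_real x) * exp (z * of_real (ln x)))
          + of_real (h' x * (x * (1 - \<kappa> * x) * w x) + h x * ((a - b * x) * w x)) * exp (z * of_real (ln x)) = ?f x"
      proof -
        have "of_real (h x * (x * (1 - \<kappa> * x) * w x)) * ((z / of_real x) * exp (z * of_real (ln x))) =
            z * of_real (h x * ((1 - \<kappa> * x) * w x)) * exp (z * of_real (ln x))"
          using x0 by simp
        then show ?thesis by (simp only:) (simp add: algebra_simps)
      qed
      finally show "(?F has_vector_derivative ?f x) (at x)" .
    next
      show "set_integrable lborel (einterval 0 R) ?f"
        unfolding set_integrable_def using intf by (intro integrable_mult_indicator) auto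
    next
      obtain C K where CK: "\<And>x. \<bar>h x\<bar> \<le> C * (1 + \<bar>x\<bar>) ^ K" using g(1) unfolding poly_growth_def by blast
      have Fb: "norm (?F x) \<le> \<bar>C * ((1 + \<bar>x\<bar>) ^ (?m + K) * (x * (1 - \<kappa> * x) * w x))\<bar>" for x
      proof -
        have "norm (?F x) \<le> \<bar>h x\<bar> * \<bar>(1 + \<bar>x\<bar>) ^ ?m * (x * (1 - \<kappa> * x) * w x)\<bar>"
          using bound[of "h x * (x * (1 - \<kappa> * x))" x] by (simp add: abs_mult mult_ac)
        also have "\<dots> \<le> \<bar>C * (1 + \<bar>x\<bar>) ^ K\<bar> * \<bar>(1 + \<bar>x\<bar>) ^ ?m * (x * (1 - \<kappa> * x) * w x)\<bar>"
          using CK[of x] by (intro mult_right_mono) auto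
        finally show ?thesis by (simp add: abs_mult power_add mult_ac)
      qed
      have G0: "((\<lambda>x. \<bar>C * ((1 + \<bar>x\<bar>) ^ (?m + K) * (x * (1 - \<kappa> * x) * w x))\<bar>) \<longlongrightarrow> 0) (at_right 0)"
        by (intro tendsto_rabs_zero tendsto_mult_right_zero lim0)
      have "(?F \<longlongrightarrow> 0) (at_right 0)"
        by (rule Lim_null_comparison[OF _ G0]) (intro always_eventually allI Fb)
      then show "((?F \<circ> real_of_ereal) \<longlongrightarrow> 0) (at_right 0)"
        unfolding zero_ereal_def ereal_tendsto_simps .
      have "((\<lambda>x. \<bar>C * (((\<lambda>x. (1 + \<bar>x\<bar>) ^ (?m + K) * (x * (1 - \<kappa> * x) * w x)) \<circ> real_of_ereal) x)\<bar>) \<longlongrightarrow> 0) (at_left R)"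
        by (intro tendsto_rabs_zero tendsto_mult_right_zero limR)
      then show "((?F \<circ> real_of_ereal) \<longlongrightarrow> 0) (at_left R)"
        by (rule Lim_null_comparison[rotated]) (intro always_eventually allI, unfold o_def, rule Fb)
    qed
    also have "(LBINT x=0..R. ?f x) = (\<integral>x. ?f x \<partial>lborel)"
      using R unfolding interval_lebesgue_integral_def set_lebesgue_integral_def
      by (auto simp: less_imp_le intro!: Bochner_Integration.integral_cong)
         (auto simp: indicator_def einterval_def w0 zero_ereal_def)
    finally show ?thesis by simp
  qed
  then show ?thesis unfolding pearson_weight_def using pm int by blast
qed

definition laguerre_weight1 :: "real \<Rightarrow> real \<Rightarrow> real" where
  "laguerre_weight1 a x = (if 0 < x then x powr (a - 1) * exp (- x / 2) else 0)"

definition jacobi_weight1 :: "real \<Rightarrow> real \<Rightarrow> real \<Rightarrow> real" where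
  "jacobi_weight1 a b x = (if 0 < x \<and> x < 1 then x powr (a - 1) * (1 - x) powr (b - 1) else 0)"

lemma laguerre_weight1_measurable [measurable]: "laguerre_weight1 a \<in> borel_measurable borel"
  unfolding laguerre_weight1_def by measurable

lemma jacobi_weight1_measurable [measurable]: "jacobi_weight1 a b \<in> borel_measurable borel"
  unfolding jacobi_weight1_def by measurable

lemma integrable_laguerre_weight1:
  assumes "a > 0" shows "integrable lborel (laguerre_weight1 a)"
proof -
  have "(\<lambda>t. complex_of_real t powr (of_real a - 1) / of_real (exp (1/2 * t))) absolutely_integrable_on {0<..}"
    using assms by (intro absolutely_integrable_Gamma_integral) auto
  then have "integrable lebesgue (\<lambda>t. norm (indicator {0<..} t *\<^sub>R (complex_of_real t powr (of_real a - 1) / of_real (exp (1/2 * t)))))"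
    unfolding set_integrable_def by (rule integrable_norm)
  also have "(\<lambda>t. norm (indicator {0<..} t *\<^sub>R (complex_of_real t powr (of_real a - 1) / of_real (exp (1/2 * t))))) = laguerre_weight1 a"
    by (auto simp: fun_eq_iff laguerre_weight1_def norm_divide norm_powr_real_powr exp_minus field_simps)
  finally show ?thesis by (subst (asm) integrable_completion) auto
qed

lemma one_plus_power_le: "(x::real) \<ge> 0 \<Longrightarrow> (1 + x) ^ K \<le> 2 ^ K * (1 + x ^ K)"
proof -
  assume x: "x \<ge> 0"
  have "(1 + x) ^ K \<le> (2 * max 1 x) ^ K" using x by (intro power_mono) auto
  also have "\<dots> = 2 ^ K * max 1 x ^ K" by (simp add: power_mult_distrib)
  also have "max 1 x ^ K \<le> 1 + x ^ K" using x by (auto simp: max_def)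
  finally show ?thesis by simp
qed

lemma pearson_laguerre:
  assumes a: "a > 0" and z: "Re z \<ge> 0"
  shows "pearson_weight (of_real a + z) (1 / 2) 0 (\<lambda>x. of_real (laguerre_weight1 a x) * exp (z * of_real (ln x)))"
proof -
  have "pearson_weight (of_real a + z) (of_real (1/2) + of_real 0 * z) 0 (\<lambda>x. of_real (laguerre_weight1 a x) * exp (z * of_real (ln x)))"
  proof (rule pearson_weight_tilted[where R = \<infinity>, OF _ _ _ _ _ _ _ _ z])
    fix x :: real assume x: "0 < x"
    have ev: "\<forall>\<^sub>F y in nhds x. laguerre_weight1 a y = y powr (a - 1) * exp (- y / 2)"
      using eventually_nhds_in_open[OF open_greaterThan, of x 0] x by (auto elim!: eventually_mono simp: laguerre_weight1_def)
    show "isCont (laguerre_weight1 a) x"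
      using x by (subst isCont_cong[OF ev]) (auto intro!: continuous_intros)
    show "((\<lambda>x. x * (1 - 0 * x) * laguerre_weight1 a x) has_real_derivative (a - 1/2 * x) * laguerre_weight1 a x) (at x)"
    proof -
      have "((\<lambda>y. y powr a * exp (- y / 2)) has_real_derivative (a - 1/2 * x) * laguerre_weight1 a x) (at x)"
      proof -
        have xa: "x powr a = x * x powr (a - 1)" using x by (simp add: powr_diff)
        have "((\<lambda>y. exp (- y / 2)) has_real_derivative exp (- x / 2) * (- 1 / 2)) (at x)"
          by (intro DERIV_chain2[where f = exp and g = "\<lambda>y. - y / 2"] DERIV_exp) (auto intro!: derivative_eq_intros)
        then have "((\<lambda>y. y powr a * exp (- y / 2)) has_real_derivative
            a * x powr (a - 1) * exp (- x / 2) + exp (- x / 2) * (- 1 / 2) * x powr a) (at x)"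
          using x by (intro DERIV_mult has_real_derivative_powr) auto
        also have "a * x powr (a - 1) * exp (- x / 2) + exp (- x / 2) * (- 1 / 2) * x powr a = (a - 1/2 * x) * laguerre_weight1 a x"
          unfolding xa using x by (simp add: laguerre_weight1_def algebra_simps)
        finally show ?thesis .
      qed
      moreover have "\<forall>\<^sub>F y in nhds x. y * (1 - 0 * y) * laguerre_weight1 a y = y powr a * exp (- y / 2)"
        using eventually_nhds_in_open[OF open_greaterThan, of x 0] x
        by (auto elim!: eventually_mono simp: laguerre_weight1_def powr_diff)
      ultimately show ?thesis by (subst DERIV_cong_ev[OF refl _ refl])
    qed
  next
    fix K
    show "integrable lborel (\<lambda>x. (1 + \<bar>x\<bar>) ^ K * laguerre_weight1 a x)"
    proof (rule Bochner_Integration.integrable_bound)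
      show "integrable lborel (\<lambda>x. 2 ^ K * (laguerre_weight1 a x + laguerre_weight1 (a + real K) x))"
        using a by (intro integrable_mult_right Bochner_Integration.integrable_add integrable_laguerre_weight1) auto
      have "(1 + \<bar>x\<bar>) ^ K * laguerre_weight1 a x \<le> 2 ^ K * (laguerre_weight1 a x + laguerre_weight1 (a + real K) x)" for x
      proof (cases "x > 0")
        case True
        have "(1 + \<bar>x\<bar>) ^ K * laguerre_weight1 a x \<le> (2 ^ K * (1 + x ^ K)) * laguerre_weight1 a x"
          using one_plus_power_le[of x K] True by (intro mult_right_mono) (auto simp: laguerre_weight1_def)
        also have "x ^ K * laguerre_weight1 a x = laguerre_weight1 (a + real K) x"
          using True by (simp add: laguerre_weight1_def powr_add powr_diff powr_realpow)
        then have "(2 ^ K * (1 + x ^ K)) * laguerre_weight1 a x = 2 ^ K * (laguerre_weight1 a x + laguerre_weight1 (a + real K) x)"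
          by (simp add: algebra_simps)
        finally show ?thesis .
      qed (auto simp: laguerre_weight1_def)
      moreover have "laguerre_weight1 c x \<ge> 0" for c x by (simp add: laguerre_weight1_def)
      ultimately show "AE x in lborel. norm ((1 + \<bar>x\<bar>) ^ K * laguerre_weight1 a x) \<le> norm (2 ^ K * (laguerre_weight1 a x + laguerre_weight1 (a + real K) x))"
        by (intro AE_I2) (simp add: abs_mult)
    qed measurable
    have "((\<lambda>x::real. (1 + \<bar>x\<bar>) ^ K * (x * (x powr (a-1) * exp (-x/2)))) \<longlongrightarrow> 0) (at_right 0)"
      using a by real_asymp
    then show "((\<lambda>x. (1 + \<bar>x\<bar>) ^ K * (x * (1 - 0 * x) * laguerre_weight1 a x)) \<longlongrightarrow> 0) (at_right 0)"
      by (rule Lim_transform_eventually) (auto simp: laguerre_weight1_def intro!: eventually_mono[OF eventually_at_right_less])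
    have "((\<lambda>x::real. (1 + \<bar>x\<bar>) ^ K * (x * (x powr (a-1) * exp (-x/2)))) \<longlongrightarrow> 0) at_top"
      using a by real_asymp
    then have "((\<lambda>x. (1 + \<bar>x\<bar>) ^ K * (x * (1 - 0 * x) * laguerre_weight1 a x)) \<longlongrightarrow> 0) at_top"
      by (rule Lim_transform_eventually) (auto simp: laguerre_weight1_def intro!: eventually_mono[OF eventually_gt_at_top[of 0]])
    then show "(((\<lambda>x. (1 + \<bar>x\<bar>) ^ K * (x * (1 - 0 * x) * laguerre_weight1 a x)) \<circ> real_of_ereal) \<longlongrightarrow> 0) (at_left \<infinity>)"
      unfolding ereal_tendsto_simps .
  qed (auto simp: laguerre_weight1_def)
  then show ?thesis by simp
qed

lemma integrable_jacobi_weight1: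
  assumes "a > 0" "b > 0" shows "integrable lborel (jacobi_weight1 a b)"
proof -
  have "integrable lborel (\<lambda>t. indicator {0..1} t *\<^sub>R (t powr (a - 1) * (1 - t) powr (b - 1)))"
    using integrable_Beta[OF assms] unfolding set_integrable_def .
  also have "(\<lambda>t. indicator {0..1} t *\<^sub>R (t powr (a - 1) * (1 - t) powr (b - 1))) = jacobi_weight1 a b"
    by (auto simp: fun_eq_iff jacobi_weight1_def indicator_def)
  finally show ?thesis .
qed

lemma pearson_jacobi:
  assumes a: "a > 0" and b: "b > 0" and z: "Re z \<ge> 0"
  shows "pearson_weight (of_real a + z) (of_real (a + b) + z) 1 (\<lambda>x. of_real (jacobi_weight1 a b x) * exp (z * of_real (ln x)))"
proof -
  have "pearson_weight (of_real a + z) (of_real (a + b) + of_real 1 * z) 1 (\<lambda>x. of_real (jacobi_weight1 a b x) * exp (z * of_real (ln x)))"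
  proof (rule pearson_weight_tilted[where R = 1, OF _ _ _ _ _ _ _ _ z])
    fix x :: real assume x: "0 < x" "ereal x < 1"
    then have x1: "x < 1" by (simp add: one_ereal_def)
    have ev: "\<forall>\<^sub>F y in nhds x. y \<in> {0<..<1}"
      using eventually_nhds_in_open[OF open_greaterThanLessThan, of x 0 1] x x1 by auto
    have ev': "\<forall>\<^sub>F y in nhds x. jacobi_weight1 a b y = y powr (a - 1) * (1 - y) powr (b - 1)"
      using ev by (auto elim!: eventually_mono simp: jacobi_weight1_def)
    show "isCont (jacobi_weight1 a b) x"
      using x x1 by (subst isCont_cong[OF ev']) (auto intro!: continuous_intros)
    show "((\<lambda>x. x * (1 - 1 * x) * jacobi_weight1 a b x) has_real_derivative (a - (a + b) * x) * jacobi_weight1 a b x) (at x)"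
    proof -
      have "((\<lambda>y. y powr a * (1 - y) powr b) has_real_derivative (a - (a + b) * x) * jacobi_weight1 a b x) (at x)"
      proof -
        let ?X = "x powr (a - 1)" and ?Y = "(1 - x) powr (b - 1)"
        have XY: "x powr a = x * ?X" "(1 - x) powr b = (1 - x) * ?Y"
          using x x1 by (simp_all add: powr_diff)
        have "((\<lambda>y. (1 - y) powr b) has_real_derivative b * ?Y * (- 1)) (at x)"
          using x1 by (intro DERIV_chain2[where f = "\<lambda>u. u powr b" and g = "\<lambda>y. 1 - y"] has_real_derivative_powr)
            (auto intro!: derivative_eq_intros)
        then have "((\<lambda>y. y powr a * (1 - y) powr b) has_real_derivative
            a * ?X * (1 - x) powr b + b * ?Y * (- 1) * x powr a) (at x)"
          using x by (intro DERIV_mult has_real_derivative_powr) auto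
        also have "a * ?X * (1 - x) powr b + b * ?Y * (- 1) * x powr a = (a - (a + b) * x) * jacobi_weight1 a b x"
          unfolding XY using x x1 by (simp add: jacobi_weight1_def algebra_simps)
        finally show ?thesis .
      qed
      moreover have "\<forall>\<^sub>F y in nhds x. y * (1 - 1 * y) * jacobi_weight1 a b y = y powr a * (1 - y) powr b"
        using ev
      proof eventually_elim
        case (elim y)
        then show ?case using powr_minus_1_mult[of y a] powr_minus_1_mult[of "1 - y" b]
          by (simp add: jacobi_weight1_def) (metis mult.assoc mult.left_commute)
      qed
      ultimately show ?thesis by (subst DERIV_cong_ev[OF refl _ refl])
    qed
  next
    fix K
    show "integrable lborel (\<lambda>x. (1 + \<bar>x\<bar>) ^ K * jacobi_weight1 a b x)"
    proof (rule Bochner_Integration.integrable_bound)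
      show "integrable lborel (\<lambda>x. 2 ^ K * jacobi_weight1 a b x)"
        using a b by (intro integrable_mult_right integrable_jacobi_weight1) auto
      have "(1 + \<bar>x\<bar>) ^ K * jacobi_weight1 a b x \<le> 2 ^ K * jacobi_weight1 a b x" for x
        by (auto simp: jacobi_weight1_def intro!: mult_right_mono power_mono)
      moreover have "jacobi_weight1 a b x \<ge> 0" for x by (simp add: jacobi_weight1_def)
      ultimately show "AE x in lborel. norm ((1 + \<bar>x\<bar>) ^ K * jacobi_weight1 a b x) \<le> norm (2 ^ K * jacobi_weight1 a b x)"
        by (intro AE_I2) (simp add: abs_mult)
    qed measurable
    have ev0: "\<forall>\<^sub>F x in at_right 0. x \<in> {0<..<1::real}"
      by (rule eventually_at_right_real) simp
    have "((\<lambda>x::real. (1 + \<bar>x\<bar>) ^ K * (x * (1-x) * (x powr (a-1) * (1-x) powr (b-1)))) \<longlongrightarrow> 0) (at_right 0)"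
      using a by real_asymp
    then show "((\<lambda>x. (1 + \<bar>x\<bar>) ^ K * (x * (1 - 1 * x) * jacobi_weight1 a b x)) \<longlongrightarrow> 0) (at_right 0)"
      by (rule Lim_transform_eventually) (use ev0 in \<open>auto elim!: eventually_mono simp: jacobi_weight1_def\<close>)
    have ev1: "\<forall>\<^sub>F x in at_left 1. x \<in> {0<..<1::real}"
      by (rule eventually_at_left_real) simp
    have "((\<lambda>x::real. (1 + \<bar>x\<bar>) ^ K * (x * x powr (a-1) * (1-x) powr b)) \<longlongrightarrow> (1 + \<bar>1\<bar>) ^ K * (1 * 1 powr (a-1) * 0)) (at_left 1)"
    proof -
      have "((\<lambda>x::real. (1-x) powr b) \<longlongrightarrow> 0) (at_left 1)" using b by real_asymp
      then show ?thesis by (intro tendsto_intros) auto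
    qed
    then have "((\<lambda>x. (1 + \<bar>x\<bar>) ^ K * (x * (1 - 1 * x) * jacobi_weight1 a b x)) \<longlongrightarrow> (1 + \<bar>1\<bar>) ^ K * (1 * 1 powr (a-1) * 0)) (at_left 1)"
    proof (rule Lim_transform_eventually)
      show "\<forall>\<^sub>F x in at_left 1. (1 + \<bar>x\<bar>) ^ K * (x * x powr (a-1) * (1-x) powr b) = (1 + \<bar>x\<bar>) ^ K * (x * (1 - 1 * x) * jacobi_weight1 a b x)"
        using ev1
      proof eventually_elim
        case (elim x)
        then show ?case using powr_minus_1_mult[of "1 - x" b] by (simp add: jacobi_weight1_def mult_ac)
      qed
    qed
    then show "(((\<lambda>x. (1 + \<bar>x\<bar>) ^ K * (x * (1 - 1 * x) * jacobi_weight1 a b x)) \<circ> real_of_ereal) \<longlongrightarrow> 0) (at_left 1)"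
      unfolding one_ereal_def ereal_tendsto_simps by simp
  qed (auto simp: jacobi_weight1_def one_ereal_def)
  then show ?thesis by simp
qed

section \<open>Mellin recursions for the three determinants\<close>
text \<open>
  The recursion \<open>E exp ((z + 1) Y) = R z * E exp (z Y)\<close> for the rational function \<open>R\<close> with zeros
  \<open>- num s\<close>, poles \<open>- den s\<close> and leading coefficient \<open>C\<close>, cleared of denominators.
\<close>

definition mellin_recursion ::
    "'w measure \<Rightarrow> ('w \<Rightarrow> real) \<Rightarrow> real \<Rightarrow> nat \<Rightarrow> (nat \<Rightarrow> real) \<Rightarrow> nat \<Rightarrow> (nat \<Rightarrow> real) \<Rightarrow> bool" where
  "mellin_recursion M Y C K num L den \<longleftrightarrow> Y \<in> borel_measurable M \<and>
     (\<forall>z. Re z \<ge> 0 \<longrightarrow> integrable M (\<lambda>\<omega>. exp (z * of_real (Y \<omega>))) \<and>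
        (\<Prod>s<L. of_real (den s) + z) * (\<integral>\<omega>. exp ((z + 1) * of_real (Y \<omega>)) \<partial>M) =
        of_real C * (\<Prod>s<K. of_real (num s) + z) * (\<integral>\<omega>. exp (z * of_real (Y \<omega>)) \<partial>M))"

lemma abs_vandermonde_powr: "abs_vandermonde n x powr \<beta> = discriminant {1..n} x powr (\<beta> / 2)"
proof -
  let ?f = "\<lambda>(i, j). \<bar>x i - x j\<bar>"
  let ?U = "Sigma {1..n} (\<lambda>k. {1..<k})"
  have V: "abs_vandermonde n x = prod ?f ?U"
    unfolding abs_vandermonde_def by (subst prod.Sigma) auto
  have eq: "off_diagonal {1..n} = ?U \<union> prod.swap ` ?U"
  proof (intro set_eqI iffI)
    fix y assume "y \<in> off_diagonal {1..n}"
    then obtain i j where y: "y = (i, j)" "i \<in> {1..n}" "j \<in> {1..n}" "i \<noteq> j" by (auto simp: off_diagonal_def)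
    then consider "j < i" | "i < j" by linarith
    then show "y \<in> ?U \<union> prod.swap ` ?U"
    proof cases
      case 2
      then have "(j, i) \<in> ?U" using y by auto
      then have "prod.swap (j, i) \<in> prod.swap ` ?U" by (rule imageI)
      then show ?thesis using y by simp
    qed (use y in auto)
  qed (auto simp: off_diagonal_def)
  have "discriminant {1..n} x = prod ?f ?U * prod ?f (prod.swap ` ?U)"
    unfolding discriminant_def eq by (rule prod.union_disjoint) auto
  also have "prod ?f (prod.swap ` ?U) = prod ?f ?U"
    by (subst prod.reindex) (auto simp: case_prod_unfold abs_minus_commute inj_on_def intro!: prod.cong)
  finally have D: "discriminant {1..n} x = (abs_vandermonde n x)\<^sup>2" by (simp add: V power2_eq_square)
  have "abs_vandermonde n x \<ge> 0" unfolding abs_vandermonde_def by (intro prod_nonneg) auto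
  then have "((abs_vandermonde n x)\<^sup>2) powr (\<beta> / 2) = abs_vandermonde n x powr \<beta>"
  proof (cases "abs_vandermonde n x = 0")
    case False
    then have "(abs_vandermonde n x)\<^sup>2 = abs_vandermonde n x powr 2"
      using \<open>abs_vandermonde n x \<ge> 0\<close> by simp
    then show ?thesis by (simp only: powr_powr) simp
  qed simp
  then show ?thesis unfolding D by simp
qed

text \<open>
  On the support of the density \<open>exp (z * ln D) = (\<Prod>i\<in>I. x i powr z)\<close>, so the factor can be
  absorbed into the one-dimensional weights, and the passage from \<open>z\<close> to \<open>z + 1\<close> inserts the
  monomial \<open>\<Prod>i\<in>I. x i\<close>. The normalising constant \<open>c\<close> cancels.
\<close>

lemma mellin_recursion_density:
  fixes \<Lambda> :: "'w \<Rightarrow> 'i \<Rightarrow> real" and w :: "real \<Rightarrow> real"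
  assumes I: "finite I" and \<gamma>: "\<gamma> > 0" and c: "c > 0"
    and dist: "distributed P (PiM I (\<lambda>_. lborel)) \<Lambda> (\<lambda>x. ennreal (c * (discriminant I x powr \<gamma> * (\<Prod>i\<in>I. w (x i)))))"
    and w: "\<And>x. w x \<ge> 0" "\<And>x. x \<le> 0 \<Longrightarrow> w x = 0"
    and pw: "\<And>z. Re z \<ge> 0 \<Longrightarrow> pearson_weight (of_real a + z) (of_real b + of_real \<kappa> * z) \<kappa> (\<lambda>x. of_real (w x) * exp (z * of_real (ln x)))"
    and D: "\<And>\<omega>. \<omega> \<in> space P \<Longrightarrow> D \<omega> = (\<Prod>i\<in>I. \<Lambda> \<omega> i)"
  shows "D \<in> borel_measurable P"
    and "Re z \<ge> 0 \<Longrightarrow> integrable P (\<lambda>\<omega>. exp (z * of_real (ln (D \<omega>))))"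
    and "Re z \<ge> 0 \<Longrightarrow> (\<Prod>s<card I. of_real (b + \<gamma> * \<kappa> * (real (card I) - 1 + real s)) + of_real \<kappa> * z) * (\<integral>\<omega>. exp ((z + 1) * of_real (ln (D \<omega>))) \<partial>P) =
        (\<Prod>s<card I. of_real (a + \<gamma> * real s) + z) * (\<integral>\<omega>. exp (z * of_real (ln (D \<omega>))) \<partial>P)"
proof -
  let ?M = "PiM I (\<lambda>_. lborel :: real measure)"
  let ?dens = "\<lambda>x. c * (discriminant I x powr \<gamma> * (\<Prod>i\<in>I. w (x i)))"
  let ?p = "\<lambda>z x. of_real (w x) * exp (z * of_real (ln x)) :: complex"
  note distr = distributed_distr_eq_density[OF dist]
  have \<Lambda> [measurable]: "\<Lambda> \<in> measurable P ?M" by (rule distributed_measurable[OF dist])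
  have nonneg: "?dens x \<ge> 0" for x using c by (intro mult_nonneg_nonneg prod_nonneg ballI w) auto
  have tp: "tame I (\<lambda>x. \<Prod>i\<in>I. x i)" using I by (intro tame_prod[of I I "\<lambda>i x. x i"]) auto
  have [measurable]: "(\<lambda>x. \<Prod>i\<in>I. x i) \<in> borel_measurable ?M" by (rule tame_measurable[OF tp])
  have D': "exp (z * of_real (ln (D \<omega>))) = exp (z * of_real (ln (\<Prod>i\<in>I. \<Lambda> \<omega> i)))" if "\<omega> \<in> space P" for \<omega> z
    using D that by simp
  have dmeas: "?dens \<in> borel_measurable ?M"
  proof -
    have "(\<lambda>x. enn2real (ennreal (?dens x))) \<in> borel_measurable ?M"
      using distributed_borel_measurable[OF dist] by measurable
    then show ?thesis using nonneg by (simp add: enn2real_ennreal)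
  qed
  have "(\<lambda>\<omega>. \<Prod>i\<in>I. \<Lambda> \<omega> i) \<in> borel_measurable P"
    by (rule measurable_compose[OF \<Lambda>]) measurable
  then show Dm: "D \<in> borel_measurable P" using D by (simp cong: measurable_cong)
  have pos: "(\<Prod>i\<in>I. x i) > 0 \<and> ln (\<Prod>i\<in>I. x i) = (\<Sum>i\<in>I. ln (x i))" if "\<And>i. i \<in> I \<Longrightarrow> x i > 0" for x :: "'i \<Rightarrow> real"
  proof -
    have "(\<Prod>i\<in>I. x i) > 0" using that by (intro prod_pos) auto
    moreover have "ln (\<Prod>i\<in>I. x i) = (\<Sum>i\<in>I. ln (x i))" using that I by (intro ln_prod) force+
    ultimately show ?thesis by simp
  qed
  have tilt: "?dens x *\<^sub>R exp (z * of_real (ln (\<Prod>i\<in>I. x i))) =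
      of_real c * (of_real (discriminant I x powr \<gamma>) * (\<Prod>i\<in>I. ?p z (x i)))" for x z
  proof (cases "\<forall>i\<in>I. x i > 0")
    case True
    then show ?thesis using pos[of x]
      by (simp add: scaleR_conv_of_real prod.distrib exp_sum[OF I, symmetric] sum_distrib_left mult_ac)
  next
    case False
    then obtain i where "i \<in> I" "x i \<le> 0" by force
    \<comment> \<open>outside the positive orthant both weights vanish\<close>
    then have "(\<Prod>i\<in>I. w (x i)) = 0" "(\<Prod>i\<in>I. ?p z (x i)) = 0" using w(2) I by (auto intro!: bexI[of _ i])
    then show ?thesis by simp
  qed
  have tilt': "?dens x *\<^sub>R exp ((z + 1) * of_real (ln (\<Prod>i\<in>I. x i))) =
      of_real c * (of_real ((\<Prod>i\<in>I. x i) * discriminant I x powr \<gamma>) * (\<Prod>i\<in>I. ?p z (x i)))" for x z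
  proof (cases "\<forall>i\<in>I. x i > 0")
    case True
    have eP: "exp ((z + 1) * of_real (ln y)) = exp (z * of_real (ln y)) * of_real y" if "y > 0" for y
      using that by (simp add: distrib_right exp_add exp_of_real)
    have "(\<Prod>i\<in>I. x i) > 0" using pos[of x] True by blast
    note eP = eP[OF this]
    have "?dens x *\<^sub>R exp ((z + 1) * of_real (ln (\<Prod>i\<in>I. x i))) =
        of_real (\<Prod>i\<in>I. x i) * (?dens x *\<^sub>R exp (z * of_real (ln (\<Prod>i\<in>I. x i))))"
      unfolding eP by (simp only: scaleR_conv_of_real mult_ac)
    also have "\<dots> = of_real c * (of_real ((\<Prod>i\<in>I. x i) * discriminant I x powr \<gamma>) * (\<Prod>i\<in>I. ?p z (x i)))"
      unfolding tilt by (simp only: of_real_mult mult_ac)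
    finally show ?thesis .
  next
    case False
    then obtain i where "i \<in> I" "x i \<le> 0" by force
    \<comment> \<open>outside the positive orthant both weights vanish\<close>
    then have "(\<Prod>i\<in>I. w (x i)) = 0" "(\<Prod>i\<in>I. ?p z (x i)) = 0" using w(2) I by (auto intro!: bexI[of _ i])
    then show ?thesis by simp
  qed
  have E: "(\<integral>\<omega>. exp (z * of_real (ln (D \<omega>))) \<partial>P) = (\<integral>x. ?dens x *\<^sub>R exp (z * of_real (ln (\<Prod>i\<in>I. x i))) \<partial>?M)" for z :: complex
  proof -
    have "(\<integral>\<omega>. exp (z * of_real (ln (D \<omega>))) \<partial>P) = (\<integral>\<omega>. exp (z * of_real (ln (\<Prod>i\<in>I. \<Lambda> \<omega> i))) \<partial>P)"
      by (intro Bochner_Integration.integral_cong refl D')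
    also have "\<dots> = (\<integral>x. exp (z * of_real (ln (\<Prod>i\<in>I. x i))) \<partial>distr P ?M \<Lambda>)"
      by (subst integral_distr[OF \<Lambda>]) measurable
    also have "\<dots> = (\<integral>x. ?dens x *\<^sub>R exp (z * of_real (ln (\<Prod>i\<in>I. x i))) \<partial>?M)"
      unfolding distr using nonneg dmeas by (intro integral_density) auto
    finally show ?thesis .
  qed
  show "integrable P (\<lambda>\<omega>. exp (z * of_real (ln (D \<omega>))))" if z: "Re z \<ge> 0"
  proof -
    have "integrable ?M (\<lambda>x. of_real (discriminant I x powr \<gamma>) * (\<Prod>i\<in>I. ?p z (x i)))"
      using tame_smoothed(1)[OF I \<gamma>, of 0] by (intro integrable_tame[OF I pw[OF z] \<gamma>]) (simp add: smoothed_0[abs_def])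
    then have "integrable ?M (\<lambda>x. ?dens x *\<^sub>R exp (z * of_real (ln (\<Prod>i\<in>I. x i))))"
      unfolding tilt by (rule integrable_mult_right)
    then have "integrable (distr P ?M \<Lambda>) (\<lambda>x. exp (z * of_real (ln (\<Prod>i\<in>I. x i))))"
      unfolding distr using nonneg dmeas by (subst integrable_density) auto
    then have "integrable P (\<lambda>\<omega>. exp (z * of_real (ln (\<Prod>i\<in>I. \<Lambda> \<omega> i))))"
      by (subst (asm) integrable_distr_eq[OF \<Lambda>]) measurable
    then show ?thesis by (subst Bochner_Integration.integrable_cong[OF refl D'])
  qed
  show "(\<Prod>s<card I. of_real (b + \<gamma> * \<kappa> * (real (card I) - 1 + real s)) + of_real \<kappa> * z) * (\<integral>\<omega>. exp ((z + 1) * of_real (ln (D \<omega>))) \<partial>P) =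
        (\<Prod>s<card I. of_real (a + \<gamma> * real s) + z) * (\<integral>\<omega>. exp (z * of_real (ln (D \<omega>))) \<partial>P)" if z: "Re z \<ge> 0"
  proof -
    have "(\<integral>\<omega>. exp (z * of_real (ln (D \<omega>))) \<partial>P) =
        of_real c * weighted_integral I (?p z) (\<lambda>x. (\<Prod>i\<in>{}. x i) * discriminant I x powr \<gamma>)"
      unfolding E tilt weighted_integral_def by simp
    moreover have "(\<integral>\<omega>. exp ((z + 1) * of_real (ln (D \<omega>))) \<partial>P) =
        of_real c * weighted_integral I (?p z) (\<lambda>x. (\<Prod>i\<in>I. x i) * discriminant I x powr \<gamma>)"
      unfolding E tilt' weighted_integral_def by simp
    ultimately show ?thesis
      using arg_cong[OF aomoto_recursion[OF I pw[OF z] \<gamma>, symmetric], of "\<lambda>y. of_real c * y"]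
      by (simp add: add_ac mult_ac)
  qed
qed

lemma laguerre_weight_eq:
  "laguerre_weight \<beta> n x = discriminant {1..n} x powr (\<beta> / 2) * (\<Prod>k\<in>{1..n}. laguerre_weight1 (\<beta> / 2) (x k))"
proof (cases "\<forall>k\<in>{1..n}. 0 < x k")
  case False
  then have "(\<Prod>k\<in>{1..n}. laguerre_weight1 (\<beta> / 2) (x k)) = 0"
    by (auto simp: laguerre_weight1_def)
  then show ?thesis unfolding laguerre_weight_def by (simp only: if_not_P[OF False] mult_zero_right)
next
  case True
  then have "(\<Prod>k\<in>{1..n}. laguerre_weight1 (\<beta> / 2) (x k)) = (\<Prod>k\<in>{1..n}. x k powr (\<beta> / 2 - 1) * exp (- x k / 2))"
    by (intro prod.cong refl) (simp add: laguerre_weight1_def)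
  then show ?thesis unfolding laguerre_weight_def abs_vandermonde_powr by (simp only: if_P[OF True])
qed

lemma jacobi_weight_eq:
  "jacobi_weight \<beta> m M x = discriminant {1..m} x powr (\<beta> / 2) *
     (\<Prod>k\<in>{1..m}. jacobi_weight1 (\<beta> / 2) (\<beta> / 2 * (real M - real m + 1)) (x k))"
proof (cases "\<forall>k\<in>{1..m}. 0 < x k \<and> x k < 1")
  case False
  then have "(\<Prod>k\<in>{1..m}. jacobi_weight1 (\<beta> / 2) (\<beta> / 2 * (real M - real m + 1)) (x k)) = 0"
    by (auto simp: jacobi_weight1_def)
  then show ?thesis unfolding jacobi_weight_def by (simp only: if_not_P[OF False] mult_zero_right)
next
  case True
  then have "(\<Prod>k\<in>{1..m}. jacobi_weight1 (\<beta> / 2) (\<beta> / 2 * (real M - real m + 1)) (x k)) =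
      (\<Prod>k\<in>{1..m}. x k powr (\<beta> / 2 - 1) * (1 - x k) powr (\<beta> / 2 * (real M - real m + 1) - 1))"
    by (intro prod.cong refl) (simp add: jacobi_weight1_def)
  then show ?thesis unfolding jacobi_weight_def abs_vandermonde_powr by (simp only: if_P[OF True])
qed

lemma mellin_recursion_laguerre:
  assumes \<beta>: "\<beta> > 0" and D: "ensemble_det Laguerre \<beta> \<tau>1 \<tau>2 n P D"
  shows "mellin_recursion P (\<lambda>\<omega>. ln (D \<omega>)) (2 ^ n) n (\<lambda>s. \<beta> / 2 * (real s + 1)) 0 den"
proof -
  obtain \<Lambda> c where c: "c > 0" and dist: "distributed P (\<Pi>\<^sub>M k\<in>{1..n}. lborel) \<Lambda> (\<lambda>x. ennreal (c * laguerre_weight \<beta> n x))"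
    and prod: "\<And>\<omega>. \<omega> \<in> space P \<Longrightarrow> D \<omega> = (\<Prod>k\<in>{1..n}. \<Lambda> \<omega> k)"
    using D by (auto simp: has_density_proportional_to_def)
  have pw: "pearson_weight (of_real (\<beta> / 2) + z) (of_real (1 / 2) + of_real 0 * z) 0 (\<lambda>x. of_real (laguerre_weight1 (\<beta> / 2) x) * exp (z * of_real (ln x)))"
    if "Re z \<ge> 0" for z
    using pearson_laguerre[of "\<beta> / 2" z] \<beta> that by simp
  note rec = mellin_recursion_density[OF finite_atLeastAtMost _ c dist[unfolded laguerre_weight_eq] _ _ pw prod]
  have w: "laguerre_weight1 a x \<ge> 0" "x \<le> 0 \<Longrightarrow> laguerre_weight1 a x = 0" for a x
    by (auto simp: laguerre_weight1_def)
  show ?thesis unfolding mellin_recursion_def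
  proof (intro conjI allI impI)
    show "(\<lambda>\<omega>. ln (D \<omega>)) \<in> borel_measurable P" using rec(1) \<beta> w by simp
    fix z :: complex assume z: "Re z \<ge> 0"
    show "integrable P (\<lambda>\<omega>. exp (z * of_real (ln (D \<omega>))))" by (rule rec(2)) (use \<beta> w z in auto)
    have "(\<Prod>s<card {1..n}. of_real (1 / 2 + \<beta> / 2 * 0 * (real (card {1..n}) - 1 + real s)) + of_real 0 * z) *
        (\<integral>\<omega>. exp ((z + 1) * of_real (ln (D \<omega>))) \<partial>P) =
        (\<Prod>s<card {1..n}. of_real (\<beta> / 2 + \<beta> / 2 * real s) + z) * (\<integral>\<omega>. exp (z * of_real (ln (D \<omega>))) \<partial>P)"
      by (rule rec(3)) (use \<beta> w z in auto)
    moreover have "(\<Prod>s<card {1..n}. of_real (1 / 2 + \<beta> / 2 * 0 * (real (card {1..n}) - 1 + real s)) + of_real 0 * z) = (1 / 2) ^ n"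
      by simp
    moreover have "\<beta> / 2 + \<beta> / 2 * real s = \<beta> / 2 * (real s + 1)" for s
      by (simp add: field_simps)
    ultimately have "(1 / 2) ^ n * (\<integral>\<omega>. exp ((z + 1) * of_real (ln (D \<omega>))) \<partial>P) =
        (\<Prod>s<n. of_real (\<beta> / 2 * (real s + 1)) + z) * (\<integral>\<omega>. exp (z * of_real (ln (D \<omega>))) \<partial>P)"
      by (simp only: card_atLeastAtMost add_diff_cancel_right' Suc_eq_plus1)
    from arg_cong[OF this, of "\<lambda>y. 2 ^ n * y"]
    show "(\<Prod>s<0. of_real (den s) + z) * (\<integral>\<omega>. exp ((z + 1) * of_real (ln (D \<omega>))) \<partial>P) =
        of_real (2 ^ n) * (\<Prod>s<n. of_real (\<beta> / 2 * (real s + 1)) + z) * (\<integral>\<omega>. exp (z * of_real (ln (D \<omega>))) \<partial>P)"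
      by (simp add: mult.assoc[symmetric] power_mult_distrib[symmetric])
  qed
qed

text \<open>
  The number of eigenvalues of the Jacobi ensemble, and below it the other dimension.
\<close>

abbreviation small_dim :: "real \<Rightarrow> real \<Rightarrow> nat \<Rightarrow> nat" where
  "small_dim \<tau>1 \<tau>2 n \<equiv> min (nat \<lfloor>real n * \<tau>1\<rfloor>) (nat \<lfloor>real n * \<tau>2\<rfloor>)"

abbreviation large_dim :: "real \<Rightarrow> real \<Rightarrow> nat \<Rightarrow> nat" where
  "large_dim \<tau>1 \<tau>2 n \<equiv> max (nat \<lfloor>real n * \<tau>1\<rfloor>) (nat \<lfloor>real n * \<tau>2\<rfloor>)"

lemma mellin_recursion_jacobi:
  assumes \<beta>: "\<beta> > 0" and D: "ensemble_det Jacobi \<beta> \<tau>1 \<tau>2 n P D"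
  defines "m \<equiv> small_dim \<tau>1 \<tau>2 n" and "M \<equiv> large_dim \<tau>1 \<tau>2 n"
  shows "mellin_recursion P (\<lambda>\<omega>. ln (D \<omega>)) 1 m (\<lambda>s. \<beta> / 2 * (real s + 1)) m (\<lambda>s. \<beta> / 2 * (real M + real s + 1))"
proof -
  obtain \<Lambda> c where c: "c > 0" and dist: "distributed P (\<Pi>\<^sub>M k\<in>{1..m}. lborel) \<Lambda> (\<lambda>x. ennreal (c * jacobi_weight \<beta> m M x))"
    and prod: "\<And>\<omega>. \<omega> \<in> space P \<Longrightarrow> D \<omega> = (\<Prod>k\<in>{1..m}. \<Lambda> \<omega> k)"
    using D by (auto simp: has_density_proportional_to_def m_def[symmetric] M_def[symmetric] Let_def)
  let ?b = "\<beta> / 2 * (real M - real m + 1)"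
  have mM: "m \<le> M" unfolding m_def M_def by auto
  have b: "?b > 0" using \<beta> mM by (intro mult_pos_pos) auto
  have pw: "pearson_weight (of_real (\<beta> / 2) + z) (of_real (\<beta> / 2 + ?b) + of_real 1 * z) 1 (\<lambda>x. of_real (jacobi_weight1 (\<beta> / 2) ?b x) * exp (z * of_real (ln x)))"
    if "Re z \<ge> 0" for z
    using pearson_jacobi[of "\<beta> / 2" ?b z] \<beta> b that by simp
  note rec = mellin_recursion_density[OF finite_atLeastAtMost _ c dist[unfolded jacobi_weight_eq] _ _ pw prod]
  have w: "jacobi_weight1 a b x \<ge> 0" "x \<le> 0 \<Longrightarrow> jacobi_weight1 a b x = 0" for a b x
    by (auto simp: jacobi_weight1_def)
  show ?thesis unfolding mellin_recursion_def
  proof (intro conjI allI impI)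
    show "(\<lambda>\<omega>. ln (D \<omega>)) \<in> borel_measurable P" using rec(1) \<beta> w by simp
    fix z :: complex assume z: "Re z \<ge> 0"
    show "integrable P (\<lambda>\<omega>. exp (z * of_real (ln (D \<omega>))))" by (rule rec(2)) (use \<beta> w z in auto)
    have "(\<Prod>s<card {1..m}. of_real (\<beta> / 2 + ?b + \<beta> / 2 * 1 * (real (card {1..m}) - 1 + real s)) + of_real 1 * z) *
        (\<integral>\<omega>. exp ((z + 1) * of_real (ln (D \<omega>))) \<partial>P) =
        (\<Prod>s<card {1..m}. of_real (\<beta> / 2 + \<beta> / 2 * real s) + z) * (\<integral>\<omega>. exp (z * of_real (ln (D \<omega>))) \<partial>P)"
      by (rule rec(3)) (use \<beta> w z in auto)
    moreover have "\<beta> / 2 + ?b + \<beta> / 2 * 1 * (real (card {1..m}) - 1 + real s) = \<beta> / 2 * (real M + real s + 1)" for s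
      by (simp add: field_simps)
    moreover have "\<beta> / 2 + \<beta> / 2 * real s = \<beta> / 2 * (real s + 1)" for s
      by (simp add: field_simps)
    ultimately show "(\<Prod>s<m. of_real (\<beta> / 2 * (real M + real s + 1)) + z) * (\<integral>\<omega>. exp ((z + 1) * of_real (ln (D \<omega>))) \<partial>P) =
        of_real 1 * (\<Prod>s<m. of_real (\<beta> / 2 * (real s + 1)) + z) * (\<integral>\<omega>. exp (z * of_real (ln (D \<omega>))) \<partial>P)"
      by (simp only: card_atLeastAtMost diff_Suc_1 of_real_1 mult_1_left add_diff_cancel_right' Suc_eq_plus1)
  qed
qed

lemma beta_density_eq: "beta_density p q x = jacobi_weight1 p q x / Beta p q"
  by (simp add: beta_density_def jacobi_weight1_def)

lemma poly_growth_const: "poly_growth (\<lambda>_. c)"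
  unfolding poly_growth_def by (rule exI[of _ "\<bar>c\<bar>"], rule exI[of _ 0]) simp

text \<open>
  The case of one variable: the weak Pearson equation is tested against the constant \<open>1\<close>.
\<close>

lemma beta_moment_recursion:
  assumes p: "p > 0" and q: "q > 0"
    and dist: "distributed Q lborel \<rho> (\<lambda>x. ennreal (beta_density p q x))"
  shows "AE \<omega> in Q. \<rho> \<omega> > 0"
    and "Re z \<ge> 0 \<Longrightarrow> integrable Q (\<lambda>\<omega>. exp (z * of_real (ln (\<rho> \<omega>))))"
    and "Re z \<ge> 0 \<Longrightarrow> (of_real (p + q) + z) * (\<integral>\<omega>. exp ((z + 1) * of_real (ln (\<rho> \<omega>))) \<partial>Q) =
           (of_real p + z) * (\<integral>\<omega>. exp (z * of_real (ln (\<rho> \<omega>))) \<partial>Q)"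
proof -
  note distr = distributed_distr_eq_density[OF dist]
  have \<rho> [measurable]: "\<rho> \<in> measurable Q lborel" by (rule distributed_measurable[OF dist])
  have B: "Beta p q > 0" using p q by (simp add: Beta_def)
  have nonneg: "beta_density p q x \<ge> 0" for x
    using B by (simp add: beta_density_eq jacobi_weight1_def)
  have dm [measurable]: "beta_density p q \<in> borel_measurable borel"
    unfolding beta_density_eq[abs_def] by measurable
  have "AE x in distr Q lborel \<rho>. x > 0"
    unfolding distr by (subst AE_density) (auto simp: beta_density_def)
  then show "AE \<omega> in Q. \<rho> \<omega> > 0" by (subst (asm) AE_distr_iff[OF \<rho>]) auto
  let ?p = "\<lambda>z x. of_real (jacobi_weight1 p q x) * exp (z * of_real (ln x)) :: complex"
  have eq: "beta_density p q x *\<^sub>R exp (z * of_real (ln x)) = of_real (1 / Beta p q) * ?p z x" for z x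
    by (simp add: beta_density_eq scaleR_conv_of_real)
  have E: "(\<integral>\<omega>. exp (z * of_real (ln (\<rho> \<omega>))) \<partial>Q) = of_real (1 / Beta p q) * (\<integral>x. ?p z x \<partial>lborel)" for z :: complex
  proof -
    have "(\<integral>\<omega>. exp (z * of_real (ln (\<rho> \<omega>))) \<partial>Q) = (\<integral>x. exp (z * of_real (ln x)) \<partial>distr Q lborel \<rho>)"
      by (subst integral_distr[OF \<rho>]) measurable
    also have "\<dots> = (\<integral>x. beta_density p q x *\<^sub>R exp (z * of_real (ln x)) \<partial>lborel)"
      unfolding distr using nonneg by (intro integral_density) auto
    finally show ?thesis unfolding eq by simp
  qed
  show "integrable Q (\<lambda>\<omega>. exp (z * of_real (ln (\<rho> \<omega>))))" if z: "Re z \<ge> 0"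
  proof -
    have "integrable lborel (\<lambda>x. of_real ((1 + \<bar>x\<bar>) ^ 0) * ?p z x)"
      using pearson_jacobi[OF p q z] unfolding pearson_weight_def by blast
    then have "integrable lborel (\<lambda>x. beta_density p q x *\<^sub>R exp (z * of_real (ln x)))"
      unfolding eq by simp
    then have "integrable (distr Q lborel \<rho>) (\<lambda>x. exp (z * of_real (ln x)))"
      unfolding distr using nonneg by (subst integrable_density) auto
    then show ?thesis by (subst (asm) integrable_distr_eq[OF \<rho>]) measurable
  qed
  show "(of_real (p + q) + z) * (\<integral>\<omega>. exp ((z + 1) * of_real (ln (\<rho> \<omega>))) \<partial>Q) =
           (of_real p + z) * (\<integral>\<omega>. exp (z * of_real (ln (\<rho> \<omega>))) \<partial>Q)" if z: "Re z \<ge> 0"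
  proof -
    let ?A = "of_real p + z :: complex" and ?B = "of_real (p + q) + z :: complex"
    have int: "integrable lborel (?p z)" "integrable lborel (?p (z + 1))"
      using pearson_jacobi[OF p q z] pearson_jacobi[OF p q, of "z + 1"] z unfolding pearson_weight_def
      by (auto dest!: spec[of _ 0])
    have px: "?p (z + 1) x = of_real x * ?p z x" for x
      by (cases "x > 0") (simp_all add: jacobi_weight1_def distrib_right exp_add exp_of_real)
    have "(\<integral>x. ((?A - ?B * of_real x) * of_real 1 + of_real (x * (1 - 1 * x) * 0)) * ?p z x \<partial>lborel) = 0"
      by (rule pearson_weight_identity[OF pearson_jacobi[OF p q z], where h = "\<lambda>_. 1" and h' = "\<lambda>_. 0"])
        (auto simp: poly_growth_const)
    also have "(\<lambda>x. ((?A - ?B * of_real x) * of_real 1 + of_real (x * (1 - 1 * x) * 0)) * ?p z x) =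
        (\<lambda>x. ?A * ?p z x - ?B * ?p (z + 1) x)"
      unfolding px by (intro ext) (simp only: of_real_1 mult_1_right mult_zero_right of_real_0 add_0_right left_diff_distrib mult.assoc)
    also have "(\<integral>x. ?A * ?p z x - ?B * ?p (z + 1) x \<partial>lborel) = ?A * (\<integral>x. ?p z x \<partial>lborel) - ?B * (\<integral>x. ?p (z + 1) x \<partial>lborel)"
      by (subst Bochner_Integration.integral_diff) (use int in \<open>auto intro!: integrable_mult_right\<close>)
    finally show ?thesis unfolding E by (simp add: mult.left_commute)
  qed
qed

text \<open>
  By independence the Mellin transform is the product of those of the Beta factors, and it depends
  only on the law of \<open>D\<close>. The parameters of \<open>\<rho> k\<close> add up to \<open>\<beta> / 2 * n\<close> for every \<open>k\<close>; the index
  \<open>s = n - k\<close> brings the first parameter into the form \<open>\<beta> / 2 * (s + 1)\<close>.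
\<close>

lemma mellin_recursion_gram:
  assumes \<beta>: "\<beta> > 0" and P: "prob_space P" and D: "ensemble_det Gram \<beta> \<tau>1 \<tau>2 n P D"
  shows "mellin_recursion P (\<lambda>\<omega>. ln (D \<omega>)) 1 (n - 1) (\<lambda>s. \<beta> / 2 * (real s + 1)) (n - 1) (\<lambda>s. \<beta> / 2 * real n)"
proof -
  obtain Q :: "(nat \<Rightarrow> real) measure" and \<rho> where Dm [measurable]: "D \<in> borel_measurable P" and Q: "prob_space Q"
    and ind: "prob_space.indep_vars Q (\<lambda>_. borel) \<rho> {2..n}"
    and dist: "\<And>k. k \<in> {2..n} \<Longrightarrow> distributed Q lborel (\<rho> k)
               (\<lambda>x. ennreal (beta_density (\<beta> / 2 * (real n - real k + 1)) (\<beta> / 2 * (real k - 1)) x))"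
    and law: "distr P borel D = distr Q borel (\<lambda>\<omega>. \<Prod>k\<in>{2..n}. \<rho> k \<omega>)"
    using D by auto
  interpret Q: prob_space Q by (rule Q)
  let ?R = "\<lambda>\<omega>. \<Prod>k\<in>{2..n}. \<rho> k \<omega>"
  have pq: "\<beta> / 2 * (real n - real k + 1) > 0" "\<beta> / 2 * (real k - 1) > 0"
    "\<beta> / 2 * (real n - real k + 1) + \<beta> / 2 * (real k - 1) = \<beta> / 2 * real n" if "k \<in> {2..n}" for k
  proof -
    show "\<beta> / 2 * (real n - real k + 1) > 0" "\<beta> / 2 * (real k - 1) > 0" using \<beta> that by auto
    show "\<beta> / 2 * (real n - real k + 1) + \<beta> / 2 * (real k - 1) = \<beta> / 2 * real n"
      unfolding distrib_left[symmetric] by simp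
  qed
  note rec = beta_moment_recursion[OF pq(1,2) dist]
  have \<rho>m: "\<rho> k \<in> borel_measurable Q" if "k \<in> {2..n}" for k
    using ind that by (auto simp: Q.indep_vars_def)
  have Rm [measurable]: "?R \<in> borel_measurable Q" by (intro borel_measurable_prod \<rho>m)
  have "AE \<omega> in Q. \<forall>k\<in>{2..n}. \<rho> k \<omega> > 0"
    by (intro AE_finite_allI finite_atLeastAtMost rec(1))
  then have split: "AE \<omega> in Q. exp (z * of_real (ln (?R \<omega>))) = (\<Prod>k\<in>{2..n}. exp (z * of_real (ln (\<rho> k \<omega>))))" for z :: complex
  proof eventually_elim
    case (elim \<omega>)
    then have "ln (?R \<omega>) = (\<Sum>k\<in>{2..n}. ln (\<rho> k \<omega>))" by (intro ln_prod) force+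
    then show ?case by (simp add: sum_distrib_left exp_sum)
  qed
  have ind_exp: "Q.indep_vars (\<lambda>_. borel) (\<lambda>k \<omega>. exp (z * of_real (ln (\<rho> k \<omega>)))) {2..n}" for z :: complex
    by (rule Q.indep_vars_compose2[OF ind, where Y = "\<lambda>_ x. exp (z * of_real (ln x))"]) measurable
  have int: "integrable Q (\<lambda>\<omega>. exp (z * of_real (ln (?R \<omega>))))" if z: "Re z \<ge> 0" for z
  proof -
    have "integrable Q (\<lambda>\<omega>. \<Prod>k\<in>{2..n}. exp (z * of_real (ln (\<rho> k \<omega>))))"
      by (rule Q.indep_vars_integrable[OF _ ind_exp]) (auto intro!: rec(2) z)
    then show ?thesis
    proof (rule Bochner_Integration.integrable_cong_AE_imp)
      show "AE \<omega> in Q. (\<Prod>k\<in>{2..n}. exp (z * of_real (ln (\<rho> k \<omega>)))) = exp (z * of_real (ln (?R \<omega>)))"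
        using split[of z] by (simp add: eq_commute)
    qed measurable
  qed
  have E: "(\<integral>\<omega>. exp (z * of_real (ln (?R \<omega>))) \<partial>Q) = (\<Prod>k\<in>{2..n}. \<integral>\<omega>. exp (z * of_real (ln (\<rho> k \<omega>))) \<partial>Q)" if z: "Re z \<ge> 0" for z
  proof -
    have "(\<integral>\<omega>. exp (z * of_real (ln (?R \<omega>))) \<partial>Q) = (\<integral>\<omega>. (\<Prod>k\<in>{2..n}. exp (z * of_real (ln (\<rho> k \<omega>)))) \<partial>Q)"
    proof (rule integral_cong_AE)
      show "(\<lambda>\<omega>. \<Prod>k\<in>{2..n}. exp (z * of_real (ln (\<rho> k \<omega>)))) \<in> borel_measurable Q"
      proof (rule borel_measurable_prod)
        fix k assume "k \<in> {2..n}"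
        note [measurable] = \<rho>m[OF this]
        show "(\<lambda>\<omega>. exp (z * of_real (ln (\<rho> k \<omega>)))) \<in> borel_measurable Q" by measurable
      qed
    qed (measurable, rule split)
    also have "\<dots> = (\<Prod>k\<in>{2..n}. \<integral>\<omega>. exp (z * of_real (ln (\<rho> k \<omega>))) \<partial>Q)"
      by (rule Q.indep_vars_lebesgue_integral[OF _ ind_exp]) (auto intro!: rec(2) z)
    finally show ?thesis .
  qed
  have transfer: "(\<integral>\<omega>. exp (z * of_real (ln (D \<omega>))) \<partial>P) = (\<integral>\<omega>. exp (z * of_real (ln (?R \<omega>))) \<partial>Q)" for z :: complex
  proof -
    have "(\<integral>\<omega>. exp (z * of_real (ln (D \<omega>))) \<partial>P) = (\<integral>x. exp (z * of_real (ln x)) \<partial>distr P borel D)"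
      by (subst integral_distr) measurable
    also have "\<dots> = (\<integral>\<omega>. exp (z * of_real (ln (?R \<omega>))) \<partial>Q)"
      unfolding law by (subst integral_distr) measurable
    finally show ?thesis .
  qed
  show ?thesis unfolding mellin_recursion_def
  proof (intro conjI allI impI)
    show "(\<lambda>\<omega>. ln (D \<omega>)) \<in> borel_measurable P" by measurable
    fix z :: complex assume z: "Re z \<ge> 0"
    have "integrable (distr Q borel ?R) (\<lambda>x. exp (z * of_real (ln x)))"
      using int[OF z] by (subst integrable_distr_eq) measurable
    then show "integrable P (\<lambda>\<omega>. exp (z * of_real (ln (D \<omega>))))"
      unfolding law[symmetric] by (subst (asm) integrable_distr_eq) measurable
    have bij: "bij_betw (\<lambda>k. n - k) {2..n} {..<n - 1}"
      by (rule bij_betw_byWitness[of _ "\<lambda>s. n - s"]) auto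
    have re: "(\<Prod>s<n - 1. f s) = (\<Prod>k\<in>{2..n}. f (n - k))" for f :: "nat \<Rightarrow> complex"
      by (rule prod.reindex_bij_betw[OF bij, symmetric])
    have "(\<Prod>s<n - 1. of_real (\<beta> / 2 * real n) + z) * (\<integral>\<omega>. exp ((z + 1) * of_real (ln (D \<omega>))) \<partial>P) =
       (\<Prod>k\<in>{2..n}. (of_real (\<beta> / 2 * real n) + z) * (\<integral>\<omega>. exp ((z + 1) * of_real (ln (\<rho> k \<omega>))) \<partial>Q))"
      using z by (simp only: re transfer prod.distrib) (subst E, auto)
    also have "\<dots> = (\<Prod>k\<in>{2..n}. (of_real (\<beta> / 2 * (real (n - k) + 1)) + z) * (\<integral>\<omega>. exp (z * of_real (ln (\<rho> k \<omega>))) \<partial>Q))"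
    proof (rule prod.cong[OF refl])
      fix k assume k: "k \<in> {2..n}"
      then have "real (n - k) = real n - real k" by (auto simp: of_nat_diff)
      then show "(of_real (\<beta> / 2 * real n) + z) * (\<integral>\<omega>. exp ((z + 1) * of_real (ln (\<rho> k \<omega>))) \<partial>Q) =
          (of_real (\<beta> / 2 * (real (n - k) + 1)) + z) * (\<integral>\<omega>. exp (z * of_real (ln (\<rho> k \<omega>))) \<partial>Q)"
        using rec(3)[OF k k k z] unfolding pq(3)[OF k] by (simp only:)
    qed
    also have "\<dots> = of_real 1 * (\<Prod>s<n - 1. of_real (\<beta> / 2 * (real s + 1)) + z) * (\<integral>\<omega>. exp (z * of_real (ln (D \<omega>))) \<partial>P)"
      by (simp only: re transfer prod.distrib E[OF z] of_real_1 mult_1_left)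
    finally show "(\<Prod>s<n - 1. of_real (\<beta> / 2 * real n) + z) * (\<integral>\<omega>. exp ((z + 1) * of_real (ln (D \<omega>))) \<partial>P) =
        of_real 1 * (\<Prod>s<n - 1. of_real (\<beta> / 2 * (real s + 1)) + z) * (\<integral>\<omega>. exp (z * of_real (ln (D \<omega>))) \<partial>P)" .
  qed
qed

section \<open>Solving the Mellin recursion on the imaginary axis\<close>
definition gamma_ratio :: "real \<Rightarrow> real \<Rightarrow> complex" where
  "gamma_ratio \<alpha> t = Gamma (of_real \<alpha> + \<i> * of_real t) / Gamma (of_real \<alpha>)"

text \<open>
  The \<open>N\<close>-th approximation to \<open>gamma_ratio\<close> in Gauss's product formula, with the power
  \<open>(\<alpha> + N) powr (i t)\<close> in place of \<open>N powr (i t)\<close>: this is the form in which it arises from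
  iterating a Mellin recursion.
\<close>

definition gamma_ratio_product :: "real \<Rightarrow> real \<Rightarrow> nat \<Rightarrow> complex" where
  "gamma_ratio_product \<alpha> t N = iexp (t * ln (\<alpha> + real N)) *
     (\<Prod>l<N. of_real (\<alpha> + real l) / (of_real (\<alpha> + real l) + \<i> * of_real t))"

lemma of_real_plus_imaginary_nonzero [simp]: "\<alpha> > 0 \<Longrightarrow> of_real \<alpha> + \<i> * of_real t \<noteq> 0"
  by (auto simp: complex_eq_iff)

lemma not_nonpos_Ints_Re: "Re z > 0 \<Longrightarrow> z \<notin> \<int>\<^sub>\<le>\<^sub>0"
  by (auto elim!: nonpos_Ints_cases')

lemma gamma_ratio_product_LIMSEQ:
  assumes \<alpha>: "\<alpha> > 0"
  shows "gamma_ratio_product \<alpha> t \<longlonglongrightarrow> gamma_ratio \<alpha> t"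
proof -
  let ?z = "of_real \<alpha> + \<i> * of_real t :: complex"
  let ?f = "\<lambda>l. of_real (\<alpha> + real l) / (of_real (\<alpha> + real l) + \<i> * of_real t) :: complex"
  have nz: "Gamma (of_real \<alpha> :: complex) \<noteq> 0"
    using \<alpha> by (intro Gamma_nonzero not_nonpos_Ints_Re) simp
  have "(\<lambda>N. Gamma_series ?z N / Gamma_series (of_real \<alpha>) N) \<longlonglongrightarrow> gamma_ratio \<alpha> t"
    unfolding gamma_ratio_def by (intro tendsto_divide Gamma_series_LIMSEQ nz)
  moreover have "\<forall>\<^sub>F N in sequentially. Gamma_series ?z N / Gamma_series (of_real \<alpha>) N =
      iexp (t * ln (real N)) * (\<Prod>l<Suc N. ?f l)"
  proof (rule always_eventually, rule allI)
    fix N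
    have "Gamma_series ?z N / Gamma_series (of_real \<alpha>) N =
        (exp (?z * of_real (ln (real N))) / exp (of_real \<alpha> * of_real (ln (real N)))) *
        (pochhammer (of_real \<alpha>) (Suc N) / pochhammer ?z (Suc N))"
      unfolding Gamma_series_def by (simp add: divide_simps)
    also have "exp (?z * of_real (ln (real N))) / exp (of_real \<alpha> * of_real (ln (real N))) = iexp (t * ln (real N))"
      by (simp add: exp_diff[symmetric] algebra_simps)
    also have "pochhammer (of_real \<alpha>) (Suc N) / pochhammer ?z (Suc N) = (\<Prod>l<Suc N. ?f l)"
      unfolding pochhammer_prod prod_dividef[symmetric] atLeast0LessThan by (simp add: add_ac)
    finally show "Gamma_series ?z N / Gamma_series (of_real \<alpha>) N = iexp (t * ln (real N)) * (\<Prod>l<Suc N. ?f l)" .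
  qed
  ultimately have lim: "(\<lambda>N. iexp (t * ln (real N)) * (\<Prod>l<Suc N. ?f l)) \<longlonglongrightarrow> gamma_ratio \<alpha> t"
    by (rule Lim_transform_eventually)
  have "(\<lambda>N. ln (\<alpha> + real N) - ln (real N)) \<longlonglongrightarrow> 0"
    using \<alpha> by real_asymp
  then have c1: "(\<lambda>N. iexp (t * (ln (\<alpha> + real N) - ln (real N)))) \<longlonglongrightarrow> iexp (t * 0)"
    by (intro tendsto_exp tendsto_mult[OF tendsto_const] tendsto_of_real)
  have c2: "(\<lambda>N. 1 + \<i> * of_real (t * (1 / (\<alpha> + real N)))) \<longlonglongrightarrow> 1 + \<i> * of_real (t * 0)"
    using \<alpha> by (intro tendsto_intros) real_asymp
  from tendsto_mult[OF tendsto_mult[OF lim c1] c2]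
  have "(\<lambda>N. iexp (t * ln (real N)) * (\<Prod>l<Suc N. ?f l) * iexp (t * (ln (\<alpha> + real N) - ln (real N))) *
      (1 + \<i> * of_real (t * (1 / (\<alpha> + real N))))) \<longlonglongrightarrow> gamma_ratio \<alpha> t" by simp
  moreover have "iexp (t * ln (real N)) * (\<Prod>l<Suc N. ?f l) * iexp (t * (ln (\<alpha> + real N) - ln (real N))) *
      (1 + \<i> * of_real (t * (1 / (\<alpha> + real N)))) = gamma_ratio_product \<alpha> t N" for N
  proof -
    have pos: "\<alpha> + real N > 0" using \<alpha> by simp
    have "1 + \<i> * of_real (t * (1 / (\<alpha> + real N))) = inverse (?f N)"
      using pos of_real_plus_imaginary_nonzero[OF pos, of t] by (simp add: field_simps del: of_real_add)
    moreover have "?f N \<noteq> 0" using pos of_real_plus_imaginary_nonzero[OF pos, of t] by (simp del: of_real_add)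
    moreover have "iexp (t * ln (real N)) * iexp (t * (ln (\<alpha> + real N) - ln (real N))) = iexp (t * ln (\<alpha> + real N))"
      by (simp add: exp_add[symmetric] algebra_simps)
    ultimately show ?thesis unfolding gamma_ratio_product_def
      by (simp add: mult_ac del: of_real_add)
  qed
  ultimately show ?thesis by simp
qed

lemma gamma_ratio_nonzero [simp]:
  assumes "\<alpha> > 0" shows "gamma_ratio \<alpha> t \<noteq> 0"
  unfolding gamma_ratio_def using assms by (simp add: Gamma_eq_zero_iff not_nonpos_Ints_Re)

text \<open>
  From \<open>\<delta> \<bar>y\<bar> \<le> \<delta>\<^sup>2 + y\<^sup>2 / 2\<close> and \<open>y\<^sup>2 / 2 \<le> exp y + exp (- y) - 2\<close>. The point of the estimate is that its
  right-hand side involves only the exponential moments that a Mellin recursion provides.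
\<close>

lemma abs_le_exp_plus_exp:
  fixes y \<delta> :: real assumes "\<delta> > 0"
  shows "\<bar>y\<bar> \<le> \<delta> + (exp y + exp (- y) - 2) / \<delta>"
proof -
  have "y\<^sup>2 / 2 \<le> exp y + exp (- y) - 2"
  proof (cases "y \<ge> 0")
    case True
    then show ?thesis using exp_lower_Taylor_quadratic[of y] exp_ge_add_one_self[of "- y"] by linarith
  next
    case False
    then show ?thesis using exp_lower_Taylor_quadratic[of "- y"] exp_ge_add_one_self[of y]
      unfolding power2_minus by linarith
  qed
  moreover have "\<delta> * \<bar>y\<bar> \<le> \<delta>\<^sup>2 + y\<^sup>2 / 2"
    using sum_squares_ge_zero[of "\<bar>y\<bar> - \<delta>" \<delta>] by (simp add: power2_eq_square algebra_simps)
  ultimately have "\<delta> * \<bar>y\<bar> \<le> \<delta>\<^sup>2 + (exp y + exp (- y) - 2)" by linarith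
  then show ?thesis using assms by (simp add: field_simps power2_eq_square)
qed

text \<open>
  Iterating the recursion from \<open>i t\<close> to \<open>N + i t\<close> and from \<open>0\<close> to \<open>N\<close> reduces the claim to
  \<open>F (N + i t) / F N \<sim> r N powr (i t)\<close>, where \<open>r N = F (N + 1) / F N\<close>. The left-hand side is the
  expectation of \<open>exp (i t Y)\<close> under the law with density \<open>exp (N Y) / F N\<close>. Under this law
  \<open>exp Y / r N\<close> has mean \<open>1\<close> and \<open>r N / exp Y\<close> has mean \<open>r N / r (N - 1)\<close>, which tends to \<open>1\<close>. A
  positive variable such that it and its inverse have means near \<open>1\<close> is concentrated near \<open>1\<close>,
  which is made quantitative by \<open>abs_le_exp_plus_exp\<close>.
\<close>

theorem mellin_recursion_char:
  assumes M: "prob_space M" and rec: "mellin_recursion M Y C K num L den"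
    and C: "C > 0" and num: "\<And>s. s < K \<Longrightarrow> num s > 0" and den: "\<And>s. s < L \<Longrightarrow> den s > 0"
  shows "(\<integral>\<omega>. iexp (t * Y \<omega>) \<partial>M) =
      iexp (t * ln C) * (\<Prod>s<K. gamma_ratio (num s) t) / (\<Prod>s<L. gamma_ratio (den s) t)"
proof -
  interpret prob_space M by (rule M)
  have Y [measurable]: "Y \<in> borel_measurable M" using rec by (simp add: mellin_recursion_def)
  define F :: "complex \<Rightarrow> complex" where "F = (\<lambda>z. \<integral>\<omega>. exp (z * of_real (Y \<omega>)) \<partial>M)"
  define R where "R = (\<lambda>z. of_real C * (\<Prod>s<K. of_real (num s) + z) / (\<Prod>s<L. of_real (den s) + z) :: complex)"
  define r where "r = (\<lambda>N. C * (\<Prod>s<K. num s + real N) / (\<Prod>s<L. den s + real N))"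
  define f where "f = (\<lambda>N. \<integral>\<omega>. exp (real N * Y \<omega>) \<partial>M)"
  have nz: "(\<Prod>s<L. of_real (den s) + z) \<noteq> 0" "(\<Prod>s<K. of_real (num s) + z) \<noteq> 0" if "Re z \<ge> 0" for z :: complex
  proof -
    have "of_real x + z \<noteq> 0" if "x > 0" for x
      using that \<open>Re z \<ge> 0\<close> by (auto simp: complex_eq_iff)
    then show "(\<Prod>s<L. of_real (den s) + z) \<noteq> 0" "(\<Prod>s<K. of_real (num s) + z) \<noteq> 0" using num den by auto
  qed
  have F_rec: "F (z + 1) = R z * F z" and int: "integrable M (\<lambda>\<omega>. exp (z * of_real (Y \<omega>)))" if "Re z \<ge> 0" for z
    using rec that nz[OF that] by (auto simp: mellin_recursion_def F_def R_def field_simps)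
  have R_nz: "R z \<noteq> 0" if "Re z \<ge> 0" for z using nz[OF that] C by (simp add: R_def)
  have r_pos: "r N > 0" for N
    unfolding r_def using C num den by (intro divide_pos_pos mult_pos_pos prod_pos) (auto intro!: add_pos_nonneg)
  have R_r: "R (of_nat N) = of_real (r N)" for N by (simp add: R_def r_def)
  have intf: "integrable M (\<lambda>\<omega>. exp (real N * Y \<omega>))" for N
  proof -
    have "integrable M (\<lambda>\<omega>. Re (exp (of_nat N * of_real (Y \<omega>))))"
      using int[of "of_nat N"] by (intro integrable_Re) simp
    then show ?thesis by (simp add: Re_exp)
  qed
  have Ff: "F (of_nat N) = of_real (f N)" for N
    unfolding F_def f_def by (simp flip: integral_complex_of_real exp_of_real)
  have f_pos: "f N > 0" for N
    unfolding f_def using intf by (intro integral_less_AE_space[of "\<lambda>_. 0", simplified]) (auto simp: emeasure_space_1)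
  have f_Suc: "f (Suc N) = r N * f N" for N
    using F_rec[of "of_nat N"] unfolding R_r Ff by (simp flip: of_real_mult of_nat_Suc add: Ff add.commute)
  let ?z = "\<lambda>N. of_nat N + \<i> * of_real t :: complex"
  define A where "A = (\<lambda>N. (\<Prod>l<N. of_real (r l) / R (?z l)))"
  have FA: "F (?z N) * A N = of_real (f N) * F (\<i> * of_real t)" for N
  proof (induction N)
    case 0
    then show ?case by (simp add: A_def F_def f_def prob_space)
  next
    case (Suc N)
    have "F (?z (Suc N)) = R (?z N) * F (?z N)" using F_rec[of "?z N"] by (simp add: add_ac)
    then show ?case using Suc R_nz[of "?z N"] by (simp add: A_def f_Suc)
  qed
  \<comment> \<open>\<open>?h\<close> is the bound of \<open>abs_le_exp_plus_exp\<close> at \<open>y = Y \<omega> - c\<close>, multiplied by \<open>exp (N Y)\<close>\<close>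
  have close: "norm (F (?z N) / of_real (f N) - iexp (t * ln (r N))) \<le> \<bar>t\<bar> * (\<delta> + (r N / r (N - 1) - 1) / \<delta>)"
    if N: "N \<ge> 1" and \<delta>: "\<delta> > 0" for N \<delta>
  proof -
    define c where "c = ln (r N)"
    have ec: "exp c = r N" "exp (- c) = 1 / r N" using r_pos[of N] by (simp_all add: c_def exp_minus field_simps)
    let ?g = "\<lambda>\<omega>. exp (of_nat N * of_real (Y \<omega>)) * (iexp (t * Y \<omega>) - iexp (t * c))"
    let ?h = "\<lambda>\<omega>. (\<delta> - 2 / \<delta>) * exp (real N * Y \<omega>) + (1 / \<delta>) * (exp (- c) * exp (real (Suc N) * Y \<omega>) + exp c * exp (real (N - 1) * Y \<omega>))"
    have inth: "integrable M ?h" using intf by (intro Bochner_Integration.integrable_add integrable_mult_right)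
    have g1: "exp (?z N * of_real y) = exp (of_nat N * of_real y) * iexp (t * y)" for y
      unfolding exp_add[symmetric] by (simp add: algebra_simps)
    have intg: "integrable M ?g"
    proof -
      have "integrable M (\<lambda>\<omega>. exp (?z N * of_real (Y \<omega>)) - iexp (t * c) * exp (of_nat N * of_real (Y \<omega>)))"
        by (intro Bochner_Integration.integrable_diff integrable_mult_right int) auto
      then show ?thesis unfolding g1 by (simp add: algebra_simps)
    qed
    have "F (?z N) - iexp (t * c) * of_real (f N) = (\<integral>\<omega>. ?g \<omega> \<partial>M)"
    proof -
      have "F (?z N) - iexp (t * c) * F (of_nat N) =
          (\<integral>\<omega>. exp (?z N * of_real (Y \<omega>)) - iexp (t * c) * exp (of_nat N * of_real (Y \<omega>)) \<partial>M)"
        unfolding F_def by (subst Bochner_Integration.integral_diff) (auto intro!: int integrable_mult_right)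
      then show ?thesis unfolding g1 Ff by (simp add: algebra_simps)
    qed
    also have "norm \<dots> \<le> (\<integral>\<omega>. norm (?g \<omega>) \<partial>M)" by (rule integral_norm_bound)
    also have "\<dots> \<le> (\<integral>\<omega>. \<bar>t\<bar> * ?h \<omega> \<partial>M)"
    proof (rule integral_mono[OF integrable_norm[OF intg] integrable_mult_right[OF inth]])
      fix \<omega>
      have "norm (iexp (t * Y \<omega>) - iexp (t * c)) = norm (iexp (t * (Y \<omega> - c)) - 1)"
      proof -
        have "iexp (t * Y \<omega>) - iexp (t * c) = iexp (t * c) * (iexp (t * (Y \<omega> - c)) - 1)"
          by (simp add: algebra_simps flip: exp_add)
        then show ?thesis by (simp add: norm_mult)
      qed
      also have "\<dots> \<le> \<bar>t * (Y \<omega> - c)\<bar>" using iexp_approx1[of "t * (Y \<omega> - c)" 0] by simp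
      also have "\<dots> \<le> \<bar>t\<bar> * (\<delta> + (exp (Y \<omega> - c) + exp (- (Y \<omega> - c)) - 2) / \<delta>)"
        unfolding abs_mult by (intro mult_left_mono abs_le_exp_plus_exp \<delta>) auto
      finally have "norm (?g \<omega>) \<le> exp (real N * Y \<omega>) * (\<bar>t\<bar> * (\<delta> + (exp (Y \<omega> - c) + exp (- (Y \<omega> - c)) - 2) / \<delta>))"
        by (simp add: norm_mult)
      also have "\<dots> = \<bar>t\<bar> * ?h \<omega>"
      proof -
        have "exp (real N * Y \<omega>) * exp (Y \<omega> - c) = exp (- c) * exp (real (Suc N) * Y \<omega>)"
          by (simp add: algebra_simps flip: exp_add)
        moreover have "exp (real N * Y \<omega>) * exp (- (Y \<omega> - c)) = exp c * exp (real (N - 1) * Y \<omega>)"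
          using N by (simp add: algebra_simps of_nat_diff flip: exp_add)
        ultimately show ?thesis by (simp add: distrib_left distrib_right right_diff_distrib left_diff_distrib add_divide_distrib diff_divide_distrib mult.left_commute)
      qed
      finally show "norm (?g \<omega>) \<le> \<bar>t\<bar> * ?h \<omega>" .
    qed
    also have "\<dots> = \<bar>t\<bar> * ((\<delta> - 2 / \<delta>) * f N + (1 / \<delta>) * (exp (- c) * f (Suc N) + exp c * f (N - 1)))"
    proof -
      have "(\<integral>\<omega>. ?h \<omega> \<partial>M) = (\<delta> - 2 / \<delta>) * f N + (1 / \<delta>) * (exp (- c) * f (Suc N) + exp c * f (N - 1))"
        unfolding f_def using intf by (simp add: Bochner_Integration.integral_add integrable_mult_right del: of_nat_Suc)
      then show ?thesis by simp
    qed
    also have "exp (- c) * f (Suc N) = f N" using r_pos[of N] by (simp add: ec f_Suc)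
    also have "exp c * f (N - 1) = r N / r (N - 1) * f N"
      using f_Suc[of "N - 1"] N r_pos[of "N - 1"] by (simp add: ec)
    also have "\<bar>t\<bar> * ((\<delta> - 2 / \<delta>) * f N + 1 / \<delta> * (f N + r N / r (N - 1) * f N)) = \<bar>t\<bar> * (\<delta> + (r N / r (N - 1) - 1) / \<delta>) * f N"
    proof -
      have "(\<delta> - 2 / \<delta>) * y + 1 / \<delta> * (y + q * y) = (\<delta> + (q - 1) / \<delta>) * y" for q y :: real
        using \<delta> by (simp add: field_simps)
      then show ?thesis by (simp only: mult.assoc)
    qed
    finally have "norm (F (?z N) - iexp (t * c) * of_real (f N)) \<le> \<bar>t\<bar> * (\<delta> + (r N / r (N - 1) - 1) / \<delta>) * f N" .
    moreover have "norm (F (?z N) / of_real (f N) - iexp (t * c)) = norm (F (?z N) - iexp (t * c) * of_real (f N)) / f N"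
    proof -
      have "F (?z N) / of_real (f N) - iexp (t * c) = (F (?z N) - iexp (t * c) * of_real (f N)) / of_real (f N)"
        using f_pos[of N] by (simp add: field_simps)
      then show ?thesis using f_pos[of N] by (simp add: norm_divide)
    qed
    ultimately show ?thesis using f_pos[of N] by (simp add: c_def pos_divide_le_eq)
  qed
  have r_ratio: "(\<lambda>N. r N / r (N - 1)) \<longlonglongrightarrow> 1"
  proof -
    have r1: "(\<lambda>N. r (Suc N) / r N) \<longlonglongrightarrow> ((\<Prod>s<K. 1) / (\<Prod>s<L. 1))"
    proof (rule Lim_transform_eventually)
      have lim: "(\<lambda>N. (x + real (Suc N)) / (x + real N)) \<longlonglongrightarrow> 1" if "x > 0" for x :: real
        using that by real_asymp
      show "(\<lambda>N. (\<Prod>s<K. (num s + real (Suc N)) / (num s + real N)) / (\<Prod>s<L. (den s + real (Suc N)) / (den s + real N))) \<longlonglongrightarrow> ((\<Prod>s<K. 1) / (\<Prod>s<L. 1))"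
        by (intro tendsto_divide tendsto_prod lim num den) auto
      show "\<forall>\<^sub>F N in sequentially. (\<Prod>s<K. (num s + real (Suc N)) / (num s + real N)) / (\<Prod>s<L. (den s + real (Suc N)) / (den s + real N)) = r (Suc N) / r N"
        using C by (intro always_eventually allI) (simp add: r_def prod_dividef)
    qed
    then show ?thesis by (subst filterlim_sequentially_Suc[symmetric]) simp
  qed
  \<comment> \<open>\<open>\<delta>\<close> is arbitrary in \<open>close\<close>, so it is enough that the limit for fixed \<open>\<delta>\<close> is \<open>\<bar>t\<bar> * \<delta>\<close>\<close>
  have diff0: "(\<lambda>N. F (?z N) / of_real (f N) - iexp (t * ln (r N))) \<longlonglongrightarrow> 0"
  proof (rule LIMSEQ_I)
    fix e :: real assume e: "e > 0"
    define \<delta> where "\<delta> = e / (2 * (\<bar>t\<bar> + 1))"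
    have \<delta>: "\<delta> > 0" using e by (simp add: \<delta>_def add_nonneg_pos)
    have "(\<lambda>N. \<bar>t\<bar> * (\<delta> + (r N / r (N - 1) - 1) / \<delta>)) \<longlonglongrightarrow> \<bar>t\<bar> * (\<delta> + (1 - 1) / \<delta>)"
      using \<delta> by (intro tendsto_intros r_ratio) auto
    moreover have "\<bar>t\<bar> * (\<delta> + (1 - 1) / \<delta>) < e"
    proof -
      have "\<bar>t\<bar> * \<delta> \<le> (\<bar>t\<bar> + 1) * \<delta>" using \<delta> by (simp add: distrib_right)
      also have "\<dots> = e / 2" unfolding \<delta>_def by (simp add: field_simps add_nonneg_pos less_imp_neq[symmetric])
      finally show ?thesis using e by simp
    qed
    ultimately have "\<forall>\<^sub>F N in sequentially. \<bar>t\<bar> * (\<delta> + (r N / r (N - 1) - 1) / \<delta>) < e"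
      by (rule order_tendstoD)
    then have "\<forall>\<^sub>F N in sequentially. norm (F (?z N) / of_real (f N) - iexp (t * ln (r N)) - 0) < e"
      using eventually_ge_at_top[of 1]
      by eventually_elim (use close[OF _ \<delta>] in \<open>auto intro: le_less_trans\<close>)
    then show "\<exists>no. \<forall>N\<ge>no. norm (F (?z N) / of_real (f N) - iexp (t * ln (r N)) - 0) < e"
      by (simp add: eventually_sequentially)
  qed
  define G where "G = iexp (t * ln C) * (\<Prod>s<K. gamma_ratio (num s) t) / (\<Prod>s<L. gamma_ratio (den s) t)"
  have G_nz: "G \<noteq> 0" unfolding G_def using num den by auto
  have "(\<lambda>N. iexp (t * ln C) * (\<Prod>s<K. gamma_ratio_product (num s) t N) / (\<Prod>s<L. gamma_ratio_product (den s) t N)) \<longlonglongrightarrow> G"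
    unfolding G_def using den by (intro tendsto_intros gamma_ratio_product_LIMSEQ num den) auto
  moreover have "iexp (t * ln C) * (\<Prod>s<K. gamma_ratio_product (num s) t N) / (\<Prod>s<L. gamma_ratio_product (den s) t N) =
      iexp (t * ln (r N)) * A N" for N
  proof -
    have pos: "num s + real N > 0" if "s < K" for s using num[OF that] by simp
    have pos': "den s + real N > 0" if "s < L" for s using den[OF that] by simp
    have prod_pos': "(\<Prod>s<K. num s + real N) > 0" "(\<Prod>s<L. den s + real N) > 0"
      using pos pos' by (auto intro!: prod_pos)
    have "ln (r N) = ln C + (\<Sum>s<K. ln (num s + real N)) - (\<Sum>s<L. ln (den s + real N))"
    proof -
      have "ln (r N) = ln C + ln (\<Prod>s<K. num s + real N) - ln (\<Prod>s<L. den s + real N)"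
      proof -
        have "ln (C * x / y) = ln C + ln x - ln y" if "x > 0" "y > 0" for x y :: real
          using that C by (simp add: ln_div ln_mult)
        from this[OF prod_pos'] show ?thesis by (simp only: r_def)
      qed
      also have "ln (\<Prod>s<K. num s + real N) = (\<Sum>s<K. ln (num s + real N))"
        using pos by (intro ln_prod) force+
      also have "ln (\<Prod>s<L. den s + real N) = (\<Sum>s<L. ln (den s + real N))"
        using pos' by (intro ln_prod) force+
      finally show ?thesis .
    qed
    then have e: "iexp (t * ln (r N)) = iexp (t * ln C) * (\<Prod>s<K. iexp (t * ln (num s + real N))) / (\<Prod>s<L. iexp (t * ln (den s + real N)))"
      by (simp add: distrib_left right_diff_distrib exp_add exp_diff sum_distrib_left exp_sum)
    have "of_real (r l) / R (?z l) =
       (\<Prod>s<K. of_real (num s + real l) / (of_real (num s + real l) + \<i> * of_real t)) /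
       (\<Prod>s<L. of_real (den s + real l) / (of_real (den s + real l) + \<i> * of_real t))" for l
      using C by (simp add: r_def R_def prod_dividef add_ac)
    then have a: "A N = (\<Prod>s<K. \<Prod>l<N. of_real (num s + real l) / (of_real (num s + real l) + \<i> * of_real t)) /
        (\<Prod>s<L. \<Prod>l<N. of_real (den s + real l) / (of_real (den s + real l) + \<i> * of_real t))"
      unfolding A_def by (simp only: prod_dividef[where f = "\<lambda>l. \<Prod>s<K. _ l s"] prod.swap[of _ "{..<N}"])
    show ?thesis unfolding e a gamma_ratio_product_def by (simp only: prod.distrib) simp
  qed
  ultimately have limG: "(\<lambda>N. iexp (t * ln (r N)) * A N) \<longlonglongrightarrow> G" by simp
  have "(\<lambda>N. iexp (t * ln (r N)) * A N + A N * (F (?z N) / of_real (f N) - iexp (t * ln (r N)))) = (\<lambda>_. F (\<i> * of_real t))"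
  proof
    fix N
    have "A N * (F (?z N) / of_real (f N)) = F (\<i> * of_real t)" using FA[of N] f_pos[of N] by (simp add: field_simps)
    then show "iexp (t * ln (r N)) * A N + A N * (F (?z N) / of_real (f N) - iexp (t * ln (r N))) = F (\<i> * of_real t)"
      by (simp add: right_diff_distrib)
  qed
  moreover have "(\<lambda>N. iexp (t * ln (r N)) * A N + A N * (F (?z N) / of_real (f N) - iexp (t * ln (r N)))) \<longlonglongrightarrow> G + 0"
  proof (rule tendsto_add[OF limG])
    have nA: "(\<lambda>N. norm (A N)) \<longlonglongrightarrow> norm G"
      using tendsto_norm[OF limG] by (simp add: norm_mult)
    show "(\<lambda>N. A N * (F (?z N) / of_real (f N) - iexp (t * ln (r N)))) \<longlonglongrightarrow> 0"
      using tendsto_mult[OF nA tendsto_norm[OF diff0]] by (subst tendsto_norm_zero_iff[symmetric]) (simp add: norm_mult)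
  qed
  ultimately have "F (\<i> * of_real t) = G" by (simp add: LIMSEQ_const_iff)
  then show ?thesis unfolding F_def G_def by (simp add: mult.assoc)
qed

section \<open>Gamma ratios on vertical lines\<close>
lemma norm_of_real_plus_imaginary:
  "x > 0 \<Longrightarrow> norm (of_real x + \<i> * of_real t) = x * sqrt (1 + t\<^sup>2 / x\<^sup>2)"
proof -
  assume x: "x > 0"
  have "x\<^sup>2 + t\<^sup>2 = x\<^sup>2 * (1 + t\<^sup>2 / x\<^sup>2)" using x by (simp add: field_simps)
  then have "sqrt (x\<^sup>2 + t\<^sup>2) = x * sqrt (1 + t\<^sup>2 / x\<^sup>2)"
    using x by (simp only: real_sqrt_mult) simp
  then show ?thesis by (simp add: cmod_def)
qed

lemma norm_gamma_ratio_product: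
  assumes "\<alpha> > 0"
  shows "norm (gamma_ratio_product \<alpha> t N) = (\<Prod>l<N. 1 / sqrt (1 + t\<^sup>2 / (\<alpha> + real l)\<^sup>2))"
proof -
  have "norm (gamma_ratio_product \<alpha> t N) = (\<Prod>l<N. norm (of_real (\<alpha> + real l) / (of_real (\<alpha> + real l) + \<i> * of_real t) :: complex))"
    unfolding gamma_ratio_product_def by (simp add: norm_mult prod_norm)
  also have "\<dots> = (\<Prod>l<N. 1 / sqrt (1 + t\<^sup>2 / (\<alpha> + real l)\<^sup>2))"
  proof (rule prod.cong[OF refl])
    fix l
    have pos: "\<alpha> + real l > 0" using assms by simp
    then show "norm (of_real (\<alpha> + real l) / (of_real (\<alpha> + real l) + \<i> * of_real t) :: complex) = 1 / sqrt (1 + t\<^sup>2 / (\<alpha> + real l)\<^sup>2)"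
      unfolding norm_divide norm_of_real_plus_imaginary[OF pos] by (simp del: of_real_add)
  qed
  finally show ?thesis .
qed

lemma norm_gamma_ratio_LIMSEQ:
  assumes "\<alpha> > 0"
  shows "(\<lambda>N. \<Prod>l<N. 1 / sqrt (1 + t\<^sup>2 / (\<alpha> + real l)\<^sup>2)) \<longlonglongrightarrow> norm (gamma_ratio \<alpha> t)"
  using tendsto_norm[OF gamma_ratio_product_LIMSEQ[OF assms, of t]] norm_gamma_ratio_product[OF assms] by simp

text \<open>
  Every factor \<open>1 / sqrt (1 + t\<^sup>2 / (\<alpha> + l)\<^sup>2)\<close> of the limiting product increases with \<open>\<alpha>\<close>.
\<close>

lemma norm_gamma_ratio_mono:
  assumes "0 < \<alpha>" "\<alpha> \<le> \<alpha>'"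
  shows "norm (gamma_ratio \<alpha> t) \<le> norm (gamma_ratio \<alpha>' t)"
proof (rule LIMSEQ_le[OF norm_gamma_ratio_LIMSEQ norm_gamma_ratio_LIMSEQ])
  show "\<exists>N. \<forall>n\<ge>N. (\<Prod>l<n. 1 / sqrt (1 + t\<^sup>2 / (\<alpha> + real l)\<^sup>2)) \<le> (\<Prod>l<n. 1 / sqrt (1 + t\<^sup>2 / (\<alpha>' + real l)\<^sup>2))"
  proof (intro exI allI impI prod_mono conjI)
    fix l
    have "t\<^sup>2 / (\<alpha>' + real l)\<^sup>2 \<le> t\<^sup>2 / (\<alpha> + real l)\<^sup>2"
      using assms by (intro divide_left_mono power_mono) auto
    then show "1 / sqrt (1 + t\<^sup>2 / (\<alpha> + real l)\<^sup>2) \<le> 1 / sqrt (1 + t\<^sup>2 / (\<alpha>' + real l)\<^sup>2)"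
      by (intro divide_left_mono) (auto intro!: mult_pos_pos add_pos_nonneg)
  qed auto
qed (use assms in auto)

lemma norm_gamma_ratio_le_1:
  assumes "0 < \<alpha>" shows "norm (gamma_ratio \<alpha> t) \<le> 1"
proof -
  have le1: "1 / sqrt (1 + a) \<le> 1" if "a \<ge> 0" for a :: real
    using that by (subst divide_le_eq_1_pos) auto
  show ?thesis
    by (rule LIMSEQ_le_const2[OF norm_gamma_ratio_LIMSEQ[OF assms, of t]])
       (intro exI[of _ 0] allI impI prod_le_1 conjI le1; simp)
qed

lemma norm_gamma_ratio_shift:
  assumes \<alpha>: "0 < \<alpha>"
  shows "norm (gamma_ratio \<alpha> t) = norm (gamma_ratio (\<alpha> + real r) t) / sqrt (\<Prod>l<r. 1 + t\<^sup>2 / (\<alpha> + real l)\<^sup>2)"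
proof -
  let ?f = "\<lambda>l. 1 / sqrt (1 + t\<^sup>2 / (\<alpha> + real l)\<^sup>2)"
  have "(\<lambda>N. (\<Prod>l<r. ?f l) * (\<Prod>l<N. 1 / sqrt (1 + t\<^sup>2 / (\<alpha> + real r + real l)\<^sup>2))) \<longlonglongrightarrow> (\<Prod>l<r. ?f l) * norm (gamma_ratio (\<alpha> + real r) t)"
    using \<alpha> by (intro tendsto_mult tendsto_const norm_gamma_ratio_LIMSEQ) auto
  moreover have "(\<Prod>l<r. ?f l) * (\<Prod>l<N. 1 / sqrt (1 + t\<^sup>2 / (\<alpha> + real r + real l)\<^sup>2)) = (\<Prod>l<N + r. ?f l)" for N
    by (induction N) (simp_all add: mult.assoc[symmetric] add_ac)
  ultimately have "(\<lambda>N. \<Prod>l<N + r. ?f l) \<longlonglongrightarrow> (\<Prod>l<r. ?f l) * norm (gamma_ratio (\<alpha> + real r) t)" by simp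
  moreover have "(\<lambda>N. \<Prod>l<N + r. ?f l) \<longlonglongrightarrow> norm (gamma_ratio \<alpha> t)"
    by (rule LIMSEQ_ignore_initial_segment[OF norm_gamma_ratio_LIMSEQ[OF \<alpha>]])
  ultimately have "norm (gamma_ratio \<alpha> t) = (\<Prod>l<r. ?f l) * norm (gamma_ratio (\<alpha> + real r) t)"
    by (rule LIMSEQ_unique[rotated])
  moreover have "(\<Prod>l<r. ?f l) = 1 / sqrt (\<Prod>l<r. 1 + t\<^sup>2 / (\<alpha> + real l)\<^sup>2)"
    by (induction r) (simp_all add: real_sqrt_mult)
  ultimately show ?thesis by simp
qed

lemma inverse_difference_bounds:
  assumes "y > (0::real)"
  shows "1 / y - 1 / (y + 1) \<le> 1 / y\<^sup>2" "1 / (y + 1)\<^sup>2 \<le> 1 / y - 1 / (y + 1)"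
proof -
  have "1 / y - 1 / (y + 1) = 1 / (y * (y + 1))" using assms by (simp add: divide_simps)
  moreover have "1 / (y * (y + 1)) \<le> 1 / y\<^sup>2" "1 / (y + 1)\<^sup>2 \<le> 1 / (y * (y + 1))"
    using assms by (auto intro!: divide_left_mono mult_pos_pos simp: power2_eq_square)
  ultimately show "1 / y - 1 / (y + 1) \<le> 1 / y\<^sup>2" "1 / (y + 1)\<^sup>2 \<le> 1 / y - 1 / (y + 1)" by simp_all
qed

lemma prod_one_plus_inverse_square_ge:
  assumes "\<alpha> > (0::real)"
  shows "1 + t\<^sup>2 * (1 / \<alpha> - 1 / (\<alpha> + real r)) \<le> (\<Prod>l<r. 1 + t\<^sup>2 / (\<alpha> + real l)\<^sup>2)"
proof (induction r)
  case (Suc r)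
  let ?x = "\<alpha> + real r"
  have x: "?x > 0" using assms by simp
  have "1 / ?x - 1 / (?x + 1) \<le> 1 / ?x\<^sup>2"
    by (rule inverse_difference_bounds(1)[OF x])
  then have "t\<^sup>2 * (1 / ?x - 1 / (?x + 1)) \<le> t\<^sup>2 / ?x\<^sup>2"
    using mult_left_mono[of "1 / ?x - 1 / (?x + 1)" "1 / ?x\<^sup>2" "t\<^sup>2"] by simp
  then have 1: "1 + t\<^sup>2 * (1 / \<alpha> - 1 / (\<alpha> + real (Suc r))) \<le> (1 + t\<^sup>2 * (1 / \<alpha> - 1 / ?x)) + t\<^sup>2 / ?x\<^sup>2"
    by (simp add: algebra_simps)
  have "1 \<le> (\<Prod>l<r. 1 + t\<^sup>2 / (\<alpha> + real l)\<^sup>2)" by (intro prod_ge_1) auto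
  then have "t\<^sup>2 / ?x\<^sup>2 \<le> (\<Prod>l<r. 1 + t\<^sup>2 / (\<alpha> + real l)\<^sup>2) * (t\<^sup>2 / ?x\<^sup>2)"
    using mult_right_mono[of 1 "\<Prod>l<r. 1 + t\<^sup>2 / (\<alpha> + real l)\<^sup>2" "t\<^sup>2 / ?x\<^sup>2"] by simp
  then show ?case using 1 Suc by (simp add: distrib_left)
qed simp

text \<open>
  The ratio at \<open>\<eta>\<close> is at least the ratio at \<open>\<alpha> + r\<close> with \<open>r = \<lfloor>\<eta> - \<alpha>\<rfloor>\<close>, and the latter differs from
  the ratio at \<open>\<alpha>\<close> by \<open>r\<close> explicit factors. Unlike an estimate of single factors of the infinite
  product, this one does not saturate for large \<open>t\<close>.
\<close>

lemma norm_gamma_ratio_decay: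
  assumes \<alpha>: "\<alpha> > 0" and \<eta>: "2 * \<alpha> \<le> \<eta>" "\<alpha> + 1 \<le> \<eta>"
  shows "norm (gamma_ratio \<alpha> t) \<le> norm (gamma_ratio \<eta> t) / sqrt (1 + t\<^sup>2 / (4 * \<alpha>))"
proof -
  define r where "r = nat \<lfloor>\<eta> - \<alpha>\<rfloor>"
  have "\<lfloor>\<eta> - \<alpha>\<rfloor> \<ge> 1" using \<eta> by linarith
  then have r: "real r \<le> \<eta> - \<alpha>" "real r > \<eta> - \<alpha> - 1" "real r \<ge> 1" unfolding r_def by linarith+
  \<comment> \<open>this makes \<open>\<alpha> + r\<close> at least \<open>4 / 3 * \<alpha>\<close>, the origin of the factor \<open>4\<close> in the claim\<close>
  then have r3: "3 * real r \<ge> \<alpha>" using \<eta> by linarith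
  have "1 / (4 * \<alpha>) \<le> 1 / \<alpha> - 1 / (\<alpha> + real r)"
  proof -
    have "1 / (\<alpha> + real r) \<le> 1 / (4 / 3 * \<alpha>)" using \<alpha> r3 by (intro divide_left_mono) auto
    then have "1 / (\<alpha> + real r) \<le> 3 / 4 * (1 / \<alpha>)" by simp
    moreover have "1 / (4 * \<alpha>) = 1 / \<alpha> - 3 / 4 * (1 / \<alpha>)" using \<alpha> by (simp add: field_simps)
    ultimately show ?thesis by simp
  qed
  then have "t\<^sup>2 / (4 * \<alpha>) \<le> t\<^sup>2 * (1 / \<alpha> - 1 / (\<alpha> + real r))"
    using mult_left_mono[of "1 / (4 * \<alpha>)" "1 / \<alpha> - 1 / (\<alpha> + real r)" "t\<^sup>2"] by simp
  then have le: "1 + t\<^sup>2 / (4 * \<alpha>) \<le> (\<Prod>l<r. 1 + t\<^sup>2 / (\<alpha> + real l)\<^sup>2)"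
    using prod_one_plus_inverse_square_ge[OF \<alpha>, of t r] by linarith
  have pos: "1 + t\<^sup>2 / (4 * \<alpha>) > 0" using \<alpha> by (intro add_pos_nonneg) auto
  have "norm (gamma_ratio \<alpha> t) \<le> norm (gamma_ratio (\<alpha> + real r) t) / sqrt (1 + t\<^sup>2 / (4 * \<alpha>))"
    unfolding norm_gamma_ratio_shift[OF \<alpha>, of t r] using le pos by (intro divide_left_mono) auto
  also have "\<dots> \<le> norm (gamma_ratio \<eta> t) / sqrt (1 + t\<^sup>2 / (4 * \<alpha>))"
    using r \<alpha> pos by (intro divide_right_mono norm_gamma_ratio_mono) auto
  finally show ?thesis .
qed

text \<open>
  Expanding the product up to second order, the first two elementary symmetric functions of
  \<open>1 / k\<close>, \<open>k \<le> K\<close>, are \<open>harm K\<close> and \<open>((harm K)\<^sup>2 - Q K) / 2\<close>, where \<open>Q K\<close> sums the squares. Since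
  \<open>Q K \<le> harm K\<close>, the second one is at least \<open>(harm K)\<^sup>2 / 4\<close> as soon as \<open>harm K \<ge> 2\<close>. The quadratic term is
  what makes the eventual bound on the characteristic function integrable.
\<close>

lemma prod_one_plus_harmonic_ge:
  fixes c :: real assumes c: "c \<ge> 0" and H: "harm K \<ge> (2::real)"
  shows "(1 + c * harm K / 2)\<^sup>2 \<le> (\<Prod>s<K. 1 + c / (real s + 1))"
proof -
  define Q where "Q = (\<lambda>K. \<Sum>s<K. 1 / (real s + 1)\<^sup>2)"
  have harm: "harm K = (\<Sum>s<K. 1 / (real s + 1))" for K :: nat
    by (simp add: harm_altdef inverse_eq_divide add_ac)
  have "1 + c * harm K + c\<^sup>2 * ((harm K)\<^sup>2 - Q K) / 2 \<le> (\<Prod>s<K. 1 + c / (real s + 1)) \<and> Q K \<le> (harm K)\<^sup>2 \<and> Q K \<le> harm K" for K :: nat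
  proof (induction K)
    case 0
    then show ?case by (simp add: Q_def harm)
  next
    case (Suc K)
    let ?y = "1 / (real K + 1)" and ?E = "((harm K)\<^sup>2 - Q K) / 2 :: real"
    have y: "0 \<le> ?y" "?y \<le> 1" by auto
    have h0: "harm K \<ge> (0::real)" by (simp add: harm_nonneg)
    have hS: "harm (Suc K) = (harm K + ?y :: real)" by (simp add: harm)
    have QS: "Q (Suc K) = Q K + ?y\<^sup>2" by (simp add: Q_def power_divide)
    have E: "((harm (Suc K))\<^sup>2 - Q (Suc K)) / 2 = ?E + harm K * ?y"
    proof -
      have "((h + y)\<^sup>2 - (q + y\<^sup>2)) / 2 = (h\<^sup>2 - q) / 2 + h * y" for h q y :: real
        by (simp add: power2_sum field_simps)
      then show ?thesis unfolding hS QS .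
    qed
    have "1 + c * harm (Suc K) + c\<^sup>2 * (?E + harm K * ?y) \<le> (1 + c * harm K + c\<^sup>2 * ?E) * (1 + c * ?y)"
    proof -
      have "0 \<le> c\<^sup>2 * ?E * (c * ?y)" using Suc c y by (intro mult_nonneg_nonneg) auto
      moreover have "1 + c * (h + y) + c\<^sup>2 * (E + h * y) \<le> (1 + c * h + c\<^sup>2 * E) * (1 + c * y)"
        if "0 \<le> c\<^sup>2 * E * (c * y)" for h y E :: real
        using that by (simp add: algebra_simps power2_eq_square)
      ultimately show ?thesis unfolding hS by blast
    qed
    also have "\<dots> \<le> (\<Prod>s<K. 1 + c / (real s + 1)) * (1 + c * ?y)"
      using Suc c y by (intro mult_right_mono) auto
    also have "\<dots> = (\<Prod>s<Suc K. 1 + c / (real s + 1))" by simp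
    finally have 1: "1 + c * harm (Suc K) + c\<^sup>2 * ((harm (Suc K))\<^sup>2 - Q (Suc K)) / 2 \<le> (\<Prod>s<Suc K. 1 + c / (real s + 1))"
      unfolding times_divide_eq_right[symmetric, of "c\<^sup>2"] E .
    have "?y\<^sup>2 \<le> ?y" using mult_left_mono[OF y(2) y(1)] by (simp only: power2_eq_square mult_1_right)
    moreover have "(harm K)\<^sup>2 + ?y\<^sup>2 \<le> (harm K + ?y)\<^sup>2" using h0 y by (simp add: power2_sum)
    ultimately have "Q (Suc K) \<le> (harm (Suc K))\<^sup>2 \<and> Q (Suc K) \<le> harm (Suc K)"
      using Suc unfolding hS QS by linarith
    then show ?case using 1 by blast
  qed
  note ind = this[of K]
  have "Q K \<le> (harm K)\<^sup>2 / 2"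
  proof -
    have "harm K * 2 \<le> harm K * (harm K :: real)" using H by (intro mult_left_mono) auto
    then show ?thesis using ind by (simp add: power2_eq_square)
  qed
  then have "c\<^sup>2 * ((harm K)\<^sup>2 / 4) \<le> c\<^sup>2 * (((harm K)\<^sup>2 - Q K) / 2)"
    by (intro mult_left_mono) auto
  moreover have "(1 + c * harm K / 2)\<^sup>2 = 1 + c * harm K + c\<^sup>2 * ((harm K)\<^sup>2 / 4)"
    by (simp add: power2_eq_square algebra_simps)
  ultimately show ?thesis using ind by simp
qed

lemma summable_inverse_shift_power:
  assumes "(x::real) > 0" "n \<ge> 2"
  shows "summable (\<lambda>l. 1 / (x + real l) ^ n)"
  using Polygamma_converges'[of x n] assms by (simp add: inverse_eq_divide)

lemma inverse_shift_telescope: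
  assumes "(x::real) > 0"
  shows "(\<lambda>l. 1 / (x + real l) - 1 / (x + real (Suc l))) sums (1 / x)"
proof -
  have "(\<lambda>l. 1 / (x + real l)) \<longlonglongrightarrow> 0" by real_asymp
  from telescope_sums'[OF this] show ?thesis by simp
qed

text \<open>
  Comparison with the telescoping series of \<open>1 / (x + l) - 1 / (x + l + 1)\<close>.
\<close>

lemma suminf_inverse_square_bounds:
  assumes x: "(x::real) > 0"
  shows "1 / x \<le> (\<Sum>l. 1 / (x + real l)\<^sup>2)" "(\<Sum>l. 1 / (x + real l)\<^sup>2) \<le> 1 / x + 1 / x\<^sup>2"
proof -
  note tel = inverse_shift_telescope[OF x]
  note s = summable_inverse_shift_power[OF x order_refl]
  have b: "1 / (x + real l) - 1 / (x + real (Suc l)) \<le> 1 / (x + real l)\<^sup>2"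
    "1 / (x + real (Suc l))\<^sup>2 \<le> 1 / (x + real l) - 1 / (x + real (Suc l))" for l
  proof -
    define y where "y = x + real l"
    have y: "y > 0" using x by (simp add: y_def)
    have "1 / y - 1 / (y + 1) \<le> 1 / y\<^sup>2" "1 / (y + 1)\<^sup>2 \<le> 1 / y - 1 / (y + 1)"
      by (rule inverse_difference_bounds[OF y])+
    then show "1 / (x + real l) - 1 / (x + real (Suc l)) \<le> 1 / (x + real l)\<^sup>2"
      "1 / (x + real (Suc l))\<^sup>2 \<le> 1 / (x + real l) - 1 / (x + real (Suc l))"
      by (simp_all add: y_def add_ac)
  qed
  show "1 / x \<le> (\<Sum>l. 1 / (x + real l)\<^sup>2)"
    unfolding sums_unique[OF tel] using b(1) by (intro suminf_le sums_summable[OF tel] s)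
  have "(\<Sum>l. 1 / (x + real l)\<^sup>2) = (\<Sum>l. 1 / (x + real (Suc l))\<^sup>2) + 1 / x\<^sup>2"
    using suminf_split_head[OF s] by simp
  also have "(\<Sum>l. 1 / (x + real (Suc l))\<^sup>2) \<le> 1 / x"
    unfolding sums_unique[OF tel] using b(2) by (intro suminf_le sums_summable[OF tel] summable_Suc_iff[THEN iffD2] s)
  finally show "(\<Sum>l. 1 / (x + real l)\<^sup>2) \<le> 1 / x + 1 / x\<^sup>2" by simp
qed

lemma trigamma_bounds:
  assumes x: "(x::real) > 0"
  shows "1 / x \<le> Polygamma 1 x" "Polygamma 1 x \<le> 1 / x + 1 / x\<^sup>2"
  using suminf_inverse_square_bounds[OF x] unfolding Polygamma_def by (simp_all add: inverse_eq_divide power2_eq_square)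

text \<open>
  The quantity is the total error of the trapezoidal rule for \<open>1 / y\<close> with nodes \<open>x, x + 1, x + 2, \<dots>\<close>.
  The error \<open>?d l\<close> on one interval is nonpositive by convexity, and its modulus is at most
  \<open>1 / (4 x)\<close> times a telescoping term.
\<close>

lemma digamma_bounds:
  assumes x: "(x::real) > 0"
  shows "Digamma x - (ln x - 1 / (2 * x)) \<in> {- (1 / (4 * x\<^sup>2))..0}"
proof -
  let ?d = "\<lambda>l. ln (x + real (Suc l)) - ln (x + real l) - (1 / (x + real l) + 1 / (x + real (Suc l))) / 2"
  have d: "?d l \<in> {- (1 / (4 * x)) * (1 / (x + real l) - 1 / (x + real (Suc l)))..0}" for l
  proof -
    define y where "y = x + real l"
    have y: "y > 0" "y \<ge> x" using x by (simp_all add: y_def)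
    have "ln (y + 1) - ln y \<le> (1 / y + 1 / (y + 1)) / 2"
      using ln_inverse_approx_le[of y 1] y by (simp add: inverse_eq_divide)
    moreover have "ln (y + 1) - ln y - (1 / y + 1 / (y + 1)) / 2 \<ge> - (1 / (4 * x)) * (1 / y - 1 / (y + 1))"
    proof -
      have "ln (y + 1) - ln y \<ge> 2 / (2 * y + 1)"
        using ln_inverse_approx_ge[of y "y + 1"] y by (simp add: add_ac)
      moreover have "2 / (2 * y + 1) - (1 / y + 1 / (y + 1)) / 2 = - (1 / (2 * (2 * y + 1))) * (1 / y - 1 / (y + 1))"
        using y by (simp add: divide_simps) (simp add: algebra_simps)
      moreover have "1 / (2 * (2 * y + 1)) * (1 / y - 1 / (y + 1)) \<le> 1 / (4 * x) * (1 / y - 1 / (y + 1))"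
        using x y by (intro mult_right_mono divide_left_mono mult_pos_pos) (auto simp: divide_simps)
      ultimately show ?thesis by simp
    qed
    ultimately show ?thesis by (simp add: y_def add_ac)
  qed
  have sum: "(\<Sum>l<m. ?d l) = ln (x + real m) - ln x - (\<Sum>l<m. 1 / (x + real l)) + 1 / (2 * x) - 1 / (2 * (x + real m))" for m
  proof (induction m)
    case (Suc m)
    have half: "1 / (2 * y) = (1 / y) / 2" for y :: real by simp
    have step: "(L0 - lx - S + h - a / 2) + (L1 - L0 - (a + b) / 2) = L1 - lx - (S + a) + h - b / 2"
      for L0 L1 lx S h a b :: real by (simp add: field_simps)
    show ?case unfolding sum.lessThan_Suc Suc half by (rule step)
  qed simp
  have "(\<lambda>m. (ln (real m) - (\<Sum>l<m. 1 / (x + real l))) + (ln (x + real m) - ln (real m) - 1 / (2 * (x + real m))) + (1 / (2 * x) - ln x))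
      \<longlonglongrightarrow> Digamma x + 0 + (1 / (2 * x) - ln x)"
  proof (intro tendsto_add tendsto_const)
    show "(\<lambda>m. ln (real m) - (\<Sum>l<m. 1 / (x + real l))) \<longlonglongrightarrow> Digamma x"
      using Digamma_LIMSEQ[of x] x by (simp add: inverse_eq_divide)
    show "(\<lambda>m. ln (x + real m) - ln (real m) - 1 / (2 * (x + real m))) \<longlonglongrightarrow> 0" using x by real_asymp
  qed
  then have lim: "(\<lambda>m. \<Sum>l<m. ?d l) \<longlonglongrightarrow> Digamma x - (ln x - 1 / (2 * x))"
    unfolding sum by (simp add: algebra_simps)
  have "Digamma x - (ln x - 1 / (2 * x)) \<le> 0"
    by (rule LIMSEQ_le_const2[OF lim]) (use d in \<open>force intro!: sum_nonpos\<close>)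
  moreover have "(\<Sum>l<m. ?d l) \<ge> - (1 / (4 * x\<^sup>2))" for m
  proof -
    have "(\<Sum>l<m. 1 / (x + real l) - 1 / (x + real (Suc l))) = 1 / x - 1 / (x + real m)"
      by (induction m) simp_all
    then have "(\<Sum>l<m. - (1 / (4 * x)) * (1 / (x + real l) - 1 / (x + real (Suc l)))) = - (1 / (4 * x)) * (1 / x - 1 / (x + real m))"
      by (simp only: sum_distrib_left[symmetric])
    also have "\<dots> \<ge> - (1 / (4 * x)) * (1 / x)" using x by (intro mult_left_mono_neg) auto
    finally have "- (1 / (4 * x\<^sup>2)) \<le> (\<Sum>l<m. - (1 / (4 * x)) * (1 / (x + real l) - 1 / (x + real (Suc l))))"
      by (simp add: power2_eq_square)
    also have "\<dots> \<le> (\<Sum>l<m. ?d l)" using d by (intro sum_mono) simp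
    finally show ?thesis .
  qed
  then have "- (1 / (4 * x\<^sup>2)) \<le> Digamma x - (ln x - 1 / (2 * x))"
    by (intro LIMSEQ_le_const[OF lim]) auto
  ultimately show ?thesis by simp
qed

text \<open>
  Second-order Taylor expansion of \<open>ln_Gamma\<close> in the half-plane \<open>Re z \<ge> \<alpha>\<close>, where the third
  derivative \<open>Polygamma 2\<close> is bounded by its value at \<open>\<alpha>\<close>, termwise in its series.
\<close>

lemma gamma_ratio_expansion:
  assumes \<alpha>: "\<alpha> > 0"
  shows "\<exists>e. norm e \<le> \<bar>t\<bar> ^ 3 * (1 / \<alpha>\<^sup>2 + 1 / \<alpha> ^ 3) \<and>
     gamma_ratio \<alpha> t = exp (\<i> * of_real (t * Digamma \<alpha>) - of_real (t\<^sup>2 / 2 * Polygamma 1 \<alpha>) + e)"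
proof -
  \<comment> \<open>\<open>f i\<close> is the \<open>i\<close>-th derivative of \<open>ln_Gamma\<close>\<close>
  define f :: "nat \<Rightarrow> complex \<Rightarrow> complex" where "f = (\<lambda>i. case i of 0 \<Rightarrow> ln_Gamma | Suc j \<Rightarrow> Polygamma j)"
  let ?S = "{z. Re z \<ge> \<alpha>}"
  let ?w = "of_real \<alpha> :: complex" and ?z = "of_real \<alpha> + \<i> * of_real t :: complex"
  have S: "z \<notin> \<real>\<^sub>\<le>\<^sub>0" "z \<notin> \<int>\<^sub>\<le>\<^sub>0" if "z \<in> ?S" for z
    using that \<alpha> by (auto simp: complex_nonpos_Reals_iff intro!: not_nonpos_Ints_Re)
  define B where "B = 2 * (1 / \<alpha>\<^sup>2 + 1 / \<alpha> ^ 3)"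
  have "norm (f 0 ?z - (\<Sum>i\<le>2. f i ?w * (?z - ?w) ^ i / fact i)) \<le> B * norm (?z - ?w) ^ Suc 2 / fact 2"
  proof (rule complex_Taylor[where S = ?S])
    show "convex ?S" by (rule convex_halfspace_Re_ge)
    show "(f i has_field_derivative f (Suc i) x) (at x within ?S)" if "x \<in> ?S" "i \<le> 2" for i x
      using S[OF that(1)] by (cases i)
        (auto simp: f_def intro!: has_field_derivative_at_within[OF has_field_derivative_ln_Gamma_complex] has_field_derivative_Polygamma)
    show "norm (f (Suc 2) x) \<le> B" if x: "x \<in> ?S" for x
    proof -
      have le: "norm (inverse ((x + of_nat k) ^ 3)) \<le> 1 / \<alpha> * (1 / (\<alpha> + real k)\<^sup>2)" for k
      proof -
        have pos: "\<alpha> + real k > 0" using \<alpha> by simp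
        have "\<alpha> + real k \<le> Re (x + of_nat k)" using x by simp
        also have "\<dots> \<le> norm (x + of_nat k)" by (rule complex_Re_le_cmod)
        finally have "(\<alpha> + real k) ^ 3 \<le> norm (x + of_nat k) ^ 3" using pos by (intro power_mono) auto
        moreover have "\<alpha> * (\<alpha> + real k)\<^sup>2 \<le> (\<alpha> + real k) * (\<alpha> + real k)\<^sup>2" by (intro mult_right_mono) auto
        then have "\<alpha> * (\<alpha> + real k)\<^sup>2 \<le> (\<alpha> + real k) ^ 3" by (simp add: power2_eq_square power3_eq_cube)
        ultimately have "\<alpha> * (\<alpha> + real k)\<^sup>2 \<le> norm (x + of_nat k) ^ 3" by linarith
        then have "1 / norm (x + of_nat k) ^ 3 \<le> 1 / (\<alpha> * (\<alpha> + real k)\<^sup>2)"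
          using \<alpha> pos by (intro frac_le) auto
        then show ?thesis by (simp add: norm_divide norm_power inverse_eq_divide)
      qed
      have s: "summable (\<lambda>k. 1 / \<alpha> * (1 / (\<alpha> + real k)\<^sup>2))"
        by (intro summable_mult summable_inverse_shift_power \<alpha>) simp
      have s': "summable (\<lambda>k. norm (inverse ((x + of_nat k) ^ 3)))"
        by (rule summable_comparison_test'[OF s, of 0]) (use le in auto)
      have "norm (\<Sum>k. inverse ((x + of_nat k) ^ 3)) \<le> (\<Sum>k. 1 / \<alpha> * (1 / (\<alpha> + real k)\<^sup>2))"
        using order_trans[OF summable_norm[OF s'] suminf_le[OF le s' s]] .
      also have "\<dots> = 1 / \<alpha> * (\<Sum>k. 1 / (\<alpha> + real k)\<^sup>2)"
        by (intro suminf_mult summable_inverse_shift_power \<alpha>) simp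
      also have "\<dots> \<le> 1 / \<alpha> * (1 / \<alpha> + 1 / \<alpha>\<^sup>2)"
        using \<alpha> by (intro mult_left_mono suminf_inverse_square_bounds) auto
      finally have "norm (\<Sum>k. inverse ((x + of_nat k) ^ 3)) \<le> 1 / \<alpha> * (1 / \<alpha> + 1 / \<alpha>\<^sup>2)" .
      moreover have "f (Suc 2) x = - 2 * (\<Sum>k. inverse ((x + of_nat k) ^ 3))"
        by (simp add: f_def Polygamma_def numeral_2_eq_2 numeral_3_eq_3)
      ultimately show ?thesis unfolding B_def
        by (simp add: norm_mult power2_eq_square power3_eq_cube distrib_left)
    qed
  qed (use \<alpha> in auto)
  also have "B * norm (?z - ?w) ^ Suc 2 / fact 2 = \<bar>t\<bar> ^ 3 * (1 / \<alpha>\<^sup>2 + 1 / \<alpha> ^ 3)"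
  proof -
    have "norm (?z - ?w) = \<bar>t\<bar>" by (simp add: norm_mult)
    moreover have "2 * y * \<bar>t\<bar> ^ Suc 2 / fact 2 = \<bar>t\<bar> ^ 3 * y" for y :: real by (simp add: numeral_3_eq_3)
    ultimately show ?thesis unfolding B_def by (simp only:)
  qed
  finally have "norm (f 0 ?z - (\<Sum>i\<le>2. f i ?w * (?z - ?w) ^ i / fact i)) \<le> \<bar>t\<bar> ^ 3 * (1 / \<alpha>\<^sup>2 + 1 / \<alpha> ^ 3)" .
  moreover have "(\<Sum>i\<le>2. f i ?w * (?z - ?w) ^ i / fact i) = ln_Gamma ?w + (\<i> * of_real (t * Digamma \<alpha>) - of_real (t\<^sup>2 / 2 * Polygamma 1 \<alpha>))"
    using \<alpha> by (simp add: f_def numeral_2_eq_2 Polygamma_of_real power_mult_distrib field_simps)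
  moreover have "gamma_ratio \<alpha> t = exp (f 0 ?z - ln_Gamma ?w)"
  proof -
    have "exp (ln_Gamma ?z) = Gamma ?z" "exp (ln_Gamma ?w) = Gamma ?w"
      using S[of ?z] S[of ?w] by (simp_all add: Gamma_complex_altdef)
    then show ?thesis by (simp add: f_def gamma_ratio_def exp_diff)
  qed
  ultimately show ?thesis
    by (intro exI[of _ "f 0 ?z - (\<Sum>i\<le>2. f i ?w * (?z - ?w) ^ i / fact i)"]) (simp add: algebra_simps)
qed

section \<open>Means, variances and decay of Gamma quotients\<close>
lemma sum_inverse_squares_le: "(\<Sum>s<K. 1 / (real s + 1)\<^sup>2) \<le> 2"
proof -
  have "(\<Sum>s<Suc K. 1 / (real s + 1)\<^sup>2) \<le> 2 - 1 / (real K + 1)"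
  proof (induction K)
    case (Suc K)
    have "1 / (real K + 1 + 1)\<^sup>2 \<le> 1 / (real K + 1) - 1 / (real K + 1 + 1)"
      by (rule inverse_difference_bounds) simp
    then show ?case using Suc by (simp add: add_ac)
  qed simp
  also have "\<dots> \<le> 2" by simp
  finally have "(\<Sum>s<K. 1 / (real s + 1)\<^sup>2) + 1 / (real K + 1)\<^sup>2 \<le> 2" by simp
  moreover have "1 / (real K + 1)\<^sup>2 \<ge> 0" by simp
  ultimately show ?thesis by linarith
qed

lemma ln_fact_sum: "ln (fact K) = (\<Sum>s<K. ln (real s + 1))"
  by (induction K) (simp_all add: ln_mult add_ac)

lemma harm_sum: "harm K = (\<Sum>s<K. 1 / (real s + 1))"
  by (simp add: harm_altdef inverse_eq_divide add_ac)

text \<open>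
  The error \<open>s n\<close> of Stirling's formula decreases, by at most \<open>1 / (4 n) - 1 / (4 (n + 1))\<close> per step,
  from its value \<open>1\<close> at \<open>n = 1\<close>.
\<close>

lemma ln_fact_bounds:
  assumes "n \<ge> 1"
  shows "\<bar>ln (fact n) - ((real n + 1 / 2) * ln (real n) - real n)\<bar> \<le> 1"
proof -
  define s where "s = (\<lambda>n. ln (fact n) - ((real n + 1 / 2) * ln (real n) - real n))"
  have "3 / 4 + 1 / (4 * real n) \<le> s n \<and> s n \<le> 1" using assms
  proof (induction n rule: dec_induct)
    case base
    then show ?case by (simp add: s_def)
  next
    case (step n)
    define x where "x = real n"
    have x: "x \<ge> 1" using step by (simp add: x_def)
    have diff: "s n - s (Suc n) = (x + 1 / 2) * (ln (x + 1) - ln x) - 1"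
    proof -
      have "ln (fact (Suc n)) = ln (fact n) + ln (x + 1)" by (simp only: ln_fact_sum sum.lessThan_Suc x_def)
      moreover have "real (Suc n) = x + 1" by (simp add: x_def)
      ultimately show ?thesis unfolding s_def x_def[symmetric] by (simp only:) (simp add: algebra_simps)
    qed
    have "ln (x + 1) - ln x \<ge> 2 / (2 * x + 1)"
      using ln_inverse_approx_ge[of x "x + 1"] x by (simp add: add_ac)
    then have "(x + 1 / 2) * (2 / (2 * x + 1)) \<le> (x + 1 / 2) * (ln (x + 1) - ln x)"
      using x by (intro mult_left_mono) auto
    moreover have "(x + 1 / 2) * (2 / (2 * x + 1)) = 1" using x by (simp add: field_simps)
    ultimately have up: "s (Suc n) \<le> s n" using diff by linarith
    have "ln (x + 1) - ln x \<le> (1 / x + 1 / (x + 1)) / 2"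
      using ln_inverse_approx_le[of x 1] x by (simp add: inverse_eq_divide)
    then have "(x + 1 / 2) * (ln (x + 1) - ln x) \<le> (x + 1 / 2) * ((1 / x + 1 / (x + 1)) / 2)"
      using x by (intro mult_left_mono) auto
    also have "\<dots> = 1 + (1 / (4 * x) - 1 / (4 * (x + 1)))"
      using x by (simp add: divide_simps) (simp add: algebra_simps)
    finally have "s n - s (Suc n) \<le> 1 / (4 * x) - 1 / (4 * (x + 1))" using diff by linarith
    then have "3 / 4 + 1 / (4 * (x + 1)) \<le> s (Suc n)" using step.IH unfolding x_def[symmetric] by linarith
    moreover have "real (Suc n) = x + 1" by (simp add: x_def)
    moreover have "s (Suc n) \<le> 1" using step.IH up by linarith
    ultimately show ?case by (simp only: conj_absorb simp_thms)
  qed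
  moreover have "1 / (4 * real n) \<ge> 0" by simp
  ultimately have "\<bar>s n\<bar> \<le> 1" by linarith
  then show ?thesis unfolding s_def .
qed

lemma harm_ln_bounds:
  assumes "n \<ge> 1" shows "harm n - ln (real n) \<in> {0..1}"
proof -
  have "harm n - ln (real n) \<ge> 0"
  proof -
    have "ln (real n) \<le> ln (real n + 1)" using assms by simp
    then show ?thesis using ln_le_harm[of n] by linarith
  qed
  moreover have "harm n - ln (of_nat n) \<le> harm 1 - ln (of_nat 1 :: real)"
    using assms by (intro euler_mascheroni_sequence_decreasing) auto
  ultimately show ?thesis by (simp add: harm_expand)
qed

definition digamma_sum :: "real \<Rightarrow> nat \<Rightarrow> real" where
  "digamma_sum \<beta> K = (\<Sum>s<K. Digamma (\<beta> / 2 * (real s + 1)))"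

definition trigamma_sum :: "real \<Rightarrow> nat \<Rightarrow> real" where
  "trigamma_sum \<beta> K = (\<Sum>s<K. Polygamma 1 (\<beta> / 2 * (real s + 1)))"

text \<open>
  Insert \<open>\<psi>(x) = ln x - 1 / (2 x) + O(1 / x\<^sup>2)\<close> at \<open>x = \<beta> / 2 * (s + 1)\<close>; the errors are summable.
\<close>

lemma digamma_sum_bounds:
  assumes \<beta>: "\<beta> > 0"
  shows "\<bar>digamma_sum \<beta> K - (real K * ln (\<beta> / 2) + ln (fact K) - harm K / \<beta>)\<bar> \<le> 2 / \<beta>\<^sup>2"
proof -
  let ?x = "\<lambda>s. \<beta> / 2 * (real s + 1)"
  have eq: "real K * ln (\<beta> / 2) + ln (fact K) - harm K / \<beta> = (\<Sum>s<K. ln (?x s) - 1 / (2 * ?x s))"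
  proof -
    have "ln (?x s) - 1 / (2 * ?x s) = ln (\<beta> / 2) + ln (real s + 1) - 1 / (real s + 1) / \<beta>" for s
    proof -
      have "ln (?x s) = ln (\<beta> / 2) + ln (real s + 1)" using \<beta> by (intro ln_mult_pos) auto
      moreover have "1 / (2 * ?x s) = 1 / (real s + 1) / \<beta>" by (simp add: mult.commute)
      ultimately show ?thesis by (simp only:)
    qed
    then show ?thesis by (simp add: sum.distrib sum_subtractf ln_fact_sum harm_sum sum_divide_distrib)
  qed
  have bnd: "\<bar>Digamma (?x s) - (ln (?x s) - 1 / (2 * ?x s))\<bar> \<le> 1 / \<beta>\<^sup>2 * (1 / (real s + 1)\<^sup>2)" for s
  proof -
    have "?x s > 0" using \<beta> by simp
    from digamma_bounds[OF this] have "\<bar>Digamma (?x s) - (ln (?x s) - 1 / (2 * ?x s))\<bar> \<le> 1 / (4 * (?x s)\<^sup>2)"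
      by (simp only: atLeastAtMost_iff abs_le_iff) linarith
    also have "1 / (4 * (?x s)\<^sup>2) = 1 / \<beta>\<^sup>2 * (1 / (real s + 1)\<^sup>2)"
      by (simp add: power_mult_distrib power_divide)
    finally show ?thesis .
  qed
  have "\<bar>digamma_sum \<beta> K - (real K * ln (\<beta> / 2) + ln (fact K) - harm K / \<beta>)\<bar> =
      \<bar>\<Sum>s<K. Digamma (?x s) - (ln (?x s) - 1 / (2 * ?x s))\<bar>"
    unfolding eq digamma_sum_def by (simp add: sum_subtractf)
  also have "\<dots> \<le> (\<Sum>s<K. 1 / \<beta>\<^sup>2 * (1 / (real s + 1)\<^sup>2))"
    by (intro order_trans[OF sum_abs] sum_mono bnd)
  also have "\<dots> = 1 / \<beta>\<^sup>2 * (\<Sum>s<K. 1 / (real s + 1)\<^sup>2)" by (simp only: sum_distrib_left)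
  also have "\<dots> \<le> 1 / \<beta>\<^sup>2 * 2" by (intro mult_left_mono sum_inverse_squares_le) auto
  finally show ?thesis by simp
qed

lemma trigamma_sum_bounds:
  assumes \<beta>: "\<beta> > 0"
  shows "\<bar>trigamma_sum \<beta> K - 2 / \<beta> * harm K\<bar> \<le> 8 / \<beta>\<^sup>2"
proof -
  let ?x = "\<lambda>s. \<beta> / 2 * (real s + 1)"
  have eq: "2 / \<beta> * harm K = (\<Sum>s<K. 1 / ?x s)"
    by (simp add: harm_sum sum_distrib_left)
  have bnd: "\<bar>Polygamma 1 (?x s) - 1 / ?x s\<bar> \<le> 4 / \<beta>\<^sup>2 * (1 / (real s + 1)\<^sup>2)" for s
  proof -
    have "?x s > 0" using \<beta> by simp
    from trigamma_bounds[OF this] have "\<bar>Polygamma 1 (?x s) - 1 / ?x s\<bar> \<le> 1 / (?x s)\<^sup>2"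
      by (simp only: abs_le_iff) linarith
    also have "1 / (?x s)\<^sup>2 = 4 / \<beta>\<^sup>2 * (1 / (real s + 1)\<^sup>2)"
      by (simp add: power_mult_distrib power_divide)
    finally show ?thesis .
  qed
  have "\<bar>trigamma_sum \<beta> K - 2 / \<beta> * harm K\<bar> = \<bar>\<Sum>s<K. Polygamma 1 (?x s) - 1 / ?x s\<bar>"
    unfolding eq trigamma_sum_def by (simp only: sum_subtractf)
  also have "\<dots> \<le> (\<Sum>s<K. 4 / \<beta>\<^sup>2 * (1 / (real s + 1)\<^sup>2))"
    by (intro order_trans[OF sum_abs] sum_mono bnd)
  also have "\<dots> = 4 / \<beta>\<^sup>2 * (\<Sum>s<K. 1 / (real s + 1)\<^sup>2)" by (simp only: sum_distrib_left)
  also have "\<dots> \<le> 4 / \<beta>\<^sup>2 * 2" by (intro mult_left_mono sum_inverse_squares_le) auto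
  finally show ?thesis by simp
qed

text \<open>
  The constant in the error term of \<open>gamma_ratio_expansion\<close>.
\<close>

definition cubic_error :: "real \<Rightarrow> real" where
  "cubic_error x = 1 / x\<^sup>2 + 1 / x ^ 3"

lemma cubic_error_mono: "0 < x \<Longrightarrow> x \<le> y \<Longrightarrow> cubic_error y \<le> cubic_error x"
  unfolding cubic_error_def by (intro add_mono divide_left_mono power_mono) auto

lemma sum_cubic_error_le:
  assumes \<beta>: "\<beta> > 0"
  shows "(\<Sum>s<K. cubic_error (\<beta> / 2 * (real s + 1))) \<le> 8 / \<beta>\<^sup>2 + 16 / \<beta> ^ 3"
proof -
  have "cubic_error (\<beta> / 2 * (real s + 1)) \<le> (4 / \<beta>\<^sup>2 + 8 / \<beta> ^ 3) * (1 / (real s + 1)\<^sup>2)" for s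
  proof -
    have "1 / (real s + 1) ^ 3 \<le> 1 / (real s + 1) ^ 2"
      by (intro divide_left_mono power_increasing) auto
    then have "8 / \<beta> ^ 3 * (1 / (real s + 1) ^ 3) \<le> 8 / \<beta> ^ 3 * (1 / (real s + 1) ^ 2)"
      using \<beta> by (intro mult_left_mono) auto
    moreover have "cubic_error (\<beta> / 2 * (real s + 1)) = 4 / \<beta>\<^sup>2 * (1 / (real s + 1)\<^sup>2) + 8 / \<beta> ^ 3 * (1 / (real s + 1) ^ 3)"
      unfolding cubic_error_def power_mult_distrib power_divide by simp
    ultimately show ?thesis by (simp only: distrib_right)
  qed
  then have "(\<Sum>s<K. cubic_error (\<beta> / 2 * (real s + 1))) \<le> (\<Sum>s<K. (4 / \<beta>\<^sup>2 + 8 / \<beta> ^ 3) * (1 / (real s + 1)\<^sup>2))"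
    by (intro sum_mono)
  also have "\<dots> = (4 / \<beta>\<^sup>2 + 8 / \<beta> ^ 3) * (\<Sum>s<K. 1 / (real s + 1)\<^sup>2)" by (simp only: sum_distrib_left)
  also have "\<dots> \<le> (4 / \<beta>\<^sup>2 + 8 / \<beta> ^ 3) * 2"
    using \<beta> by (intro mult_left_mono sum_inverse_squares_le) auto
  finally show ?thesis by simp
qed

lemma prod_gamma_ratio_expansion:
  assumes S: "finite S" and x: "\<And>s. s \<in> S \<Longrightarrow> x s > 0"
  shows "\<exists>e. norm e \<le> \<bar>t\<bar> ^ 3 * (\<Sum>s\<in>S. cubic_error (x s)) \<and>
     (\<Prod>s\<in>S. gamma_ratio (x s) t) =
       exp (\<i> * of_real (t * (\<Sum>s\<in>S. Digamma (x s))) - of_real (t\<^sup>2 / 2 * (\<Sum>s\<in>S. Polygamma 1 (x s))) + e)"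
proof -
  have "\<forall>s\<in>S. \<exists>e. norm e \<le> \<bar>t\<bar> ^ 3 * cubic_error (x s) \<and>
     gamma_ratio (x s) t = exp (\<i> * of_real (t * Digamma (x s)) - of_real (t\<^sup>2 / 2 * Polygamma 1 (x s)) + e)"
    using gamma_ratio_expansion[OF x] unfolding cubic_error_def by blast
  then obtain e where e: "\<And>s. s \<in> S \<Longrightarrow> norm (e s) \<le> \<bar>t\<bar> ^ 3 * cubic_error (x s)"
    "\<And>s. s \<in> S \<Longrightarrow> gamma_ratio (x s) t = exp (\<i> * of_real (t * Digamma (x s)) - of_real (t\<^sup>2 / 2 * Polygamma 1 (x s)) + e s)"
    by metis
  have "norm (\<Sum>s\<in>S. e s) \<le> \<bar>t\<bar> ^ 3 * (\<Sum>s\<in>S. cubic_error (x s))"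
    unfolding sum_distrib_left by (intro order_trans[OF norm_sum] sum_mono e)
  moreover have "(\<Prod>s\<in>S. gamma_ratio (x s) t) = exp (\<Sum>s\<in>S. \<i> * of_real (t * Digamma (x s)) - of_real (t\<^sup>2 / 2 * Polygamma 1 (x s)) + e s)"
    unfolding exp_sum[OF S] by (intro prod.cong refl e(2))
  moreover have "(\<Sum>s\<in>S. \<i> * of_real (t * Digamma (x s)) - of_real (t\<^sup>2 / 2 * Polygamma 1 (x s)) + e s) =
      \<i> * of_real (t * (\<Sum>s\<in>S. Digamma (x s))) - of_real (t\<^sup>2 / 2 * (\<Sum>s\<in>S. Polygamma 1 (x s))) + (\<Sum>s\<in>S. e s)"
    by (simp only: sum.distrib sum_subtractf sum_distrib_left of_real_sum)
  ultimately show ?thesis by (intro exI[of _ "\<Sum>s\<in>S. e s"]) simp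
qed

text \<open>
  Exponents subtract under division, whereas the bounds on the errors add up.
\<close>

lemma gamma_ratio_quotient_expansion:
  fixes K L :: nat
  assumes num: "\<And>s. s < K \<Longrightarrow> num s > 0" and den: "\<And>s. s < L \<Longrightarrow> den s > 0"
  shows "\<exists>e. norm e \<le> \<bar>t\<bar> ^ 3 * ((\<Sum>s<K. cubic_error (num s)) + (\<Sum>s<L. cubic_error (den s))) \<and>
     iexp (t * ln C) * (\<Prod>s<K. gamma_ratio (num s) t) / (\<Prod>s<L. gamma_ratio (den s) t) =
       exp (\<i> * of_real (t * (ln C + (\<Sum>s<K. Digamma (num s)) - (\<Sum>s<L. Digamma (den s))))
         - of_real (t\<^sup>2 / 2 * ((\<Sum>s<K. Polygamma 1 (num s)) - (\<Sum>s<L. Polygamma 1 (den s)))) + e)"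
proof -
  have pos: "\<And>s. s \<in> {..<K} \<Longrightarrow> num s > 0" "\<And>s. s \<in> {..<L} \<Longrightarrow> den s > 0" using num den by auto
  obtain e where e: "norm e \<le> \<bar>t\<bar> ^ 3 * (\<Sum>s<K. cubic_error (num s))"
    "(\<Prod>s<K. gamma_ratio (num s) t) = exp (\<i> * of_real (t * (\<Sum>s<K. Digamma (num s))) - of_real (t\<^sup>2 / 2 * (\<Sum>s<K. Polygamma 1 (num s))) + e)"
    using prod_gamma_ratio_expansion[of "{..<K}" num t] pos(1) finite_lessThan[of K] by blast
  obtain e' where e': "norm e' \<le> \<bar>t\<bar> ^ 3 * (\<Sum>s<L. cubic_error (den s))"
    "(\<Prod>s<L. gamma_ratio (den s) t) = exp (\<i> * of_real (t * (\<Sum>s<L. Digamma (den s))) - of_real (t\<^sup>2 / 2 * (\<Sum>s<L. Polygamma 1 (den s))) + e')"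
    using prod_gamma_ratio_expansion[of "{..<L}" den t] pos(2) finite_lessThan[of L] by blast
  have "norm (e - e') \<le> \<bar>t\<bar> ^ 3 * ((\<Sum>s<K. cubic_error (num s)) + (\<Sum>s<L. cubic_error (den s)))"
    using norm_triangle_ineq4[of e e'] e(1) e'(1) by (simp add: distrib_left)
  moreover have "iexp (t * c) * exp (\<i> * of_real (t * x) - of_real (t\<^sup>2 / 2 * y) + e) / exp (\<i> * of_real (t * x') - of_real (t\<^sup>2 / 2 * y') + e')
      = exp (\<i> * of_real (t * (c + x - x')) - of_real (t\<^sup>2 / 2 * (y - y')) + (e - e'))" for c x y x' y'
    unfolding exp_add[symmetric] exp_diff[symmetric] by (rule arg_cong[of _ _ exp]) (simp add: field_simps)
  ultimately show ?thesis unfolding e(2) e'(2) by blast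
qed

text \<open>
  When the denominators are too large to spoil the decay of the numerators: none of the ratios is
  increased beyond \<open>1\<close>, and the first \<open>K'\<close> of them satisfy the hypotheses of
  \<open>norm_gamma_ratio_decay\<close>. The first disjunct is the case without denominators.
\<close>

definition dominating_shifts :: "real \<Rightarrow> nat \<Rightarrow> nat \<Rightarrow> nat \<Rightarrow> (nat \<Rightarrow> real) \<Rightarrow> bool" where
  "dominating_shifts \<beta> K K' L den \<longleftrightarrow>
     L = 0 \<or> L = K \<and> (\<forall>s<K. \<beta> / 2 * (real s + 1) \<le> den s) \<and>
       (\<forall>s<K'. 2 * (\<beta> / 2 * (real s + 1)) \<le> den s \<and> \<beta> / 2 * (real s + 1) + 1 \<le> den s)"

text \<open>
  Only the first \<open>K'\<close> ratios are used; \<open>norm_gamma_ratio_decay\<close> bounds them by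
  \<open>1 / sqrt (1 + c / (s + 1))\<close> with \<open>c = t\<^sup>2 / (2 * \<beta>)\<close>, and \<open>prod_one_plus_harmonic_ge\<close> together with
  \<open>harm K' \<ge> ln n / 2\<close> turns the product into the stated bound.
\<close>

lemma gamma_ratio_quotient_decay:
  assumes \<beta>: "\<beta> > 0" and K': "K' \<le> K" "harm K' \<ge> (2::real)" "ln (real n) \<le> 2 * ln (real K')" "K' \<ge> 1"
    and L: "dominating_shifts \<beta> K K' L den"
  shows "norm (iexp (t * c) * (\<Prod>s<K. gamma_ratio (\<beta> / 2 * (real s + 1)) t) / (\<Prod>s<L. gamma_ratio (den s) t))
     \<le> 1 / (1 + 1 / 16 * (2 * ln (real n) / \<beta> * t\<^sup>2))"
proof -
  let ?x = "\<lambda>s. \<beta> / 2 * (real s + 1)"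
  note L = L[unfolded dominating_shifts_def]
  \<comment> \<open>pair each numerator with its denominator, or with \<open>1\<close> if there are none\<close>
  define d where "d = (\<lambda>s. if L = 0 then 1 else norm (gamma_ratio (den s) t))"
  define r where "r = (\<lambda>s. norm (gamma_ratio (?x s) t) / d s)"
  have x: "?x s > 0" for s using \<beta> by simp
  have d: "d s > 0" if "s < K" for s
  proof (cases "L = 0")
    case False
    then have "?x s \<le> den s" using L that by auto
    then have "den s > 0" using x[of s] by linarith
    then show ?thesis using False by (simp add: d_def)
  qed (simp add: d_def)
  have r1: "r s \<le> 1" "r s \<ge> 0" if "s < K" for s
  proof -
    have "norm (gamma_ratio (?x s) t) \<le> d s"
      unfolding d_def using L that x[of s] by (auto intro!: norm_gamma_ratio_le_1 norm_gamma_ratio_mono)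
    then show "r s \<le> 1" "r s \<ge> 0" using d[OF that] by (auto simp: r_def)
  qed
  have r2: "r s \<le> 1 / sqrt (1 + t\<^sup>2 / (2 * \<beta>) / (real s + 1))" if "s < K'" for s
  proof -
    have eq: "t\<^sup>2 / (4 * ?x s) = t\<^sup>2 / (2 * \<beta>) / (real s + 1)" by simp
    have pos: "sqrt (1 + t\<^sup>2 / (4 * ?x s)) > 0" using x[of s] by (intro real_sqrt_gt_zero add_pos_nonneg) auto
    have "norm (gamma_ratio (?x s) t) \<le> d s / sqrt (1 + t\<^sup>2 / (4 * ?x s))"
    proof (cases "L = 0")
      case True
      \<comment> \<open>without denominators any parameter that is large enough can play the role of \<open>\<eta>\<close>\<close>
      have "norm (gamma_ratio (?x s) t) \<le> norm (gamma_ratio (2 * ?x s + 1) t) / sqrt (1 + t\<^sup>2 / (4 * ?x s))"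
        using x[of s] by (intro norm_gamma_ratio_decay) auto
      also have "\<dots> \<le> 1 / sqrt (1 + t\<^sup>2 / (4 * ?x s))"
        using x[of s] pos by (intro divide_right_mono norm_gamma_ratio_le_1) auto
      finally show ?thesis using True by (simp add: d_def)
    next
      case False
      then have "2 * ?x s \<le> den s \<and> ?x s + 1 \<le> den s" using L that by blast
      then show ?thesis unfolding d_def if_not_P[OF False] by (intro norm_gamma_ratio_decay x) auto
    qed
    then show ?thesis using d[of s] that K'(1) unfolding eq r_def by (simp add: field_simps)
  qed
  have "norm (iexp (t * c) * (\<Prod>s<K. gamma_ratio (?x s) t) / (\<Prod>s<L. gamma_ratio (den s) t)) = (\<Prod>s<K. r s)"
  proof -
    have "(\<Prod>s<L. norm (gamma_ratio (den s) t)) = (\<Prod>s<K. d s)"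
      using L by (cases "L = 0") (auto simp: d_def)
    then show ?thesis by (simp add: norm_mult norm_divide prod_norm[symmetric] r_def prod_dividef)
  qed
  also have "\<dots> = (\<Prod>s<K'. r s) * (\<Prod>s\<in>{K'..<K}. r s)"
    using K'(1) by (subst prod.union_disjoint[symmetric]) (auto intro!: prod.cong)
  also have "\<dots> \<le> (\<Prod>s<K'. r s) * 1"
    using K'(1) r1 by (intro mult_left_mono prod_le_1 prod_nonneg) auto
  also have "\<dots> \<le> (\<Prod>s<K'. 1 / sqrt (1 + t\<^sup>2 / (2 * \<beta>) / (real s + 1)))"
    unfolding mult_1_right using K'(1) r1 r2 by (intro prod_mono) auto
  also have "\<dots> = 1 / sqrt (\<Prod>s<K'. 1 + t\<^sup>2 / (2 * \<beta>) / (real s + 1))"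
    by (induction K') (simp_all add: real_sqrt_mult)
  also have "\<dots> \<le> 1 / (1 + t\<^sup>2 / (2 * \<beta>) * harm K' / 2)"
  proof -
    have "(1 + t\<^sup>2 / (2 * \<beta>) * harm K' / 2)\<^sup>2 \<le> (\<Prod>s<K'. 1 + t\<^sup>2 / (2 * \<beta>) / (real s + 1))"
      using \<beta> K'(2) by (intro prod_one_plus_harmonic_ge) auto
    then have "1 + t\<^sup>2 / (2 * \<beta>) * harm K' / 2 \<le> sqrt (\<Prod>s<K'. 1 + t\<^sup>2 / (2 * \<beta>) / (real s + 1))"
      by (rule real_le_rsqrt)
    moreover have "1 + t\<^sup>2 / (2 * \<beta>) * harm K' / 2 > 0"
      using \<beta> K'(2) by (intro add_pos_nonneg) auto
    ultimately show ?thesis by (intro divide_left_mono mult_pos_pos) linarith+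
  qed
  also have "\<dots> \<le> 1 / (1 + 1 / 16 * (2 * ln (real n) / \<beta> * t\<^sup>2))"
  proof (cases "ln (real n) \<ge> 0")
    case True
    have "ln (real n) / 2 \<le> harm K'"
    proof -
      have "ln (real K') \<le> ln (real K' + 1)" using K'(4) by simp
      then show ?thesis using K'(3) ln_le_harm[of K'] by linarith
    qed
    then have "t\<^sup>2 / (2 * \<beta>) * (ln (real n) / 2) / 2 \<le> t\<^sup>2 / (2 * \<beta>) * harm K' / 2"
      using \<beta> by (intro divide_right_mono mult_left_mono) auto
    moreover have "t\<^sup>2 / (2 * \<beta>) * (ln (real n) / 2) / 2 = 1 / 16 * (2 * ln (real n) / \<beta> * t\<^sup>2)" by simp
    moreover have "1 / 16 * (2 * ln (real n) / \<beta> * t\<^sup>2) \<ge> 0" using True \<beta> by simp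
    ultimately show ?thesis by (intro divide_left_mono mult_pos_pos) linarith+
  next
    case False
    then show ?thesis by (cases n) auto
  qed
  finally show ?thesis .
qed

section \<open>A local limit theorem from characteristic functions\<close>
text \<open>
  The Fourier transform of the indicator function of \<open>(a, b)\<close>. At \<open>t = 0\<close>, where its true value is
  \<open>b - a\<close>, it is \<open>0\<close> by division by zero.
\<close>

definition levy_kernel :: "real \<Rightarrow> real \<Rightarrow> real \<Rightarrow> complex" where
  "levy_kernel a b t = (iexp (- (t * a)) - iexp (- (t * b))) / (\<i> * of_real t)"

lemma levy_kernel_measurable [measurable]: "levy_kernel a b \<in> borel_measurable borel"
  unfolding levy_kernel_def by measurable

lemma norm_levy_kernel_le:
  assumes "a \<le> b" shows "norm (levy_kernel a b t) \<le> b - a"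
proof (cases "t = 0")
  case False
  then show ?thesis using Levy_Inversion_aux2[of "- b" "- a" t] assms by (simp add: levy_kernel_def)
qed (use assms in \<open>simp add: levy_kernel_def\<close>)

lemma levy_kernel_scale: "w > 0 \<Longrightarrow> levy_kernel (w * a) (w * b) t = of_real w * levy_kernel a b (t * w)"
proof -
  assume w: "w > 0"
  have eq: "X / (\<i> * of_real t) = of_real w * (X / (\<i> * of_real (t * w)))" for X :: complex
    using w by simp
  show ?thesis unfolding levy_kernel_def by (subst eq) (simp add: mult_ac)
qed

context real_distribution begin

text \<open>
  If the characteristic function is integrable, the truncated integrals of Levy's inversion formula
  converge by dominated convergence.
\<close>

lemma interval_probability_eq_aux:
  assumes int: "integrable lborel (char M)" and ab: "a \<le> b" "measure M {a} = 0" "measure M {b} = 0"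
  shows "of_real (measure M {a<..b}) = 1 / (2 * pi) * (\<integral>t. levy_kernel a b t * char M t \<partial>lborel)"
proof -
  have [measurable]: "char M \<in> borel_measurable borel" using int by auto
  let ?f = "\<lambda>t. levy_kernel a b t * char M t"
  have dom: "integrable lborel (\<lambda>t. (b - a) * norm (char M t))" using int by auto
  have "(\<lambda>n. \<integral>t. indicator {- real n<..<real n} t *\<^sub>R ?f t \<partial>lborel) \<longlonglongrightarrow> (\<integral>t. ?f t \<partial>lborel)"
  proof (rule integral_dominated_convergence[OF _ _ dom])
    show "AE t in lborel. (\<lambda>n. indicator {- real n<..<real n} t *\<^sub>R ?f t) \<longlonglongrightarrow> ?f t"
    proof (rule AE_I2)
      fix t :: real
      have "\<forall>\<^sub>F n in sequentially. \<bar>t\<bar> < real n"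
        using filterlim_real_sequentially by (rule filterlim_at_top_dense[THEN iffD1, rule_format])
      then have "\<forall>\<^sub>F n in sequentially. ?f t = indicator {- real n<..<real n} t *\<^sub>R ?f t"
        by eventually_elim (auto simp: indicator_def)
      then show "(\<lambda>n. indicator {- real n<..<real n} t *\<^sub>R ?f t) \<longlonglongrightarrow> ?f t"
        by (rule Lim_transform_eventually[OF tendsto_const])
    qed
    show "AE t in lborel. norm (indicator {- real n<..<real n} t *\<^sub>R ?f t) \<le> (b - a) * norm (char M t)" for n
      using norm_levy_kernel_le[OF ab(1)] ab(1)
      by (intro AE_I2) (auto simp: indicator_def norm_mult intro!: mult_right_mono)
  qed measurable
  moreover have "(\<integral>t. indicator {- real n<..<real n} t *\<^sub>R ?f t \<partial>lborel) = (CLBINT t=- real n..real n. ?f t)" for n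
    by (simp add: interval_lebesgue_integral_def set_lebesgue_integral_def)
  ultimately have "(\<lambda>n. 1 / (2 * pi) * (CLBINT t=- real n..real n. ?f t)) \<longlonglongrightarrow> 1 / (2 * pi) * (\<integral>t. ?f t \<partial>lborel)"
    by (intro tendsto_mult tendsto_const) simp
  moreover have "(\<lambda>n. 1 / (2 * pi) * (CLBINT t=- real n..real n. ?f t)) \<longlonglongrightarrow> of_real (measure M {a<..b})"
    using Levy_Inversion[OF ab] unfolding levy_kernel_def by simp
  ultimately show ?thesis by (rule LIMSEQ_unique[rotated])
qed

text \<open>
  There are only countably many atoms, so \<open>x\<close> lies in arbitrarily short intervals with endpoints that
  are not atoms, and the inversion formula bounds their probability by a constant times their length.
\<close>

lemma no_atoms_of_integrable_char:
  assumes int: "integrable lborel (char M)"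
  shows "measure M {x} = 0"
proof -
  define c where "c = (1 / (2 * pi)) * (\<integral>t. norm (char M t) \<partial>lborel)"
  have c: "c \<ge> 0" unfolding c_def by (intro mult_nonneg_nonneg integral_nonneg_AE) auto
  have "measure M {x} \<le> 2 * c * e" if e: "e > 0" for e
  proof -
    have nonatom: "\<exists>y\<in>{u<..<v}. measure M {y} = 0" if "u < v" for u v :: real
    proof (rule ccontr)
      assume "\<not> ?thesis"
      then have "{u<..<v} \<subseteq> {x. measure M {x} > 0}" by (auto simp: zero_less_measure_iff measure_nonneg order.strict_iff_order)
      then have "countable {u<..<v}" using countable_atoms countable_subset by blast
      then show False using uncountable_open_interval[of u v] that by simp
    qed
    obtain a where a: "x - e < a" "a < x" "measure M {a} = 0" using nonatom[of "x - e" x] e by auto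
    obtain b where b: "x < b" "b < x + e" "measure M {b} = 0" using nonatom[of x "x + e"] e by auto
    have ab: "a \<le> b" using a b by simp
    have "measure M {x} \<le> measure M {a<..b}" using a b by (intro finite_measure_mono) auto
    also have "\<dots> = norm (of_real (measure M {a<..b}) :: complex)" by simp
    also have "\<dots> = 1 / (2 * pi) * norm (\<integral>t. levy_kernel a b t * char M t \<partial>lborel)"
      unfolding interval_probability_eq_aux[OF int ab a(3) b(3)] by (simp add: norm_mult norm_divide)
    also have "\<dots> \<le> 1 / (2 * pi) * (\<integral>t. (b - a) * norm (char M t) \<partial>lborel)"
    proof (rule mult_left_mono)
      have [measurable]: "char M \<in> borel_measurable borel" using int by auto
      have 2: "integrable lborel (\<lambda>t. (b - a) * norm (char M t))" using int by auto
      have 3: "norm (levy_kernel a b t * char M t) \<le> (b - a) * norm (char M t)" for t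
        unfolding norm_mult by (intro mult_right_mono norm_levy_kernel_le ab) auto
      have "integrable lborel (\<lambda>t. levy_kernel a b t * char M t)"
        by (rule Bochner_Integration.integrable_bound[OF 2]) (use 3 ab in \<open>auto simp: abs_mult\<close>)
      then show "norm (\<integral>t. levy_kernel a b t * char M t \<partial>lborel) \<le> (\<integral>t. (b - a) * norm (char M t) \<partial>lborel)"
        using 2 3 by (intro order_trans[OF integral_norm_bound] integral_mono integrable_norm)
    qed simp
    also have "1 / (2 * pi) * (\<integral>t. (b - a) * norm (char M t) \<partial>lborel) = (b - a) * c" by (simp add: c_def)
    also have "\<dots> \<le> (2 * e) * c" using a b c by (intro mult_right_mono) auto
    finally show ?thesis by (simp add: mult_ac)
  qed
  note le = this
  have "((\<lambda>e. 2 * c * e) \<longlongrightarrow> 2 * c * 0) (at_right 0)" by (intro tendsto_intros)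
  then have "measure M {x} \<le> 2 * c * 0"
    by (rule tendsto_lowerbound) (auto intro!: eventually_at_right_less[THEN eventually_mono] le)
  then show ?thesis using measure_nonneg[of M "{x}"] by simp
qed

lemma interval_probability_eq:
  assumes int: "integrable lborel (char M)" and ab: "a < b"
  shows "of_real (measure M {a<..<b}) = 1 / (2 * pi) * (\<integral>t. levy_kernel a b t * char M t \<partial>lborel)"
proof -
  note z = no_atoms_of_integrable_char[OF int]
  have "{a<..b} = {a<..<b} \<union> {b}" using ab by auto
  moreover have "measure M ({a<..<b} \<union> {b}) = measure M {a<..<b} + measure M {b}"
    by (rule finite_measure_Union) auto
  ultimately have "measure M {a<..b} = measure M {a<..<b} + measure M {b}" by (simp only:)
  then show ?thesis using interval_probability_eq_aux[OF int _ z z, of a b] ab z by simp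
qed

end

lemma integrable_inverse_1_plus_scaled_square:
  assumes "\<kappa> > 0" shows "integrable lborel (\<lambda>u::real. 1 / (1 + \<kappa> * u\<^sup>2))"
proof -
  have "integrable lborel (\<lambda>x::real. inverse (1 + x\<^sup>2))"
    using integrable_inverse_1_plus_square by (simp add: set_integrable_def)
  then have "integrable lborel (\<lambda>x. inverse (1 + (0 + sqrt \<kappa> * x)\<^sup>2))"
    using assms by (intro lborel_integrable_real_affine) auto
  then show ?thesis using assms by (simp add: power_mult_distrib inverse_eq_divide)
qed

text \<open>
  After the substitution \<open>t = u / sqrt (v n)\<close> the scaled probability becomes \<open>1 / (2 \<pi>)\<close> times
  the integral of \<open>levy_kernel a b (\<theta> n * u) * char (\<mu> n) (u / sqrt (v n))\<close> with
  \<open>\<theta> n = v n powr (- \<delta> - 1 / 2)\<close>. Because \<open>\<theta> n\<close> tends to \<open>0\<close>, the kernel tends to \<open>b - a\<close>, and the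
  integral of the limit is that of the Gaussian.
\<close>

theorem local_limit_from_char:
  fixes \<mu> :: "nat \<Rightarrow> real measure" and v :: "nat \<Rightarrow> real"
  assumes \<kappa>: "\<kappa> > 0" and ab: "a < b" and \<delta>: "\<delta> > - 1 / 2"
    and v: "filterlim v at_top sequentially"
    and dist: "\<forall>\<^sub>F n in sequentially. real_distribution (\<mu> n)"
    and lim: "\<And>u. (\<lambda>n. char (\<mu> n) (u / sqrt (v n))) \<longlonglongrightarrow> of_real (exp (- u\<^sup>2 / 2))"
    and bound: "\<forall>\<^sub>F n in sequentially. \<forall>t. norm (char (\<mu> n) t) \<le> 1 / (1 + \<kappa> * (v n * t\<^sup>2))"
  shows "(\<lambda>n. v n powr (\<delta> + 1 / 2) * measure (\<mu> n) {v n powr (- \<delta>) * a<..<v n powr (- \<delta>) * b})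
           \<longlonglongrightarrow> (b - a) / sqrt (2 * pi)"
proof -
  define \<theta> where "\<theta> = (\<lambda>n. v n powr (- \<delta> - 1 / 2))"
  have vpos: "\<forall>\<^sub>F n in sequentially. v n > 0" using v by (simp add: filterlim_at_top_dense)
  have \<theta>0: "\<theta> \<longlonglongrightarrow> 0" unfolding \<theta>_def using \<delta> by (intro tendsto_neg_powr v) auto
  have good: "\<forall>\<^sub>F n in sequentially. v n > 0 \<and> real_distribution (\<mu> n) \<and> (\<forall>t. norm (char (\<mu> n) t) \<le> 1 / (1 + \<kappa> * (v n * t\<^sup>2)))"
    using vpos dist bound by eventually_elim auto
  let ?g = "\<lambda>n u. levy_kernel a b (\<theta> n * u) * char (\<mu> n) (u / sqrt (v n))"
  have charm: "char (\<mu> n) \<in> borel_measurable borel" if "real_distribution (\<mu> n)" for n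
    using real_distribution.char_measurable[OF that] .
  have charb: "norm (char (\<mu> n) (u / sqrt (v n))) \<le> 1 / (1 + \<kappa> * u\<^sup>2)"
    if "v n > 0" "\<forall>t. norm (char (\<mu> n) t) \<le> 1 / (1 + \<kappa> * (v n * t\<^sup>2))" for n u
    using that(2)[rule_format, of "u / sqrt (v n)"] that(1) by (simp add: power_divide)
  have formula: "of_real (v n powr (\<delta> + 1 / 2) * measure (\<mu> n) {v n powr (- \<delta>) * a<..<v n powr (- \<delta>) * b}) =
      1 / (2 * pi) * (\<integral>u. ?g n u \<partial>lborel)"
    if n: "v n > 0" "real_distribution (\<mu> n)" "\<forall>t. norm (char (\<mu> n) t) \<le> 1 / (1 + \<kappa> * (v n * t\<^sup>2))" for n
  proof -
    interpret real_distribution "\<mu> n" by fact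
    let ?w = "v n powr (- \<delta>)"
    have w: "?w > 0" using n by simp
    have int: "integrable lborel (char (\<mu> n))"
    proof (rule Bochner_Integration.integrable_bound)
      show "integrable lborel (\<lambda>t. 1 / (1 + (\<kappa> * v n) * t\<^sup>2))"
        using \<kappa> n by (intro integrable_inverse_1_plus_scaled_square) auto
      show "AE t in lborel. norm (char (\<mu> n) t) \<le> norm (1 / (1 + (\<kappa> * v n) * t\<^sup>2))"
      proof (rule AE_I2)
        fix t
        have "1 / (1 + (\<kappa> * v n) * t\<^sup>2) \<ge> 0" using \<kappa> n(1) by simp
        then show "norm (char (\<mu> n) t) \<le> norm (1 / (1 + (\<kappa> * v n) * t\<^sup>2))"
          using n(3)[rule_format, of t] by (simp only: real_norm_def abs_of_nonneg mult.assoc)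
      qed
    qed (use charm[OF n(2)] in auto)
    have "?w * a < ?w * b" using w ab by simp
    note eq = interval_probability_eq[OF int this]
    have sc: "v n powr (\<delta> + 1 / 2) * (1 / sqrt (v n)) * ?w = 1"
    proof -
      have inv_sqrt: "1 / sqrt (v n) = v n powr (- (1 / 2))"
        using n(1) unfolding powr_minus by (simp add: powr_half_sqrt inverse_eq_divide)
      have "v n powr (\<delta> + 1 / 2) * v n powr (- (1 / 2)) * v n powr (- \<delta>) = v n powr (\<delta> + 1 / 2 + - (1 / 2) + - \<delta>)"
        by (simp only: powr_add)
      also have "\<delta> + 1 / 2 + - (1 / 2) + - \<delta> = 0" by simp
      finally show ?thesis using n(1) unfolding inv_sqrt by simp
    qed
    have \<theta>: "\<theta> n = 1 / sqrt (v n) * ?w"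
      using n(1) by (simp add: \<theta>_def powr_diff powr_half_sqrt)
    have "(\<integral>t. levy_kernel (?w * a) (?w * b) t * char (\<mu> n) t \<partial>lborel) =
        of_real (1 / sqrt (v n)) * (\<integral>u. levy_kernel (?w * a) (?w * b) (0 + 1 / sqrt (v n) * u) * char (\<mu> n) (0 + 1 / sqrt (v n) * u) \<partial>lborel)"
      using n(1) by (subst lborel_integral_real_affine[of "1 / sqrt (v n)" _ 0]) (auto simp: scaleR_conv_of_real)
    also have "(\<lambda>u. levy_kernel (?w * a) (?w * b) (0 + 1 / sqrt (v n) * u) * char (\<mu> n) (0 + 1 / sqrt (v n) * u)) =
        (\<lambda>u. of_real ?w * ?g n u)"
      unfolding levy_kernel_scale[OF w] \<theta> by (simp add: mult_ac)
    also have "(\<integral>u. of_real ?w * ?g n u \<partial>lborel) = of_real ?w * (\<integral>u. ?g n u \<partial>lborel)"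
      by simp
    finally have "of_real (v n powr (\<delta> + 1 / 2) * measure (\<mu> n) {?w * a<..<?w * b}) =
        of_real (v n powr (\<delta> + 1 / 2) * (1 / sqrt (v n)) * ?w) * (1 / (2 * pi) * (\<integral>u. ?g n u \<partial>lborel))"
      unfolding of_real_mult eq by (simp add: mult_ac)
    then show ?thesis unfolding sc by simp
  qed
  have "(\<lambda>n. \<integral>u. ?g n u \<partial>lborel) \<longlonglongrightarrow> (\<integral>u. of_real (b - a) * of_real (exp (- u\<^sup>2 / 2)) \<partial>lborel)"
  proof -
    obtain N where N: "\<And>n. n \<ge> N \<Longrightarrow> v n > 0 \<and> real_distribution (\<mu> n) \<and> (\<forall>t. norm (char (\<mu> n) t) \<le> 1 / (1 + \<kappa> * (v n * t\<^sup>2)))"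
      using good unfolding eventually_sequentially by blast
    have "(\<lambda>n. \<integral>u. ?g (n + N) u \<partial>lborel) \<longlonglongrightarrow> (\<integral>u. of_real (b - a) * of_real (exp (- u\<^sup>2 / 2)) \<partial>lborel)"
    proof (rule integral_dominated_convergence)
      show "integrable lborel (\<lambda>u. (b - a) * (1 / (1 + \<kappa> * u\<^sup>2)))"
        by (intro integrable_mult_right integrable_inverse_1_plus_scaled_square \<kappa>)
      show "(\<lambda>u. ?g (n + N) u) \<in> borel_measurable lborel" for n
      proof -
        have [measurable]: "char (\<mu> (n + N)) \<in> borel_measurable borel" using charm N[of "n + N"] by simp
        show ?thesis by measurable
      qed
      show "AE u in lborel. norm (?g (n + N) u) \<le> (b - a) * (1 / (1 + \<kappa> * u\<^sup>2))" for n
        unfolding norm_mult using N[of "n + N"] ab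
        by (intro AE_I2 mult_mono norm_levy_kernel_le charb) auto
      have "(\<lambda>n. ?g (n + N) u) \<longlonglongrightarrow> of_real (b - a) * of_real (exp (- u\<^sup>2 / 2))" if u: "u \<noteq> 0" for u
      proof (rule LIMSEQ_ignore_initial_segment, intro tendsto_mult lim)
        have "filterlim (\<lambda>n. \<theta> n * u) (at 0) sequentially"
        proof (rule filterlim_atI)
          show "(\<lambda>n. \<theta> n * u) \<longlonglongrightarrow> 0" using tendsto_mult_left_zero[OF \<theta>0] .
          show "\<forall>\<^sub>F n in sequentially. \<theta> n * u \<noteq> 0" using vpos by eventually_elim (use u in \<open>simp add: \<theta>_def\<close>)
        qed
        from filterlim_compose[OF Levy_Inversion_aux1[of a b] this] ab
        show "(\<lambda>n. levy_kernel a b (\<theta> n * u)) \<longlonglongrightarrow> of_real (b - a)"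
          by (simp add: levy_kernel_def)
      qed
      then show "AE u in lborel. (\<lambda>n. ?g (n + N) u) \<longlonglongrightarrow> of_real (b - a) * of_real (exp (- u\<^sup>2 / 2))"
        \<comment> \<open>convergence holds outside the null set \<open>{0}\<close>, where the kernel has a default value\<close>
        by (intro AE_I[of _ _ "{0}"]) auto
    qed measurable
    then show ?thesis by (rule LIMSEQ_offset)
  qed
  also have "(\<integral>u. of_real (b - a) * of_real (exp (- u\<^sup>2 / 2)) \<partial>lborel) = of_real ((b - a) * sqrt (2 * pi)) * (1 :: complex)"
  proof -
    have "(\<lambda>u. exp (- u\<^sup>2 / 2)) = (\<lambda>u. sqrt (2 * pi) * normal_density 0 1 u)"
      by (simp add: normal_density_def)
    then have "(\<integral>u. exp (- u\<^sup>2 / 2) \<partial>lborel) = sqrt (2 * pi)" by simp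
    then show ?thesis by simp
  qed
  finally have "(\<lambda>n. 1 / (2 * pi) * (\<integral>u. ?g n u \<partial>lborel)) \<longlonglongrightarrow> complex_of_real (1 / (2 * pi)) * (complex_of_real ((b - a) * sqrt (2 * pi)) * 1)"
    by (intro tendsto_mult tendsto_const)
  also have "complex_of_real (1 / (2 * pi)) * (complex_of_real ((b - a) * sqrt (2 * pi)) * 1) = complex_of_real ((b - a) / sqrt (2 * pi))"
  proof -
    have "sqrt (2 * pi) * sqrt (2 * pi) = 2 * pi" by simp
    then have "1 / (2 * pi) * ((b - a) * sqrt (2 * pi)) = (b - a) / sqrt (2 * pi)"
      by (simp add: divide_simps)
    then show ?thesis unfolding mult_1_right of_real_mult[symmetric] by (simp only:)
  qed
  finally have "(\<lambda>n. complex_of_real (v n powr (\<delta> + 1 / 2) * measure (\<mu> n) {v n powr (- \<delta>) * a<..<v n powr (- \<delta>) * b}))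
      \<longlonglongrightarrow> complex_of_real ((b - a) / sqrt (2 * pi))"
  proof (rule Lim_transform_eventually)
    show "\<forall>\<^sub>F n in sequentially. complex_of_real (1 / (2 * pi)) * (\<integral>u. ?g n u \<partial>lborel) =
        complex_of_real (v n powr (\<delta> + 1 / 2) * measure (\<mu> n) {v n powr (- \<delta>) * a<..<v n powr (- \<delta>) * b})"
      using good by eventually_elim (rule formula[symmetric], auto)
  qed
  then show ?thesis by (simp only: tendsto_of_real_iff)
qed

section \<open>Local limit theorem for variables with a Mellin recursion\<close>
text \<open>
  Means and variances need to match \<open>\<mu>\<close> and \<open>v = 2 ln n / \<beta>\<close> only up to a bounded error \<open>B\<close>: the
  logarithm of the characteristic function of \<open>X n\<close> differs from \<open>- t\<^sup>2 v / 2\<close> by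
  \<open>O(\<bar>t\<bar> + t\<^sup>2 + \<bar>t\<bar>\<^sup>3)\<close>, uniformly in \<open>n\<close>, which tends to \<open>0\<close> at \<open>t = u / sqrt v\<close>. The number \<open>K'\<close>
  counts the ratios that contribute to the decay; \<open>n \<le> K'\<^sup>2\<close> makes \<open>ln K'\<close> comparable to \<open>ln n\<close>.
\<close>

lemma local_limit_from_mellin_recursion:
  fixes P :: "nat \<Rightarrow> 'w measure" and Y X :: "nat \<Rightarrow> 'w \<Rightarrow> real" and den :: "nat \<Rightarrow> nat \<Rightarrow> real"
  assumes \<beta>: "\<beta> > 0" and ab: "a < b" and \<delta>: "\<delta> > - 1 / 2"
    and prob: "\<And>n. n \<ge> 1 \<Longrightarrow> prob_space (P n)"
    and rec: "\<And>n. n \<ge> 1 \<Longrightarrow> mellin_recursion (P n) (Y n) (C n) (K n) (\<lambda>s. \<beta> / 2 * (real s + 1)) (L n) (den n)"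
    and C: "\<And>n. C n > 0"
    and den: "\<forall>\<^sub>F n in sequentially. \<forall>s<L n. den n s > 0"
    and decay: "\<forall>\<^sub>F n in sequentially. \<exists>K'\<le>K n. real n \<le> (real K')\<^sup>2 \<and> dominating_shifts \<beta> (K n) K' (L n) (den n)"
    and mean: "\<forall>\<^sub>F n in sequentially. \<bar>ln (C n) + digamma_sum \<beta> (K n) - (\<Sum>s<L n. Digamma (den n s)) - \<mu> n\<bar> \<le> B"
    and var: "\<forall>\<^sub>F n in sequentially. \<bar>trigamma_sum \<beta> (K n) - (\<Sum>s<L n. Polygamma 1 (den n s)) - 2 * ln (real n) / \<beta>\<bar> \<le> B"
    and err: "\<forall>\<^sub>F n in sequentially. (\<Sum>s<L n. cubic_error (den n s)) \<le> B"
    and X: "\<And>n \<omega>. X n \<omega> = Y n \<omega> - \<mu> n"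
  shows "(\<lambda>n. (2 * ln (real n) / \<beta>) powr (\<delta> + 1 / 2)
            * measure (P n) {\<omega> \<in> space (P n).
                X n \<omega> \<in> {(\<beta> / (2 * ln (real n))) powr \<delta> * a
                         <..< (\<beta> / (2 * ln (real n))) powr \<delta> * b}})
         \<longlonglongrightarrow> (b - a) / sqrt (2 * pi)"
proof -
  define v where "v = (\<lambda>n. 2 * ln (real n) / \<beta>)"
  define \<nu> where "\<nu> = (\<lambda>n. distr (P n) borel (X n))"
  define A where "A = \<bar>B\<bar> + (8 / \<beta>\<^sup>2 + 16 / \<beta> ^ 3)"
  have v_top: "filterlim v at_top sequentially"
    unfolding v_def using \<beta> by real_asymp
  have vpos: "\<forall>\<^sub>F n in sequentially. v n > 0" using v_top by (simp add: filterlim_at_top_dense)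
  have Xm: "X n \<in> borel_measurable (P n)" if "n \<ge> 1" for n
  proof -
    have [measurable]: "Y n \<in> borel_measurable (P n)" using rec[OF that] by (simp add: mellin_recursion_def)
    show ?thesis unfolding X[abs_def] by measurable
  qed
  have rd: "real_distribution (\<nu> n)" if "n \<ge> 1" for n
    unfolding \<nu>_def by (rule prob_space.real_distribution_distr[OF prob[OF that] Xm[OF that]])
  define \<phi> where "\<phi> = (\<lambda>n t. iexp (t * ln (C n)) * (\<Prod>s<K n. gamma_ratio (\<beta> / 2 * (real s + 1)) t) / (\<Prod>s<L n. gamma_ratio (den n s) t))"
  have char: "char (\<nu> n) t = iexp (- (t * \<mu> n)) * \<phi> n t" if n: "n \<ge> 1" "\<forall>s<L n. den n s > 0" for n t
  proof -
    have "char (\<nu> n) t = (\<integral>\<omega>. iexp (t * X n \<omega>) \<partial>P n)"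
      unfolding char_def \<nu>_def using Xm[OF n(1)] by (subst integral_distr) auto
    also have "\<dots> = (\<integral>\<omega>. iexp (- (t * \<mu> n)) * iexp (t * Y n \<omega>) \<partial>P n)"
      unfolding X by (intro Bochner_Integration.integral_cong refl) (simp add: exp_add[symmetric] algebra_simps)
    also have "\<dots> = iexp (- (t * \<mu> n)) * (\<integral>\<omega>. iexp (t * Y n \<omega>) \<partial>P n)" by simp
    also have "(\<integral>\<omega>. iexp (t * Y n \<omega>) \<partial>P n) = \<phi> n t"
      unfolding \<phi>_def using \<beta> n by (intro mellin_recursion_char[OF prob rec C]) auto
    finally show ?thesis .
  qed
  have expansion: "\<forall>\<^sub>F n in sequentially. \<forall>t. \<exists>w. char (\<nu> n) t = exp w \<and>
      norm (w + of_real (t\<^sup>2 * v n / 2)) \<le> A * (\<bar>t\<bar> + t\<^sup>2 + \<bar>t\<bar> ^ 3)"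
    using den mean var err eventually_ge_at_top[of 1]
  proof eventually_elim
    case (elim n)
    show ?case
    proof
      fix t
      define m where "m = ln (C n) + digamma_sum \<beta> (K n) - (\<Sum>s<L n. Digamma (den n s))"
      define s where "s = trigamma_sum \<beta> (K n) - (\<Sum>s<L n. Polygamma 1 (den n s))"
      obtain e where e: "norm e \<le> \<bar>t\<bar> ^ 3 * ((\<Sum>s<K n. cubic_error (\<beta> / 2 * (real s + 1))) + (\<Sum>s<L n. cubic_error (den n s)))"
        "\<phi> n t = exp (\<i> * of_real (t * m) - of_real (t\<^sup>2 / 2 * s) + e)"
        using gamma_ratio_quotient_expansion[of "K n" "\<lambda>s. \<beta> / 2 * (real s + 1)" "L n" "den n" t "C n"] \<beta> elim(1)
        unfolding \<phi>_def m_def s_def digamma_sum_def trigamma_sum_def by auto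
      define w where "w = \<i> * of_real (t * (m - \<mu> n)) - of_real (t\<^sup>2 / 2 * s) + e"
      have "char (\<nu> n) t = exp w"
        unfolding char[OF elim(5) elim(1)] e(2) w_def exp_add[symmetric] by (rule arg_cong[of _ _ exp]) (simp add: algebra_simps)
      moreover have "norm (w + of_real (t\<^sup>2 * v n / 2)) \<le> A * (\<bar>t\<bar> + t\<^sup>2 + \<bar>t\<bar> ^ 3)"
      proof -
        have A: "\<bar>m - \<mu> n\<bar> \<le> A" "\<bar>s - v n\<bar> \<le> A" "A \<ge> 0"
          "(\<Sum>s<K n. cubic_error (\<beta> / 2 * (real s + 1))) + (\<Sum>s<L n. cubic_error (den n s)) \<le> A"
        proof -
          have pos: "8 / \<beta>\<^sup>2 + 16 / \<beta> ^ 3 \<ge> 0" using \<beta> by simp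
          show "\<bar>m - \<mu> n\<bar> \<le> A" "\<bar>s - v n\<bar> \<le> A" "A \<ge> 0"
            using elim pos unfolding m_def s_def v_def A_def by linarith+
          show "(\<Sum>s<K n. cubic_error (\<beta> / 2 * (real s + 1))) + (\<Sum>s<L n. cubic_error (den n s)) \<le> A"
            using elim(4) sum_cubic_error_le[OF \<beta>, of "K n"] unfolding A_def by linarith
        qed
        have "w + of_real (t\<^sup>2 * v n / 2) = \<i> * of_real (t * (m - \<mu> n)) + of_real (t\<^sup>2 / 2 * (v n - s)) + e"
          unfolding w_def by (simp add: field_simps)
        also have "norm \<dots> \<le> \<bar>t * (m - \<mu> n)\<bar> + \<bar>t\<^sup>2 / 2 * (v n - s)\<bar> + norm e"
        proof -
          have "norm (\<i> * of_real x + of_real y + e) \<le> \<bar>x\<bar> + \<bar>y\<bar> + norm e" for x y :: real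
            using norm_triangle_ineq[of "\<i> * of_real x + of_real y" e] norm_triangle_ineq[of "\<i> * of_real x" "of_real y :: complex"]
            by (simp add: norm_mult)
          then show ?thesis by blast
        qed
        also have "\<dots> \<le> \<bar>t\<bar> * A + t\<^sup>2 * A + \<bar>t\<bar> ^ 3 * A"
        proof (intro add_mono)
          show "\<bar>t * (m - \<mu> n)\<bar> \<le> \<bar>t\<bar> * A" unfolding abs_mult using A by (intro mult_left_mono) auto
          have "\<bar>t\<^sup>2 / 2 * (v n - s)\<bar> = t\<^sup>2 / 2 * \<bar>s - v n\<bar>" by (simp add: abs_mult abs_minus_commute)
          also have "\<dots> \<le> t\<^sup>2 * A" using A by (intro mult_mono) auto
          finally show "\<bar>t\<^sup>2 / 2 * (v n - s)\<bar> \<le> t\<^sup>2 * A" .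
          show "norm e \<le> \<bar>t\<bar> ^ 3 * A" using e(1) A(4) by (rule order_trans[OF _ mult_left_mono]) auto
        qed
        finally show ?thesis by (simp add: algebra_simps)
      qed
      ultimately show "\<exists>w. char (\<nu> n) t = exp w \<and> norm (w + of_real (t\<^sup>2 * v n / 2)) \<le> A * (\<bar>t\<bar> + t\<^sup>2 + \<bar>t\<bar> ^ 3)" by blast
    qed
  qed
  have lim: "(\<lambda>n. char (\<nu> n) (u / sqrt (v n))) \<longlonglongrightarrow> of_real (exp (- u\<^sup>2 / 2))" for u
  proof -
    define t where "t = (\<lambda>n. u / sqrt (v n))"
    have t0: "t \<longlonglongrightarrow> 0" unfolding t_def
      by (intro tendsto_divide_0[OF tendsto_const] filterlim_at_top_imp_at_infinity filterlim_compose[OF sqrt_at_top v_top])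
    \<comment> \<open>a choice of logarithms with the expansion above\<close>
    define w where "w = (\<lambda>n. SOME w. char (\<nu> n) (t n) = exp w \<and> norm (w + of_real (u\<^sup>2 / 2)) \<le> A * (\<bar>t n\<bar> + (t n)\<^sup>2 + \<bar>t n\<bar> ^ 3))"
    have w: "\<forall>\<^sub>F n in sequentially. char (\<nu> n) (t n) = exp (w n) \<and> norm (w n + of_real (u\<^sup>2 / 2)) \<le> A * (\<bar>t n\<bar> + (t n)\<^sup>2 + \<bar>t n\<bar> ^ 3)"
      using expansion vpos
    proof eventually_elim
      case (elim n)
      have "(t n)\<^sup>2 * v n / 2 = u\<^sup>2 / 2" using elim(2) by (simp add: t_def power_divide)
      then have "\<exists>w. char (\<nu> n) (t n) = exp w \<and> norm (w + of_real (u\<^sup>2 / 2)) \<le> A * (\<bar>t n\<bar> + (t n)\<^sup>2 + \<bar>t n\<bar> ^ 3)"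
        using elim(1)[rule_format, of "t n"] by simp
      then show ?case unfolding w_def by (rule someI_ex)
    qed
    have "(\<lambda>n. A * (\<bar>t n\<bar> + (t n)\<^sup>2 + \<bar>t n\<bar> ^ 3)) \<longlonglongrightarrow> A * (\<bar>0\<bar> + 0\<^sup>2 + \<bar>0\<bar> ^ 3)"
      by (intro tendsto_intros t0)
    then have b0: "(\<lambda>n. A * (\<bar>t n\<bar> + (t n)\<^sup>2 + \<bar>t n\<bar> ^ 3)) \<longlonglongrightarrow> 0" by simp
    have "(\<lambda>n. w n + of_real (u\<^sup>2 / 2)) \<longlonglongrightarrow> 0"
      by (rule Lim_null_comparison[OF _ b0]) (use w in \<open>auto elim: eventually_mono\<close>)
    then have "(\<lambda>n. exp (w n + of_real (u\<^sup>2 / 2) + of_real (- u\<^sup>2 / 2))) \<longlonglongrightarrow> exp (0 + of_real (- u\<^sup>2 / 2))"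
      by (intro tendsto_intros)
    then have "(\<lambda>n. exp (w n)) \<longlonglongrightarrow> of_real (exp (- u\<^sup>2 / 2))"
      by (simp flip: exp_of_real)
    then have "(\<lambda>n. char (\<nu> n) (t n)) \<longlonglongrightarrow> of_real (exp (- u\<^sup>2 / 2))"
      by (rule Lim_transform_eventually) (use w in \<open>auto elim: eventually_mono\<close>)
    then show ?thesis by (simp add: t_def)
  qed
  have bound: "\<forall>\<^sub>F n in sequentially. \<forall>t. norm (char (\<nu> n) t) \<le> 1 / (1 + 1 / 16 * (v n * t\<^sup>2))"
  proof -
    obtain k0 where k0: "harm k0 \<ge> (2::real)"
      using harm_at_top unfolding filterlim_at_top eventually_sequentially by blast
    show ?thesis
      \<comment> \<open>then \<open>K' > k0\<close>, hence \<open>harm K' \<ge> 2\<close>\<close>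
      using den decay eventually_ge_at_top[of "Suc k0 ^ 2"]
    proof eventually_elim
      case (elim n)
      then obtain K' where K': "K' \<le> K n" "real n \<le> (real K')\<^sup>2"
        "dominating_shifts \<beta> (K n) K' (L n) (den n)"
        by blast
      have n1: "n \<ge> 1" using elim(3) by (rule order_trans[rotated]) simp
      have "real ((Suc k0)\<^sup>2) \<le> (real K')\<^sup>2" using elim(3) K'(2) by (meson of_nat_le_iff order_trans)
      then have "Suc k0 \<le> K'" by (simp only: of_nat_power power2_le_iff_abs_le)
      then have "harm k0 \<le> (harm K' :: real)" "K' \<ge> 1" by (auto intro: harm_mono)
      then have h: "harm K' \<ge> (2::real)" "K' \<ge> 1" using k0 by auto
      have l: "ln (real n) \<le> 2 * ln (real K')"
      proof -
        have "ln (real n) \<le> ln ((real K')\<^sup>2)" using K'(2) n1 by (intro ln_mono) auto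
        then show ?thesis using h(2) by (simp add: ln_realpow)
      qed
      show ?case
      proof
        fix t
        have "norm (char (\<nu> n) t) = norm (\<phi> n t)" unfolding char[OF n1 elim(1)] by (simp add: norm_mult)
        also have "\<dots> \<le> 1 / (1 + 1 / 16 * (v n * t\<^sup>2))"
          unfolding \<phi>_def v_def by (rule gamma_ratio_quotient_decay[OF \<beta> K'(1) h(1) l h(2) K'(3)])
        finally show "norm (char (\<nu> n) t) \<le> 1 / (1 + 1 / 16 * (v n * t\<^sup>2))" .
      qed
    qed
  qed
  have "(\<lambda>n. v n powr (\<delta> + 1 / 2) * measure (\<nu> n) {v n powr (- \<delta>) * a<..<v n powr (- \<delta>) * b}) \<longlonglongrightarrow> (b - a) / sqrt (2 * pi)"
  proof (intro local_limit_from_char[where \<kappa> = "1 / 16"] ab \<delta> v_top lim bound)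
    show "\<forall>\<^sub>F n in sequentially. real_distribution (\<nu> n)"
      using eventually_ge_at_top[of 1] by eventually_elim (rule rd)
  qed simp
  then show ?thesis
  proof (rule Lim_transform_eventually)
    show "\<forall>\<^sub>F n in sequentially. v n powr (\<delta> + 1 / 2) * measure (\<nu> n) {v n powr (- \<delta>) * a<..<v n powr (- \<delta>) * b} =
      (2 * ln (real n) / \<beta>) powr (\<delta> + 1 / 2)
            * measure (P n) {\<omega> \<in> space (P n).
                X n \<omega> \<in> {(\<beta> / (2 * ln (real n))) powr \<delta> * a
                         <..< (\<beta> / (2 * ln (real n))) powr \<delta> * b}}"
      using vpos eventually_ge_at_top[of 1]
    proof eventually_elim
      case (elim n)
      have "\<beta> / (2 * ln (real n)) = inverse (v n)" by (simp add: v_def)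
      then have w: "(\<beta> / (2 * ln (real n))) powr \<delta> = v n powr (- \<delta>)"
        using elim(1) by (simp add: inverse_powr powr_minus)
      have "measure (\<nu> n) {v n powr (- \<delta>) * a<..<v n powr (- \<delta>) * b} =
          measure (P n) (X n -` {v n powr (- \<delta>) * a<..<v n powr (- \<delta>) * b} \<inter> space (P n))"
        unfolding \<nu>_def by (rule measure_distr[OF Xm[OF elim(2)]]) simp
      also have "X n -` {v n powr (- \<delta>) * a<..<v n powr (- \<delta>) * b} \<inter> space (P n) =
          {\<omega> \<in> space (P n). X n \<omega> \<in> {v n powr (- \<delta>) * a<..<v n powr (- \<delta>) * b}}" by auto
      finally show ?case unfolding w by (simp add: v_def)
    qed
  qed
qed

section \<open>Centerings and sizes of the three ensembles\<close>
lemma laguerre_mean: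
  assumes \<beta>: "\<beta> > 0" and n: "n \<ge> 1"
  shows "\<bar>ln (2 ^ n) + digamma_sum \<beta> n - centering Laguerre \<beta> \<tau>1 \<tau>2 n\<bar> \<le> 2 / \<beta>\<^sup>2 + 1 + 1 / \<beta>"
proof -
  let ?n = "real n"
  have l1: "ln (2 ^ n) = ?n * ln 2" by (simp add: ln_realpow)
  have l2: "ln (\<beta> / 2) = ln \<beta> - ln 2" using \<beta> by (simp add: ln_div)
  have l3: "ln (\<beta> * ?n) = ln \<beta> + ln ?n" using \<beta> n by (simp add: ln_mult)
  have h: "\<bar>harm n / \<beta> - ln ?n / \<beta>\<bar> \<le> 1 / \<beta>"
    unfolding diff_divide_distrib[symmetric] using harm_ln_bounds[OF n] \<beta> by (simp add: divide_right_mono)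
  have "ln (2 ^ n) + digamma_sum \<beta> n - centering Laguerre \<beta> \<tau>1 \<tau>2 n =
      (digamma_sum \<beta> n - (?n * ln (\<beta> / 2) + ln (fact n) - harm n / \<beta>))
      + (ln (fact n) - ((?n + 1 / 2) * ln ?n - ?n)) - (harm n / \<beta> - ln ?n / \<beta>)"
    unfolding l1 l2 by (simp add: l3 algebra_simps)
  then show ?thesis using digamma_sum_bounds[OF \<beta>, of n] ln_fact_bounds[OF n] h by linarith
qed

lemma laguerre_variance:
  assumes \<beta>: "\<beta> > 0" and n: "n \<ge> 1"
  shows "\<bar>trigamma_sum \<beta> n - 2 * ln (real n) / \<beta>\<bar> \<le> 8 / \<beta>\<^sup>2 + 2 / \<beta>"
proof -
  have "\<bar>2 / \<beta> * harm n - 2 * ln (real n) / \<beta>\<bar> \<le> 2 / \<beta>"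
  proof -
    have "2 / \<beta> * harm n - 2 * ln (real n) / \<beta> = 2 / \<beta> * (harm n - ln (real n))" by (simp add: algebra_simps)
    moreover have "2 / \<beta> * (harm n - ln (real n)) \<le> 2 / \<beta> * 1" "0 \<le> 2 / \<beta> * (harm n - ln (real n))"
      using harm_ln_bounds[OF n] \<beta> by (intro mult_left_mono mult_nonneg_nonneg; simp)+
    ultimately show ?thesis by simp
  qed
  then show ?thesis using trigamma_sum_bounds[OF \<beta>, of n] by linarith
qed

text \<open>
  The summand \<open>s = n - 1\<close> of the first sum equals \<open>Digamma (\<beta> / 2 * n)\<close>, so both sums may be
  extended by one term.
\<close>

lemma gram_sums:
  assumes "n \<ge> 1"
  shows "digamma_sum \<beta> (n - 1) - (\<Sum>s<n - 1. Digamma (\<beta> / 2 * real n)) = digamma_sum \<beta> n - real n * Digamma (\<beta> / 2 * real n)"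
    and "trigamma_sum \<beta> (n - 1) - (\<Sum>s<n - 1. Polygamma 1 (\<beta> / 2 * real n)) = trigamma_sum \<beta> n - real n * Polygamma 1 (\<beta> / 2 * real n)"
proof -
  obtain k where k: "n = Suc k" using assms by (cases n) auto
  show "digamma_sum \<beta> (n - 1) - (\<Sum>s<n - 1. Digamma (\<beta> / 2 * real n)) = digamma_sum \<beta> n - real n * Digamma (\<beta> / 2 * real n)"
    "trigamma_sum \<beta> (n - 1) - (\<Sum>s<n - 1. Polygamma 1 (\<beta> / 2 * real n)) = trigamma_sum \<beta> n - real n * Polygamma 1 (\<beta> / 2 * real n)"
    by (simp_all add: k digamma_sum_def trigamma_sum_def distrib_right add.commute)
qed

lemma gram_mean:
  assumes \<beta>: "\<beta> > 0" and n: "n \<ge> 1"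
  shows "\<bar>ln 1 + digamma_sum \<beta> (n - 1) - (\<Sum>s<n - 1. Digamma (\<beta> / 2 * real n)) - centering Gram \<beta> \<tau>1 \<tau>2 n\<bar> \<le> 3 / \<beta>\<^sup>2 + 1 + 1 / \<beta>"
proof -
  let ?n = "real n" and ?x = "\<beta> / 2 * real n"
  have n1: "?n \<ge> 1" using n by simp
  have x: "?x > 0" using \<beta> n by simp
  have lx: "ln ?x = ln (\<beta> / 2) + ln ?n" using \<beta> n by (intro ln_mult_pos) auto
  have h: "\<bar>harm n / \<beta> - ln ?n / \<beta>\<bar> \<le> 1 / \<beta>"
    unfolding diff_divide_distrib[symmetric] using harm_ln_bounds[OF n] \<beta> by (simp add: divide_right_mono)
  have d: "\<bar>?n * Digamma ?x - (?n * ln ?x - 1 / \<beta>)\<bar> \<le> 1 / \<beta>\<^sup>2"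
  proof -
    have "?n * (ln ?x - 1 / (2 * ?x)) = ?n * ln ?x - 1 / \<beta>" using \<beta> n by (simp add: field_simps)
    then have "\<bar>?n * Digamma ?x - (?n * ln ?x - 1 / \<beta>)\<bar> = ?n * \<bar>Digamma ?x - (ln ?x - 1 / (2 * ?x))\<bar>"
      using n1 by (simp only: abs_mult[of ?n, symmetric, simplified abs_of_nonneg] right_diff_distrib[symmetric]) (simp add: abs_mult right_diff_distrib)
    also have "\<dots> \<le> ?n * (1 / (4 * ?x\<^sup>2))"
      using digamma_bounds[OF x] by (intro mult_left_mono) (auto simp: abs_le_iff)
    also have "\<dots> = 1 / \<beta>\<^sup>2 * (1 / ?n)" using n1 \<beta> by (simp add: power2_eq_square field_simps)
    also have "\<dots> \<le> 1 / \<beta>\<^sup>2 * 1" using n1 by (intro mult_left_mono) auto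
    finally show ?thesis by simp
  qed
  have "ln 1 + digamma_sum \<beta> (n - 1) - (\<Sum>s<n - 1. Digamma (\<beta> / 2 * real n)) - centering Gram \<beta> \<tau>1 \<tau>2 n =
      (digamma_sum \<beta> n - (?n * ln (\<beta> / 2) + ln (fact n) - harm n / \<beta>))
      + (ln (fact n) - ((?n + 1 / 2) * ln ?n - ?n)) - (harm n / \<beta> - ln ?n / \<beta>)
      - (?n * Digamma ?x - (?n * ln ?x - 1 / \<beta>))"
  proof -
    have "ln 1 + digamma_sum \<beta> (n - 1) - (\<Sum>s<n - 1. Digamma ?x) = digamma_sum \<beta> n - ?n * Digamma ?x"
      using gram_sums(1)[OF n, of \<beta>] by simp
    then show ?thesis unfolding lx by (simp only:) (simp add: algebra_simps)
  qed
  moreover have "3 / \<beta>\<^sup>2 = 2 / \<beta>\<^sup>2 + 1 / \<beta>\<^sup>2" by (simp add: add_divide_distrib[symmetric])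
  ultimately show ?thesis using digamma_sum_bounds[OF \<beta>, of n] ln_fact_bounds[OF n] h d by linarith
qed

lemma gram_variance:
  assumes \<beta>: "\<beta> > 0" and n: "n \<ge> 1"
  shows "\<bar>trigamma_sum \<beta> (n - 1) - (\<Sum>s<n - 1. Polygamma 1 (\<beta> / 2 * real n)) - 2 * ln (real n) / \<beta>\<bar> \<le> 12 / \<beta>\<^sup>2 + 4 / \<beta>"
proof -
  let ?n = "real n" and ?x = "\<beta> / 2 * real n"
  have n1: "?n \<ge> 1" using n by simp
  have x: "?x > 0" using \<beta> n by simp
  have "?n * Polygamma 1 ?x \<le> ?n * (1 / ?x + 1 / ?x\<^sup>2)" using trigamma_bounds(2)[OF x] by (intro mult_left_mono) auto
  also have "\<dots> = 2 / \<beta> + 4 / \<beta>\<^sup>2 * (1 / ?n)" using n1 \<beta> by (simp add: power2_eq_square field_simps)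
  also have "\<dots> \<le> 2 / \<beta> + 4 / \<beta>\<^sup>2 * 1" using n1 by (intro add_left_mono mult_left_mono) auto
  finally have "?n * Polygamma 1 ?x \<le> 2 / \<beta> + 4 / \<beta>\<^sup>2" by simp
  moreover have "?n * Polygamma 1 ?x \<ge> 0"
  proof -
    have "1 / ?x > 0" using x by simp
    then have "Polygamma 1 ?x \<ge> 0" using trigamma_bounds(1)[OF x] by linarith
    then show ?thesis by simp
  qed
  moreover have "12 / \<beta>\<^sup>2 = 8 / \<beta>\<^sup>2 + 4 / \<beta>\<^sup>2" "4 / \<beta> = 2 / \<beta> + 2 / \<beta>" by (simp_all add: add_divide_distrib[symmetric])
  ultimately show ?thesis using laguerre_variance[OF \<beta> n] unfolding gram_sums(2)[OF n] by linarith
qed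

lemma gram_error:
  assumes \<beta>: "\<beta> > 0"
  shows "(\<Sum>s<n - 1. cubic_error (\<beta> / 2 * real n)) \<le> 8 / \<beta>\<^sup>2 + 16 / \<beta> ^ 3"
proof -
  have "(\<Sum>s<n - 1. cubic_error (\<beta> / 2 * real n)) \<le> (\<Sum>s<n - 1. cubic_error (\<beta> / 2 * (real s + 1)))"
    using \<beta> by (intro sum_mono cubic_error_mono) auto
  then show ?thesis using sum_cubic_error_le[OF \<beta>, of "n - 1"] by linarith
qed

text \<open>
  For \<open>s + 1 \<le> n / 2\<close> the parameter \<open>\<beta> / 2 * n\<close> of the denominator is at least twice that of the
  numerator.
\<close>

lemma gram_decay:
  assumes \<beta>: "\<beta> > 0"
  shows "\<forall>\<^sub>F n in sequentially. \<exists>K'\<le>n - 1. real n \<le> (real K')\<^sup>2 \<and>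
       dominating_shifts \<beta> (n - 1) K' (n - 1) (\<lambda>_. \<beta> / 2 * real n)"
proof -
  have "\<forall>\<^sub>F n in sequentially. real n \<ge> 4 / \<beta>"
    using filterlim_real_sequentially by (simp add: filterlim_at_top)
  then show ?thesis using eventually_ge_at_top[of 16]
  proof eventually_elim
    case (elim n)
    have half: "real n / 2 - 1 / 2 \<le> real (n div 2)" "real (n div 2) \<le> real n / 2" by linarith+
    show ?case unfolding dominating_shifts_def
    proof (intro exI[of _ "n div 2"] conjI disjI2 allI impI refl)
      show "n div 2 \<le> n - 1" using elim by linarith
      have "real n \<le> (real n / 2 - 1 / 2)\<^sup>2"
      proof -
        have "16 * real n \<le> real n * real n" using elim by (intro mult_right_mono) auto
        moreover have "(real n / 2 - 1 / 2)\<^sup>2 = (real n * real n - 2 * real n + 1) / 4"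
          by (simp add: power2_eq_square field_simps)
        moreover have "x \<le> (y - 2 * x + 1) / 4" if "16 * x \<le> y" "x \<ge> 0" for x y :: real
          using that by (simp add: field_simps)
        ultimately show ?thesis by simp
      qed
      also have "\<dots> \<le> (real (n div 2))\<^sup>2" using half elim by (intro power_mono) auto
      finally show "real n \<le> (real (n div 2))\<^sup>2" .
    next
      fix s assume "s < n - 1"
      then show "\<beta> / 2 * (real s + 1) \<le> \<beta> / 2 * real n" using \<beta> by (intro mult_left_mono) auto
    next
      fix s assume "s < n div 2"
      then have s: "real s + 1 \<le> real n / 2" using half(2) by linarith
      then have le: "\<beta> / 2 * (real s + 1) \<le> \<beta> / 2 * (real n / 2)" using \<beta> by (intro mult_left_mono) auto
      then show "2 * (\<beta> / 2 * (real s + 1)) \<le> \<beta> / 2 * real n" by simp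
      have "1 \<le> \<beta> / 2 * (real n / 2)" using elim(1) \<beta> by (simp add: field_simps)
      then show "\<beta> / 2 * (real s + 1) + 1 \<le> \<beta> / 2 * real n" using le by simp
    qed
  qed
qed

lemma sum_shift_lessThan: "(\<Sum>s<m. f (M + s)) = (\<Sum>s<M + m. f s) - (\<Sum>s<M. f s)" for f :: "nat \<Rightarrow> real"
  by (induction m) simp_all

text \<open>
  The parameters of the denominators continue the arithmetic progression of the numerators.
\<close>

lemma jacobi_sums:
  "(\<Sum>s<m. Digamma (\<beta> / 2 * (real M + real s + 1))) = digamma_sum \<beta> (M + m) - digamma_sum \<beta> M"
  "(\<Sum>s<m. Polygamma 1 (\<beta> / 2 * (real M + real s + 1))) = trigamma_sum \<beta> (M + m) - trigamma_sum \<beta> M"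
  using sum_shift_lessThan[of "\<lambda>s. Digamma (\<beta> / 2 * (real s + 1))" M m]
    sum_shift_lessThan[of "\<lambda>s. Polygamma 1 (\<beta> / 2 * (real s + 1))" M m]
  by (simp_all add: digamma_sum_def trigamma_sum_def)

lemma harm_diff_le:
  assumes "1 \<le> m" "m \<le> M"
  shows "harm (M + m) - harm M \<in> {0..2::real}"
proof -
  have "ln (real (M + m)) \<le> ln (2 * real M)" using assms by (intro ln_mono) auto
  also have "\<dots> = ln 2 + ln (real M)" using assms by (simp add: ln_mult)
  finally have "harm (M + m) - harm M \<le> (2::real)"
    using harm_ln_bounds[of "M + m"] harm_ln_bounds[of M] assms ln_2_less_1 by simp
  then show ?thesis using harm_mono[of M "M + m", where 'a = real] by simp
qed

text \<open>
  Stirling's formula for the three factorials in \<open>m! M! / (M + m)!\<close> produces the terms \<open>eps\<close>, and a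
  remainder \<open>(ln (m M / (M + m))) / 2\<close>, which equals \<open>(ln m) / 2\<close> up to a bounded error. The harmonic
  sum \<open>harm m / \<beta>\<close> contributes \<open>ln m / \<beta>\<close>, whereas \<open>harm (M + m) - harm M\<close> is bounded.
\<close>

lemma jacobi_centering_core:
  assumes \<beta>: "\<beta> > 0" and m: "1 \<le> m" "m \<le> M"
  shows "\<bar>digamma_sum \<beta> m - (digamma_sum \<beta> (M + m) - digamma_sum \<beta> M)
     - ((1 / 2 - 1 / \<beta>) * ln (real m) - eps (real m) (real M) - eps (real M) (real m))\<bar> \<le> 6 / \<beta>\<^sup>2 + 3 / \<beta> + 4"
proof -
  let ?m = "real m" and ?M = "real M" and ?N = "real (M + m)"
  have pos: "?m > 0" "?M > 0" "?m \<le> ?M" using m by auto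
  have N: "?N = ?M + ?m" by simp
  have e: "eps ?m ?M = ?m * (ln ?N - ln ?m)" "eps ?M ?m = ?M * (ln ?N - ln ?M)"
  proof -
    have "1 + ?M / ?m = ?N / ?m" "1 + ?m / ?M = ?N / ?M" using pos by (simp_all add: field_simps)
    then show "eps ?m ?M = ?m * (ln ?N - ln ?m)" "eps ?M ?m = ?M * (ln ?N - ln ?M)"
      using pos by (simp_all add: eps_def ln_div)
  qed
  have N2: "\<bar>ln ?N - ln ?M\<bar> \<le> 1"
  proof -
    have "ln ?M \<le> ln ?N" using pos by (intro ln_mono) auto
    moreover have "ln ?N \<le> ln (2 * ?M)" using pos by (intro ln_mono) auto
    moreover have "ln (2 * ?M) = ln 2 + ln ?M" using pos by (simp add: ln_mult)
    ultimately show ?thesis using ln_2_less_1 by linarith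
  qed
  define hm where "hm = harm m / \<beta> - ln ?m / \<beta>"
  define hM where "hM = harm (M + m) / \<beta> - harm M / \<beta>"
  have hm: "\<bar>hm\<bar> \<le> 1 / \<beta>"
    unfolding hm_def diff_divide_distrib[symmetric] using harm_ln_bounds[OF m(1)] \<beta> by (simp add: divide_right_mono)
  have hM: "\<bar>hM\<bar> \<le> 2 / \<beta>"
    unfolding hM_def diff_divide_distrib[symmetric] using harm_diff_le[OF m] \<beta> by (simp add: divide_right_mono)
  define S where "S = (\<lambda>k. digamma_sum \<beta> k - (real k * ln (\<beta> / 2) + ln (fact k) - harm k / \<beta>))"
  define T where "T = (\<lambda>k. ln (fact k) - ((real k + 1 / 2) * ln (real k) - real k))"
  have S: "\<bar>S k\<bar> \<le> 2 / \<beta>\<^sup>2" for k unfolding S_def by (rule digamma_sum_bounds[OF \<beta>])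
  have T: "\<bar>T m\<bar> \<le> 1" "\<bar>T M\<bar> \<le> 1" "\<bar>T (M + m)\<bar> \<le> 1"
    unfolding T_def using m by (auto intro!: ln_fact_bounds simp del: of_nat_add)
  have "digamma_sum \<beta> m - (digamma_sum \<beta> (M + m) - digamma_sum \<beta> M)
     - ((1 / 2 - 1 / \<beta>) * ln ?m - eps ?m ?M - eps ?M ?m)
     = S m - S (M + m) + S M + T m + T M - T (M + m) - hm + hM + (ln ?M - ln ?N) / 2"
    unfolding S_def T_def e hm_def hM_def by (simp add: algebra_simps add_divide_distrib diff_divide_distrib)
  moreover have "\<bar>s1 - s2 + s3 + t1 + t2 - t3 - h + h' + (y - x) / 2\<bar> \<le> 3 * p + 3 * q + 4"
    if "\<bar>s1\<bar> \<le> p" "\<bar>s2\<bar> \<le> p" "\<bar>s3\<bar> \<le> p" "\<bar>t1\<bar> \<le> 1" "\<bar>t2\<bar> \<le> 1" "\<bar>t3\<bar> \<le> 1"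
      "\<bar>h\<bar> \<le> q" "\<bar>h'\<bar> \<le> 2 * q" "\<bar>x - y\<bar> \<le> 1" for s1 s2 s3 t1 t2 t3 h h' x y p q :: real
    using that by (simp add: abs_le_iff field_simps)
  note this[OF S[of m] S[of "M + m"] S[of M] T hm _ N2]
  ultimately show ?thesis using hM by simp
qed

lemma jacobi_trigamma_tail:
  assumes \<beta>: "\<beta> > 0" and m: "1 \<le> m" "m \<le> M"
  shows "\<bar>trigamma_sum \<beta> (M + m) - trigamma_sum \<beta> M\<bar> \<le> 16 / \<beta>\<^sup>2 + 4 / \<beta>"
proof -
  have "2 / \<beta> * (harm (M + m) - harm M) \<le> 2 / \<beta> * 2" "0 \<le> 2 / \<beta> * (harm (M + m) - harm M)"
    using harm_diff_le[OF m] \<beta> by (intro mult_left_mono mult_nonneg_nonneg; simp)+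
  moreover have "2 / \<beta> * (harm (M + m) - harm M) = 2 / \<beta> * harm (M + m) - 2 / \<beta> * harm M" by (simp only: right_diff_distrib)
  moreover have "2 / \<beta> * 2 = 4 / \<beta>" "16 / \<beta>\<^sup>2 = 8 / \<beta>\<^sup>2 + 8 / \<beta>\<^sup>2" by (simp_all add: add_divide_distrib[symmetric])
  ultimately show ?thesis
    using trigamma_sum_bounds[OF \<beta>, of "M + m"] trigamma_sum_bounds[OF \<beta>, of M] by linarith
qed

lemma jacobi_error:
  assumes \<beta>: "\<beta> > 0"
  shows "(\<Sum>s<m. cubic_error (\<beta> / 2 * (real M + real s + 1))) \<le> 8 / \<beta>\<^sup>2 + 16 / \<beta> ^ 3"
proof -
  have "(\<Sum>s<m. cubic_error (\<beta> / 2 * (real M + real s + 1))) \<le> (\<Sum>s<m. cubic_error (\<beta> / 2 * (real s + 1)))"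
    using \<beta> by (intro sum_mono cubic_error_mono) auto
  then show ?thesis using sum_cubic_error_le[OF \<beta>, of m] by linarith
qed

lemma jacobi_sizes:
  assumes \<tau>: "\<tau>1 > 0" "\<tau>2 > 0"
  defines "m \<equiv> \<lambda>n. small_dim \<tau>1 \<tau>2 n"
  shows "\<forall>\<^sub>F n in sequentially. min \<tau>1 \<tau>2 / 2 * real n \<le> real (m n) \<and> real (m n) \<le> max \<tau>1 \<tau>2 * real n"
proof -
  have "\<forall>\<^sub>F n in sequentially. real n \<ge> 2 / min \<tau>1 \<tau>2"
    using filterlim_real_sequentially by (simp add: filterlim_at_top)
  then show ?thesis
  proof eventually_elim
    case (elim n)
    have floor: "real n * \<tau> - 1 \<le> real (nat \<lfloor>real n * \<tau>\<rfloor>) \<and> real (nat \<lfloor>real n * \<tau>\<rfloor>) \<le> real n * \<tau>" if "\<tau> > 0" for \<tau>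
    proof -
      have "real n * \<tau> \<ge> 0" using that by simp
      then have "\<lfloor>real n * \<tau>\<rfloor> \<ge> 0" by simp
      then show ?thesis by linarith
    qed
    have "min \<tau>1 \<tau>2 > 0" using \<tau> by simp
    then have "min \<tau>1 \<tau>2 * real n \<ge> 2" using elim by (simp add: field_simps)
    moreover have "min \<tau>1 \<tau>2 * real n \<le> real n * \<tau>1" "min \<tau>1 \<tau>2 * real n \<le> real n * \<tau>2"
      unfolding mult.commute[of "real n"] by (intro mult_right_mono; simp)+
    ultimately have "min \<tau>1 \<tau>2 / 2 * real n \<le> real n * \<tau>1 - 1" "min \<tau>1 \<tau>2 / 2 * real n \<le> real n * \<tau>2 - 1" by linarith+
    then have "min \<tau>1 \<tau>2 / 2 * real n \<le> real (nat \<lfloor>real n * \<tau>1\<rfloor>)" "min \<tau>1 \<tau>2 / 2 * real n \<le> real (nat \<lfloor>real n * \<tau>2\<rfloor>)"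
      using floor[OF \<tau>(1)] floor[OF \<tau>(2)] by linarith+
    then have "min \<tau>1 \<tau>2 / 2 * real n \<le> real (m n)"
      unfolding m_def of_nat_min by (rule min.boundedI)
    moreover have "real (m n) \<le> max \<tau>1 \<tau>2 * real n"
    proof -
      have "real (m n) \<le> real (nat \<lfloor>real n * \<tau>1\<rfloor>)" unfolding m_def by simp
      also have "\<dots> \<le> \<tau>1 * real n" using floor[OF \<tau>(1)] by (simp add: mult.commute)
      also have "\<dots> \<le> max \<tau>1 \<tau>2 * real n" by (intro mult_right_mono) auto
      finally show ?thesis .
    qed
    ultimately show ?case by blast
  qed
qed

lemma jacobi_centering_eq:
  fixes n :: nat
  assumes \<tau>: "\<tau>1 > 0" "\<tau>2 > 0"
  defines "m \<equiv> small_dim \<tau>1 \<tau>2 n" and "M \<equiv> large_dim \<tau>1 \<tau>2 n"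
  shows "centering Jacobi \<beta> \<tau>1 \<tau>2 n = (1 / 2 - 1 / \<beta>) * ln (real n) + (1 / 2 - 1 / \<beta>) * ln (\<tau>1 * \<tau>2 / (\<tau>1 + \<tau>2))
     - eps (real m) (real M) - eps (real M) (real m)"
proof -
  have f: "of_int \<lfloor>real n * \<tau>\<rfloor> = real (nat \<lfloor>real n * \<tau>\<rfloor>)" if "\<tau> > 0" for \<tau>
  proof -
    have "real n * \<tau> \<ge> 0" using that by simp
    then have "\<lfloor>real n * \<tau>\<rfloor> \<ge> 0" by simp
    then show ?thesis by simp
  qed
  show ?thesis unfolding centering.simps f[OF \<tau>(1)] f[OF \<tau>(2)] m_def M_def min_def max_def by auto
qed

lemma jacobi_log_size:
  assumes \<tau>: "\<tau>1 > 0" "\<tau>2 > (0::real)" and n: "n \<ge> (1::nat)"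
    and m: "min \<tau>1 \<tau>2 / 2 * real n \<le> real m" "real m \<le> max \<tau>1 \<tau>2 * real n"
  shows "m \<ge> 1" "\<bar>ln (real m) - ln (real n)\<bar> \<le> \<bar>ln (min \<tau>1 \<tau>2 / 2)\<bar> + \<bar>ln (max \<tau>1 \<tau>2)\<bar>"
proof -
  have c: "min \<tau>1 \<tau>2 / 2 > 0" "max \<tau>1 \<tau>2 > 0" using \<tau> by (auto simp: less_max_iff_disj)
  have n0: "real n > 0" using n by simp
  have "0 < min \<tau>1 \<tau>2 / 2 * real n" by (rule mult_pos_pos[OF c(1) n0])
  then have m0: "real m > 0" using m(1) by linarith
  then show "m \<ge> 1" by simp
  have "ln (min \<tau>1 \<tau>2 / 2 * real n) \<le> ln (real m)" using m(1) c n0 by (intro ln_mono mult_pos_pos) auto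
  moreover have "ln (real m) \<le> ln (max \<tau>1 \<tau>2 * real n)" using m(2) m0 by (intro ln_mono) auto
  moreover have "ln (min \<tau>1 \<tau>2 / 2 * real n) = ln (min \<tau>1 \<tau>2 / 2) + ln (real n)"
    "ln (max \<tau>1 \<tau>2 * real n) = ln (max \<tau>1 \<tau>2) + ln (real n)"
    by (rule ln_mult_pos[OF c(1) n0], rule ln_mult_pos[OF c(2) n0])
  ultimately show "\<bar>ln (real m) - ln (real n)\<bar> \<le> \<bar>ln (min \<tau>1 \<tau>2 / 2)\<bar> + \<bar>ln (max \<tau>1 \<tau>2)\<bar>" by linarith
qed

text \<open>
  Both dimensions are of exact order \<open>n\<close>, so \<open>ln m\<close> may be replaced by \<open>ln n\<close>. The constant
  \<open>ln (\<tau>1 * \<tau>2 / (\<tau>1 + \<tau>2))\<close> of the centering is absorbed into the bound.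
\<close>

lemma jacobi_mean:
  fixes n :: nat
  assumes \<beta>: "\<beta> > 0" and \<tau>: "\<tau>1 > 0" "\<tau>2 > 0" and n: "n \<ge> 1"
  defines "m \<equiv> small_dim \<tau>1 \<tau>2 n" and "M \<equiv> large_dim \<tau>1 \<tau>2 n"
  defines "l \<equiv> \<bar>ln (min \<tau>1 \<tau>2 / 2)\<bar> + \<bar>ln (max \<tau>1 \<tau>2)\<bar>"
  assumes m: "min \<tau>1 \<tau>2 / 2 * real n \<le> real m" "real m \<le> max \<tau>1 \<tau>2 * real n"
  shows "\<bar>ln 1 + digamma_sum \<beta> m - (\<Sum>s<m. Digamma (\<beta> / 2 * (real M + real s + 1))) - centering Jacobi \<beta> \<tau>1 \<tau>2 n\<bar>
      \<le> 6 / \<beta>\<^sup>2 + 3 / \<beta> + 4 + \<bar>1 / 2 - 1 / \<beta>\<bar> * (l + \<bar>ln (\<tau>1 * \<tau>2 / (\<tau>1 + \<tau>2))\<bar>)"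
    and "\<bar>trigamma_sum \<beta> m - (\<Sum>s<m. Polygamma 1 (\<beta> / 2 * (real M + real s + 1))) - 2 * ln (real n) / \<beta>\<bar>
      \<le> 24 / \<beta>\<^sup>2 + 6 / \<beta> + 2 / \<beta> * l"
proof -
  have m1: "1 \<le> m" and size: "\<bar>ln (real m) - ln (real n)\<bar> \<le> l"
    unfolding l_def using jacobi_log_size[OF \<tau> n m] by auto
  have mM: "m \<le> M" unfolding m_def M_def by simp
  let ?h = "1 / 2 - 1 / \<beta>"
  define c where "c = ln (\<tau>1 * \<tau>2 / (\<tau>1 + \<tau>2))"
  have "\<bar>?h * (ln (real m) - ln (real n) - c)\<bar> \<le> \<bar>?h\<bar> * (l + \<bar>c\<bar>)"
    unfolding abs_mult using size by (intro mult_left_mono) linarith+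
  moreover have "ln 1 + digamma_sum \<beta> m - (\<Sum>s<m. Digamma (\<beta> / 2 * (real M + real s + 1))) - centering Jacobi \<beta> \<tau>1 \<tau>2 n =
     (digamma_sum \<beta> m - (digamma_sum \<beta> (M + m) - digamma_sum \<beta> M)
     - (?h * ln (real m) - eps (real m) (real M) - eps (real M) (real m))) + ?h * (ln (real m) - ln (real n) - c)"
    unfolding jacobi_sums jacobi_centering_eq[OF \<tau>] m_def[symmetric] M_def[symmetric] c_def[symmetric]
    by (simp only: ln_one) (simp add: algebra_simps)
  ultimately show "\<bar>ln 1 + digamma_sum \<beta> m - (\<Sum>s<m. Digamma (\<beta> / 2 * (real M + real s + 1))) - centering Jacobi \<beta> \<tau>1 \<tau>2 n\<bar>
      \<le> 6 / \<beta>\<^sup>2 + 3 / \<beta> + 4 + \<bar>?h\<bar> * (l + \<bar>ln (\<tau>1 * \<tau>2 / (\<tau>1 + \<tau>2))\<bar>)"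
    using jacobi_centering_core[OF \<beta> m1 mM] unfolding c_def[symmetric] by linarith
  have "\<bar>2 / \<beta> * (ln (real m) - ln (real n))\<bar> \<le> 2 / \<beta> * l"
    unfolding abs_mult using size \<beta> by (intro mult_mono) auto
  moreover have "2 / \<beta> * (ln (real m) - ln (real n)) = 2 * ln (real m) / \<beta> - 2 * ln (real n) / \<beta>"
    by (simp add: algebra_simps diff_divide_distrib)
  moreover have "24 / \<beta>\<^sup>2 = 8 / \<beta>\<^sup>2 + 16 / \<beta>\<^sup>2" "6 / \<beta> = 2 / \<beta> + 4 / \<beta>" by (simp_all add: add_divide_distrib[symmetric])
  ultimately show "\<bar>trigamma_sum \<beta> m - (\<Sum>s<m. Polygamma 1 (\<beta> / 2 * (real M + real s + 1))) - 2 * ln (real n) / \<beta>\<bar>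
      \<le> 24 / \<beta>\<^sup>2 + 6 / \<beta> + 2 / \<beta> * l"
    using laguerre_variance[OF \<beta> m1] jacobi_trigamma_tail[OF \<beta> m1 mM] unfolding jacobi_sums by linarith
qed

text \<open>
  Here \<open>\<beta> / 2 * (M + s + 1)\<close> is at least twice \<open>\<beta> / 2 * (s + 1)\<close> for all \<open>s < m\<close>, since \<open>m \<le> M\<close>.
\<close>

lemma jacobi_decay:
  fixes \<tau>1 \<tau>2 :: real
  assumes \<beta>: "\<beta> > 0" and \<tau>: "\<tau>1 > 0" "\<tau>2 > 0"
  defines "m \<equiv> \<lambda>n. small_dim \<tau>1 \<tau>2 n" and "M \<equiv> \<lambda>n. large_dim \<tau>1 \<tau>2 n"
  shows "\<forall>\<^sub>F n in sequentially. \<exists>K'\<le>m n. real n \<le> (real K')\<^sup>2 \<and>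
       dominating_shifts \<beta> (m n) K' (m n) (\<lambda>s. \<beta> / 2 * (real (M n) + real s + 1))"
proof -
  define c where "c = min \<tau>1 \<tau>2 / 2"
  have c: "c > 0" using \<tau> by (simp add: c_def)
  have "\<forall>\<^sub>F n in sequentially. real n \<ge> 1 / c\<^sup>2" "\<forall>\<^sub>F n in sequentially. real n \<ge> 2 / (\<beta> * c)"
    using filterlim_real_sequentially by (simp_all add: filterlim_at_top)
  then show ?thesis using jacobi_sizes[OF \<tau>]
  proof eventually_elim
    case (elim n)
    have cm: "c * real n \<le> real (m n)" using elim(3) by (simp add: c_def m_def)
    have mM: "m n \<le> M n" by (simp add: m_def M_def)
    show ?case unfolding dominating_shifts_def
    proof (intro exI[of _ "m n"] conjI disjI2 allI impI refl order_refl)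
      have "real n * 1 \<le> real n * (c\<^sup>2 * real n)"
        using elim(1) c by (intro mult_left_mono) (auto simp: field_simps)
      also have "\<dots> = (c * real n)\<^sup>2" by (simp add: power2_eq_square)
      also have "\<dots> \<le> (real (m n))\<^sup>2" using cm c by (intro power_mono) auto
      finally show "real n \<le> (real (m n))\<^sup>2" by simp
    next
      fix s assume "s < m n"
      show "\<beta> / 2 * (real s + 1) \<le> \<beta> / 2 * (real (M n) + real s + 1)"
        using \<beta> by (intro mult_left_mono) auto
    next
      fix s assume "s < m n"
      then have s: "real s + 1 \<le> real (M n)" using mM by simp
      have "\<beta> / 2 * (real s + 1 + (real s + 1)) \<le> \<beta> / 2 * (real (M n) + real s + 1)"
        using s \<beta> by (intro mult_left_mono) auto
      then show "2 * (\<beta> / 2 * (real s + 1)) \<le> \<beta> / 2 * (real (M n) + real s + 1)" by (simp add: algebra_simps)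
      have "1 \<le> \<beta> / 2 * (c * real n)" using elim(2) \<beta> c by (simp add: field_simps)
      also have "\<dots> \<le> \<beta> / 2 * real (M n)"
        using cm mM \<beta> by (intro mult_left_mono) auto
      finally have le: "1 \<le> \<beta> / 2 * real (M n)" .
      have eq: "\<beta> / 2 * (real (M n) + real s + 1) = \<beta> / 2 * real (M n) + \<beta> / 2 * (real s + 1)"
        by (simp only: distrib_left add.assoc)
      show "\<beta> / 2 * (real s + 1) + 1 \<le> \<beta> / 2 * (real (M n) + real s + 1)"
        unfolding eq by (subst add.commute) (rule add_right_mono[OF le])
    qed
  qed
qed

section \<open>The local limit theorem for random determinants\<close>
theorem theorem4p13:
  fixes \<beta> \<tau>1 \<tau>2 a b \<delta> :: real
    and i :: ensemble
    and P :: "nat \<Rightarrow> 'w measure"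
    and detW :: "nat \<Rightarrow> 'w \<Rightarrow> real"
    and X :: "nat \<Rightarrow> 'w \<Rightarrow> real"
  assumes "\<beta> > 0" and "\<tau>1 > 0" and "\<tau>2 > 0"
    and "a < b"
    and "- 1 / 2 < \<delta>" and "\<delta> < 1"
    and "\<And>n. n \<ge> 1 \<Longrightarrow> prob_space (P n)"
    and "\<And>n. n \<ge> 1 \<Longrightarrow> ensemble_det i \<beta> \<tau>1 \<tau>2 n (P n) (detW n)"
    and "\<And>n \<omega>. X n \<omega> = ln (detW n \<omega>) - centering i \<beta> \<tau>1 \<tau>2 n"
  shows "(\<lambda>n. (2 * ln (real n) / \<beta>) powr (\<delta> + 1 / 2)
            * measure (P n) {\<omega> \<in> space (P n).
                X n \<omega> \<in> {(\<beta> / (2 * ln (real n))) powr \<delta> * a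
                         <..< (\<beta> / (2 * ln (real n))) powr \<delta> * b}})
         \<longlonglongrightarrow> (b - a) / sqrt (2 * pi)"
proof -
  note \<beta> = assms(1) and \<tau> = assms(2,3) and prob = assms(7)
  have det: "ensemble_det i \<beta> \<tau>1 \<tau>2 n (P n) (detW n)" if "n \<ge> 1" for n
    using assms(8)[OF that] .
  let ?e = "8 / \<beta>\<^sup>2 + 16 / \<beta> ^ 3"
  have ge1: "\<forall>\<^sub>F n::nat in sequentially. n \<ge> 1" by (rule eventually_ge_at_top)
  show ?thesis
  proof (cases i)
    case Laguerre
    define B where "B = Max {2 / \<beta>\<^sup>2 + 1 + 1 / \<beta>, 8 / \<beta>\<^sup>2 + 2 / \<beta>, 0}"
    have B: "2 / \<beta>\<^sup>2 + 1 + 1 / \<beta> \<le> B" "8 / \<beta>\<^sup>2 + 2 / \<beta> \<le> B" "0 \<le> B" by (auto simp: B_def)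
    show ?thesis
    proof (rule local_limit_from_mellin_recursion[OF \<beta> assms(4) assms(5) prob, where Y = "\<lambda>n \<omega>. ln (detW n \<omega>)"
        and C = "\<lambda>n. 2 ^ n" and K = "\<lambda>n. n" and L = "\<lambda>_. 0" and den = "\<lambda>_ _. 0" and B = B and \<mu> = "centering i \<beta> \<tau>1 \<tau>2"])
      show "mellin_recursion (P n) (\<lambda>\<omega>. ln (detW n \<omega>)) (2 ^ n) n (\<lambda>s. \<beta> / 2 * (real s + 1)) 0 (\<lambda>_. 0)" if "n \<ge> 1" for n
        using mellin_recursion_laguerre[OF \<beta>] det[OF that] Laguerre by blast
      show "\<forall>\<^sub>F n in sequentially. \<exists>K'\<le>n. real n \<le> (real K')\<^sup>2 \<and> dominating_shifts \<beta> n K' 0 (\<lambda>_. 0)"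
        using ge1
      proof eventually_elim
        case (elim n)
        have "real n * 1 \<le> real n * real n" using elim by (intro mult_left_mono) auto
        then show ?case by (intro exI[of _ n]) (simp add: power2_eq_square dominating_shifts_def)
      qed
      show "\<forall>\<^sub>F n in sequentially. \<bar>ln (2 ^ n) + digamma_sum \<beta> n - (\<Sum>s<(0::nat). Digamma 0) - centering i \<beta> \<tau>1 \<tau>2 n\<bar> \<le> B"
        using ge1
      proof eventually_elim
        case (elim n)
        then show ?case using laguerre_mean[OF \<beta> elim, of \<tau>1 \<tau>2] B(1) unfolding Laguerre by simp
      qed
      show "\<forall>\<^sub>F n in sequentially. \<bar>trigamma_sum \<beta> n - (\<Sum>s<(0::nat). Polygamma 1 0) - 2 * ln (real n) / \<beta>\<bar> \<le> B"
        using ge1 by eventually_elim (use laguerre_variance[OF \<beta>] B(2) in \<open>auto intro: order_trans\<close>)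
    qed (use assms(9) B(3) in auto)
  next
    case Gram
    define B where "B = Max {3 / \<beta>\<^sup>2 + 1 + 1 / \<beta>, 12 / \<beta>\<^sup>2 + 4 / \<beta>, ?e}"
    have B: "3 / \<beta>\<^sup>2 + 1 + 1 / \<beta> \<le> B" "12 / \<beta>\<^sup>2 + 4 / \<beta> \<le> B" "?e \<le> B" by (auto simp: B_def)
    show ?thesis
    proof (rule local_limit_from_mellin_recursion[OF \<beta> assms(4) assms(5) prob, where Y = "\<lambda>n \<omega>. ln (detW n \<omega>)"
        and C = "\<lambda>_. 1" and K = "\<lambda>n. n - 1" and L = "\<lambda>n. n - 1" and den = "\<lambda>n _. \<beta> / 2 * real n" and B = B and \<mu> = "centering i \<beta> \<tau>1 \<tau>2"])
      show "mellin_recursion (P n) (\<lambda>\<omega>. ln (detW n \<omega>)) 1 (n - 1) (\<lambda>s. \<beta> / 2 * (real s + 1)) (n - 1) (\<lambda>_. \<beta> / 2 * real n)" if "n \<ge> 1" for n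
        using mellin_recursion_gram[OF \<beta> prob[OF that]] det[OF that] Gram by blast
      show "\<forall>\<^sub>F n in sequentially. \<forall>s<n - 1. \<beta> / 2 * real n > 0"
        using ge1 by eventually_elim (use \<beta> in auto)
      show "\<forall>\<^sub>F n in sequentially. \<bar>ln 1 + digamma_sum \<beta> (n - 1) - (\<Sum>s<n - 1. Digamma (\<beta> / 2 * real n)) - centering i \<beta> \<tau>1 \<tau>2 n\<bar> \<le> B"
        using ge1
      proof eventually_elim
        case (elim n)
        show ?case using gram_mean[OF \<beta> elim, of \<tau>1 \<tau>2] B(1) unfolding Gram by (rule order_trans)
      qed
      show "\<forall>\<^sub>F n in sequentially. \<bar>trigamma_sum \<beta> (n - 1) - (\<Sum>s<n - 1. Polygamma 1 (\<beta> / 2 * real n)) - 2 * ln (real n) / \<beta>\<bar> \<le> B"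
        using ge1
      proof eventually_elim
        case (elim n)
        show ?case using gram_variance[OF \<beta> elim] B(2) by (rule order_trans)
      qed
      show "\<forall>\<^sub>F n in sequentially. (\<Sum>s<n - 1. cubic_error (\<beta> / 2 * real n)) \<le> B"
        using order_trans[OF gram_error[OF \<beta>] B(3)] by (intro always_eventually allI)
    qed (use assms(9) gram_decay[OF \<beta>] in auto)
  next
    case Jacobi
    define m where "m = (\<lambda>n::nat. small_dim \<tau>1 \<tau>2 n)"
    define M where "M = (\<lambda>n::nat. large_dim \<tau>1 \<tau>2 n)"
    define l where "l = \<bar>ln (min \<tau>1 \<tau>2 / 2)\<bar> + \<bar>ln (max \<tau>1 \<tau>2)\<bar>"
    define b1 where "b1 = 6 / \<beta>\<^sup>2 + 3 / \<beta> + 4 + \<bar>1 / 2 - 1 / \<beta>\<bar> * (l + \<bar>ln (\<tau>1 * \<tau>2 / (\<tau>1 + \<tau>2))\<bar>)"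
    define b2 where "b2 = 24 / \<beta>\<^sup>2 + 6 / \<beta> + 2 / \<beta> * l"
    define B where "B = Max {b1, b2, ?e}"
    have B: "b1 \<le> B" "b2 \<le> B" "?e \<le> B" by (auto simp: B_def)
    show ?thesis
    proof (rule local_limit_from_mellin_recursion[OF \<beta> assms(4) assms(5) prob, where Y = "\<lambda>n \<omega>. ln (detW n \<omega>)"
        and C = "\<lambda>_. 1" and K = m and L = m and den = "\<lambda>n s. \<beta> / 2 * (real (M n) + real s + 1)" and B = B and \<mu> = "centering i \<beta> \<tau>1 \<tau>2"])
      show "mellin_recursion (P n) (\<lambda>\<omega>. ln (detW n \<omega>)) 1 (m n) (\<lambda>s. \<beta> / 2 * (real s + 1)) (m n) (\<lambda>s. \<beta> / 2 * (real (M n) + real s + 1))" if "n \<ge> 1" for n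
        unfolding m_def M_def using mellin_recursion_jacobi[OF \<beta>] det[OF that] Jacobi by blast
      show "\<forall>\<^sub>F n in sequentially. \<forall>s<m n. \<beta> / 2 * (real (M n) + real s + 1) > 0"
        using \<beta> by (intro always_eventually allI impI mult_pos_pos) auto
      show "\<forall>\<^sub>F n in sequentially. \<exists>K'\<le>m n. real n \<le> (real K')\<^sup>2 \<and>
          dominating_shifts \<beta> (m n) K' (m n) (\<lambda>s. \<beta> / 2 * (real (M n) + real s + 1))"
        unfolding m_def M_def by (rule jacobi_decay[OF \<beta> \<tau>])
      show "\<forall>\<^sub>F n in sequentially. \<bar>ln 1 + digamma_sum \<beta> (m n) - (\<Sum>s<m n. Digamma (\<beta> / 2 * (real (M n) + real s + 1))) - centering i \<beta> \<tau>1 \<tau>2 n\<bar> \<le> B"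
        using ge1 jacobi_sizes[OF \<tau>]
      proof eventually_elim
        case (elim n)
        show ?case using jacobi_mean(1)[OF \<beta> \<tau> elim(1)] elim(2) B(1)
          unfolding Jacobi m_def M_def b1_def l_def by (meson order_trans)
      qed
      show "\<forall>\<^sub>F n in sequentially. \<bar>trigamma_sum \<beta> (m n) - (\<Sum>s<m n. Polygamma 1 (\<beta> / 2 * (real (M n) + real s + 1))) - 2 * ln (real n) / \<beta>\<bar> \<le> B"
        using ge1 jacobi_sizes[OF \<tau>]
      proof eventually_elim
        case (elim n)
        show ?case using jacobi_mean(2)[OF \<beta> \<tau> elim(1)] elim(2) B(2)
          unfolding m_def M_def b2_def l_def by (meson order_trans)
      qed
      show "\<forall>\<^sub>F n in sequentially. (\<Sum>s<m n. cubic_error (\<beta> / 2 * (real (M n) + real s + 1))) \<le> B"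
        using order_trans[OF jacobi_error[OF \<beta>] B(3)] by (intro always_eventually allI)
    qed (use assms(9) in auto)
  qed
qed

end
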